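(* Assume $B\equiv0$. Then $k_\varepsilon$ converges as $\varepsilon\to0$ and $$\lim_{\varepsilon\to0}k_\varepsilon=\max_{y\in\overline{\mathcal Y}}k^y.$$
   Context: Let $n,p\geq1$ and $\alpha\in(0,1)$. $\mathcal Y$ is either the torus $\mathbb T^n=\mathbb R^n/\mathbb Z^n$ or an open bounded domain in $\mathbb R^n$ with $\mathcal C^{2,\alpha}$ boundary; $\mathcal Z$ is either the torus $\mathbb T^p$ or an open bounded domain in $\mathbb R^p$ with $\mathcal C^{2,\alpha}$ boundary; at least one of $\mathcal Y,\mathcal Z$ is a torus. Set $\mathcal W=\mathcal Y\times\mathcal Z$; if $\partial\mathcal W\neq\emptyset$, $\nu$ is the outward unit normal on $\partial\mathcal W$; if $\partial\mathcal Z\ne\emptyset$, $\nu_2$ is the outward unit normal on $\partial\mathcal Z$. Boundary conditions are required only on nonempty boundaries. Coefficients: $A\in\mathcal C^{2,\alpha}(\overline{\mathcal Y},M_n(\mathbb R))$, $a\in\mathcal C^{2,\alpha}(\overline{\mathcal Z},M_p(\mathbb R))$, symmetric-matrix valued and uniformly elliptic (there are constants $\overline A>\underline A>0$, $\overline a>\underline a>0$ with $\underline A|\xi|^2\le\xi\cdot A(y)\xi\le\overline A|\xi|^2$ and $\underline a|\xi'|^2\le\xi'\cdot a(z)\xi'\le\overline a|\xi'|^2$ for all $y\in\overline{\mathcal Y}$, $z\in\overline{\mathcal Z}$, $\xi\in\mathbb R^n$, $\xi'\in\mathbb R^p$); $B\in\mathcal C^{1,\alpha}(\overline{\mathcal Y},\mathbb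 R^n)$, $b\in\mathcal C^{1,\alpha}(\overline{\mathcal Z},\mathbb R^p)$; $c\in\mathcal C^{0,1}(\overline{\mathcal W})$ (Lipschitz). Thus $A,B$ depend only on $y$, $a,b$ only on $z$, and $c$ on $(y,z)$. If $\partial\mathcal W\neq\emptyset$, assume $\begin{pmatrix}B\\ b\end{pmatrix}\cdot\nu=0$ on $\partial\mathcal W$. Let $\mathcal A=\begin{pmatrix}A&0\\0&a\end{pmatrix}$. Operators: $\mathcal L_y^\varepsilon\phi=\varepsilon^2\nabla_y\cdot(A\nabla_y\phi)+\varepsilon\nabla_y\cdot(\phi B)$ and $\mathcal L_z\phi=\nabla_z\cdot(a\nabla_z\phi)+\nabla_z\cdot(\phi b)$. Global eigenvalue problem: for $\varepsilon>0$, $(\varphi_\varepsilon,k_\varepsilon)\in\mathcal C^{2,\alpha}(\mathcal W)\times\mathbb R$ is the (unique) solution of $(\mathcal L_y^\varepsilon+\mathcal L_z+c)\varphi_\varepsilon=k_\varepsilon\varphi_\varepsilon$ in $\mathcal W$, $\varphi_\varepsilon>0$ in $\mathcal W$, $\nu\cdot\mathcal A\nabla\varphi_\varepsilon=0$ on $\partial\mathcal W$, $\int_{\mathcal W}\varphi_\varepsilon=1$. Local eigenvalue problem: for $y_0\in\overline{\mathcal Y}$, $(\psi^{y_0},k^{y_0})\in\mathcal C^{2,\alpha}(\mathcal Z)\times\mathbb R$ is the (unique) solution of $(\mathcal L_z+c(y_0,\cdot))\psi^{y_0}=k^{y_0}\psi^{y_0}$ in $\mathcal Z$, $\psi^{y_0}>0$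 in $\mathcal Z$, $\nu_2\cdot a\nabla\psi^{y_0}=0$ on $\partial\mathcal Z$, $\int_{\mathcal Z}\psi^{y_0}=1$. *)

theory Defs
  imports "HOL-Analysis.Analysis"
begin

section \<open>Derivatives up to the boundary and Hoelder spaces\<close>

text \<open>
  Derivatives of \<open>f\<close> are taken in the open set \<open>\<Omega>\<close>; at the other points of \<open>closure \<Omega>\<close> they
  denote the limit from inside \<open>\<Omega>\<close>, i.e. the continuous extension whenever there is one.
\<close>

definition partial_deriv ::
  "'a::euclidean_space set \<Rightarrow> 'a \<Rightarrow> ('a \<Rightarrow> 'b::real_normed_vector) \<Rightarrow> 'a \<Rightarrow> 'b" where
  "partial_deriv \<Omega> i f x =
     (if x \<in> \<Omega> then frechet_derivative f (at x) i
      else Lim (at x within \<Omega>) (\<lambda>x'. frechet_derivative f (at x') i))"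

definition grad :: "'a::euclidean_space set \<Rightarrow> ('a \<Rightarrow> real) \<Rightarrow> 'a \<Rightarrow> 'a" where
  "grad \<Omega> f x = (\<Sum>i\<in>Basis. partial_deriv \<Omega> i f x *\<^sub>R i)"

definition divg :: "'a::euclidean_space set \<Rightarrow> ('a \<Rightarrow> 'a) \<Rightarrow> 'a \<Rightarrow> real" where
  "divg \<Omega> F x = (\<Sum>i\<in>Basis. partial_deriv \<Omega> i F x \<bullet> i)"

text \<open>
  The space $C^{k,\alpha}(\overline\Omega)$: all derivatives of order at most \<open>k\<close> are continuous up
  to the boundary, and those of order \<open>k\<close> are uniformly \<open>\<alpha>\<close>-Hoelder continuous.
\<close>

primrec holder_on ::
  "nat \<Rightarrow> real \<Rightarrow> 'a::euclidean_space set \<Rightarrow> ('a \<Rightarrow> 'b::real_normed_vector) \<Rightarrow> bool" where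
  "holder_on 0 \<alpha> \<Omega> f \<longleftrightarrow>
     (\<exists>C. \<forall>x\<in>closure \<Omega>. \<forall>x'\<in>closure \<Omega>. dist (f x) (f x') \<le> C * dist x x' powr \<alpha>)"
| "holder_on (Suc k) \<alpha> \<Omega> f \<longleftrightarrow>
     continuous_on (closure \<Omega>) f \<and> f differentiable_on \<Omega> \<and>
     (\<forall>i\<in>Basis. holder_on k \<alpha> \<Omega> (partial_deriv \<Omega> i f))"

section \<open>Domains\<close>

text \<open>
  Near each boundary point \<open>\<Omega>\<close> is the region above the graph of a $C^{k,\alpha}$ function, in the
  direction \<open>e\<close>.  A function on the hyperplane orthogonal to \<open>e\<close> is encoded as a function on the
  whole space that is constant along \<open>e\<close>.
\<close>

definition holder_boundary :: "nat \<Rightarrow> real \<Rightarrow> 'a::euclidean_space set \<Rightarrow> bool" where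
  "holder_boundary k \<alpha> \<Omega> \<longleftrightarrow>
     (\<forall>x0\<in>frontier \<Omega>. \<exists>r e \<gamma>. r > 0 \<and> norm e = 1 \<and>
        (\<forall>x t. \<gamma> (x + t *\<^sub>R e) = \<gamma> x) \<and> holder_on k \<alpha> (ball x0 r) \<gamma> \<and>
        \<Omega> \<inter> ball x0 r = {x \<in> ball x0 r. \<gamma> x < x \<bullet> e})"

text \<open>
  The outward unit normal at \<open>x \<in> frontier \<Omega>\<close> is the normalised gradient of a local defining
  function \<open>\<rho>\<close> of \<open>\<Omega>\<close>; its direction does not depend on the choice of \<open>\<rho>\<close>.
\<close>

definition outward_unit_normal :: "'a::euclidean_space set \<Rightarrow> 'a \<Rightarrow> 'a \<Rightarrow> bool" where
  "outward_unit_normal \<Omega> x \<nu> \<longleftrightarrow>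
     norm \<nu> = 1 \<and>
     (\<exists>r \<rho> d. r > 0 \<and> d > 0 \<and> \<rho> x = 0 \<and> (GDERIV \<rho> x :> d *\<^sub>R \<nu>) \<and>
        \<Omega> \<inter> ball x r = {x' \<in> ball x r. \<rho> x' < (0::real)})"

text \<open>
  The torus $\mathbb R^n/\mathbb Z^n$ is handled through its universal cover: functions on it are
  the functions on $\mathbb R^n$ invariant under integer translations, and integrals over it are
  integrals over the unit cube.  Since \<open>frontier UNIV = {}\<close>, a torus carries no boundary condition.
\<close>

datatype 'a space = Torus | Domain "'a set"

fun cover :: "'a space \<Rightarrow> 'a set" where
  "cover Torus = UNIV"
| "cover (Domain U) = U"

fun cell :: "(real^'n) space \<Rightarrow> (real^'n) set" where
  "cell Torus = cbox 0 1"
| "cell (Domain U) = U"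

fun descends :: "(real^'n) space \<Rightarrow> (real^'n \<Rightarrow> 'b) \<Rightarrow> bool" where
  "descends Torus f \<longleftrightarrow> (\<forall>x m. (\<forall>i. m $ i \<in> \<int>) \<longrightarrow> f (x + m) = f x)"
| "descends (Domain U) f \<longleftrightarrow> True"

fun admissible :: "real \<Rightarrow> (real^'n) space \<Rightarrow> bool" where
  "admissible \<alpha> Torus \<longleftrightarrow> True"
| "admissible \<alpha> (Domain U) \<longleftrightarrow>
     open U \<and> connected U \<and> U \<noteq> {} \<and> bounded U \<and> holder_boundary 2 \<alpha> U"

definition holder_space ::
  "nat \<Rightarrow> real \<Rightarrow> (real^'n) space \<Rightarrow> (real^'n \<Rightarrow> 'b::real_normed_vector) \<Rightarrow> bool" where
  "holder_space k \<alpha> S f \<longleftrightarrow> descends S f \<and> holder_on k \<alpha> (cover S) f"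

definition coverW :: "(real^'n) space \<Rightarrow> (real^'p) space \<Rightarrow> ((real^'n) \<times> (real^'p)) set" where
  "coverW Y Z = cover Y \<times> cover Z"

definition descendsW ::
  "(real^'n) space \<Rightarrow> (real^'p) space \<Rightarrow> ((real^'n) \<times> (real^'p) \<Rightarrow> 'b) \<Rightarrow> bool" where
  "descendsW Y Z f \<longleftrightarrow>
     (\<forall>z\<in>closure (cover Z). descends Y (\<lambda>y. f (y, z))) \<and>
     (\<forall>y\<in>closure (cover Y). descends Z (\<lambda>z. f (y, z)))"

section \<open>Operators and eigenvalue problems\<close>

definition symmetric_elliptic :: "(real^'n) space \<Rightarrow> (real^'n \<Rightarrow> real^'n^'n) \<Rightarrow> bool" where
  "symmetric_elliptic S A \<longleftrightarrow>
     (\<forall>x\<in>closure (cover S). transpose (A x) = A x) \<and>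
     (\<exists>lo hi. 0 < lo \<and> lo < hi \<and>
        (\<forall>x\<in>closure (cover S). \<forall>\<xi>.
           lo * (norm \<xi>)\<^sup>2 \<le> \<xi> \<bullet> (A x *v \<xi>) \<and> \<xi> \<bullet> (A x *v \<xi>) \<le> hi * (norm \<xi>)\<^sup>2))"

definition opLy ::
  "(real^'n) space \<Rightarrow> (real^'n \<Rightarrow> real^'n^'n) \<Rightarrow> (real^'n \<Rightarrow> real^'n) \<Rightarrow> real \<Rightarrow>
   (real^'n \<Rightarrow> real) \<Rightarrow> real^'n \<Rightarrow> real" where
  "opLy Y A B \<epsilon> f y =
     \<epsilon>\<^sup>2 * divg (cover Y) (\<lambda>y'. A y' *v grad (cover Y) f y') y +
     \<epsilon> * divg (cover Y) (\<lambda>y'. f y' *\<^sub>R B y') y"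

definition opLz ::
  "(real^'p) space \<Rightarrow> (real^'p \<Rightarrow> real^'p^'p) \<Rightarrow> (real^'p \<Rightarrow> real^'p) \<Rightarrow>
   (real^'p \<Rightarrow> real) \<Rightarrow> real^'p \<Rightarrow> real" where
  "opLz Z a b f z =
     divg (cover Z) (\<lambda>z'. a z' *v grad (cover Z) f z') z +
     divg (cover Z) (\<lambda>z'. f z' *\<^sub>R b z') z"

text \<open>The action of the block diagonal matrix with blocks \<open>M\<close> and \<open>m\<close>.\<close>

definition block_diag_mult ::
  "real^'n^'n \<Rightarrow> real^'p^'p \<Rightarrow> (real^'n) \<times> (real^'p) \<Rightarrow> (real^'n) \<times> (real^'p)" where
  "block_diag_mult M m v = (M *v fst v, m *v snd v)"

definition global_eigenpair ::
  "real \<Rightarrow> (real^'n) space \<Rightarrow> (real^'p) space \<Rightarrow>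
   (real^'n \<Rightarrow> real^'n^'n) \<Rightarrow> (real^'n \<Rightarrow> real^'n) \<Rightarrow>
   (real^'p \<Rightarrow> real^'p^'p) \<Rightarrow> (real^'p \<Rightarrow> real^'p) \<Rightarrow>
   ((real^'n) \<times> (real^'p) \<Rightarrow> real) \<Rightarrow> real \<Rightarrow>
   ((real^'n) \<times> (real^'p) \<Rightarrow> real) \<Rightarrow> real \<Rightarrow> bool" where
  "global_eigenpair \<alpha> Y Z A B a b c \<epsilon> \<phi> k \<longleftrightarrow>
     descendsW Y Z \<phi> \<and> holder_on 2 \<alpha> (coverW Y Z) \<phi> \<and>
     (\<forall>(y, z)\<in>coverW Y Z.
        opLy Y A B \<epsilon> (\<lambda>y'. \<phi> (y', z)) y + opLz Z a b (\<lambda>z'. \<phi> (y, z')) z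
          + c (y, z) * \<phi> (y, z) = k * \<phi> (y, z)) \<and>
     (\<forall>w\<in>coverW Y Z. \<phi> w > 0) \<and>
     (\<forall>(y, z)\<in>frontier (coverW Y Z). \<forall>\<nu>. outward_unit_normal (coverW Y Z) (y, z) \<nu> \<longrightarrow>
        \<nu> \<bullet> block_diag_mult (A y) (a z) (grad (coverW Y Z) \<phi> (y, z)) = 0) \<and>
     (LINT w:cell Y \<times> cell Z|lborel. \<phi> w) = 1"

definition local_eigenpair ::
  "real \<Rightarrow> (real^'p) space \<Rightarrow> (real^'p \<Rightarrow> real^'p^'p) \<Rightarrow> (real^'p \<Rightarrow> real^'p) \<Rightarrow>
   ((real^'n) \<times> (real^'p) \<Rightarrow> real) \<Rightarrow> real^'n \<Rightarrow> (real^'p \<Rightarrow> real) \<Rightarrow> real \<Rightarrow> bool" where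
  "local_eigenpair \<alpha> Z a b c y0 \<psi> k \<longleftrightarrow>
     holder_space 2 \<alpha> Z \<psi> \<and>
     (\<forall>z\<in>cover Z. opLz Z a b \<psi> z + c (y0, z) * \<psi> z = k * \<psi> z) \<and>
     (\<forall>z\<in>cover Z. \<psi> z > 0) \<and>
     (\<forall>z\<in>frontier (cover Z). \<forall>\<nu>. outward_unit_normal (cover Z) z \<nu> \<longrightarrow>
        \<nu> \<bullet> (a z *v grad (cover Z) \<psi> z) = 0) \<and>
     (LINT z:cell Z|lborel. \<psi> z) = 1"

end

theory Submission
  imports Defs
begin

text \<open>
  The proof rests on the pointwise maximum principle.  The basic tool is the lemma \<open>touching\<close>: if \<open>f\<^sub>1 \<le> f\<^sub>2\<close> with equality at a point, and
  \<open>f\<^sub>1\<close> has conormal derivative zero on the boundary whereas that of \<open>f\<^sub>2\<close> is strictly positive,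
  then the contact point is interior, and there the operator applied to \<open>f\<^sub>1\<close> is at most the operator
  applied to \<open>f\<^sub>2\<close>.  At the contact point the inequality between the operators compares eigenvalues.

  Three devices make the required comparison functions available.

  \<^item> An eigenfunction is only known to be positive in the open domain, and its conormal derivative
    vanishes instead of being positive.  Adding a small function \<open>g\<close> of the form
    \<open>\<tau> (1 + \<rho> - M \<rho>\<^sup>2)\<close>, with \<open>\<rho>\<close> a defining function of the domain, repairs both defects:
    \<open>g\<close> is a strict supersolution near the boundary because of the concave term, and far from the
    boundary its contribution is absorbed by the positive lower bound of the eigenfunction.
    This is the lemma \<open>corrector\<close>.

  \<^item> Lower bound.  With \<open>\<psi>\<close> the local eigenfunction at an interior point \<open>y\<^sub>0\<close>, the function
    \<open>(\<delta>\<^sup>2 - |y - y\<^sub>0|\<^sup>2)\<^sup>2 \<psi>(z)\<close> is a subsolution: the bump costs only \<open>O(\<epsilon>\<^sup>2)\<close>, and freezing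
    \<open>c\<close> at \<open>y\<^sub>0\<close> costs \<open>L \<delta>\<close>.  Comparing it with the corrected global eigenfunction gives
    \<open>k\<^sub>\<epsilon> \<ge> k\<^sup>y\<^sup>0 - L \<delta> - O(\<epsilon>\<^sup>2)\<close>.

  \<^item> Upper bound.  Since \<open>c\<close> is only Lipschitz, \<open>\<psi>\<^sup>y\<close> cannot be differentiated twice in \<open>y\<close>.
    Instead one takes a finite \<open>\<delta>\<close>-net of points \<open>i\<close> and the minimum over \<open>i\<close> of
    \<open>exp (N |y - i|\<^sup>2 + K \<rho>(y)) \<Psi>\<^sub>i(z)\<close>, where \<open>\<Psi>\<^sub>i\<close> is the corrected local eigenfunction at \<open>i\<close>.
    A minimum of supersolutions is good enough for a touching argument, since only the active one
    matters; for \<open>N\<close> large the active \<open>i\<close> is within \<open>2\<delta>\<close> of \<open>y\<close>, and the factor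
    \<open>exp (K \<rho>)\<close> makes the conormal derivative positive.  This gives
    \<open>k\<^sub>\<epsilon> \<le> max k\<^sup>y + O(\<delta>) + O(\<epsilon>\<^sup>2)\<close>.

  The same comparison shows that \<open>y \<mapsto> k\<^sup>y\<close> is Lipschitz, so the maximum exists and is approximated
  from the interior.
\<close>

section \<open>Twice continuously differentiable functions\<close>

definition pd :: "'n \<Rightarrow> (real^'n \<Rightarrow> 'b::real_normed_vector) \<Rightarrow> real^'n \<Rightarrow> 'b" where
  "pd i f x = frechet_derivative f (at x) (axis i 1)"

text \<open>
  Only open sets \<open>U\<close> matter, so that the derivatives are determined by the function on \<open>U\<close>.
  Phrasing the continuity of derivatives on sets makes unions and restrictions immediate.
\<close>

definition C1on :: "(real^'n) set \<Rightarrow> (real^'n \<Rightarrow> real) \<Rightarrow> bool" where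
  "C1on U f \<longleftrightarrow> (\<forall>x\<in>U. f differentiable (at x)) \<and> (\<forall>i. continuous_on U (pd i f))"

definition C2on :: "(real^'n) set \<Rightarrow> (real^'n \<Rightarrow> real) \<Rightarrow> bool" where
  "C2on U f \<longleftrightarrow> (\<forall>x\<in>U. f differentiable (at x)) \<and> (\<forall>i. C1on U (pd i f))"

lemma pd_eqI: "(f has_derivative f') (at x) \<Longrightarrow> pd i f x = f' (axis i 1)"
  unfolding pd_def by (simp add: frechet_derivative_at[symmetric])

lemma pd_const [simp]: "pd i (\<lambda>x. c) = (\<lambda>x. 0)"
  by (rule ext, rule pd_eqI[OF has_derivative_const])

lemma pd_nth [simp]: "pd i (\<lambda>x::real^'n. x $ j) = (\<lambda>x. if i = j then 1 else 0)"
proof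
  fix x :: "real^'n"
  have "((\<lambda>x::real^'n. x $ j) has_derivative (\<lambda>h. h $ j)) (at x)"
    by (rule bounded_linear.has_derivative[OF bounded_linear_vec_nth has_derivative_ident])
  from pd_eqI[OF this, of i] show "pd i (\<lambda>x. x $ j) x = (if i = j then 1 else 0)"
    by (simp add: axis_def)
qed

lemma fderiv_works:
  "f differentiable (at x) \<Longrightarrow> (f has_derivative frechet_derivative f (at x)) (at x)"
  by (simp add: frechet_derivative_works[symmetric])

lemma pd_add:
  assumes "f differentiable (at x)" "g differentiable (at x)"
  shows "pd i (\<lambda>x. f x + g x) x = pd i f x + pd i g x"
  using pd_eqI[OF has_derivative_add[OF assms[THEN fderiv_works]]] by (simp add: pd_def)

lemma pd_mult:
  fixes f g :: "real^'n \<Rightarrow> real"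
  assumes "f differentiable (at x)" "g differentiable (at x)"
  shows "pd i (\<lambda>x. f x * g x) x = f x * pd i g x + pd i f x * g x"
  using pd_eqI[OF has_derivative_mult[OF assms[THEN fderiv_works]]] by (simp add: pd_def)

lemma pd_compose:
  fixes f :: "real^'n \<Rightarrow> real"
  assumes "f differentiable (at x)" "(p has_real_derivative q) (at (f x))"
  shows "(\<lambda>x. p (f x)) differentiable (at x)" "pd i (\<lambda>x. p (f x)) x = q * pd i f x"
proof -
  have *: "((\<lambda>x. p (f x)) has_derivative (\<lambda>h. q * frechet_derivative f (at x) h)) (at x)"
    using has_derivative_compose[OF fderiv_works[OF assms(1)]] assms(2)
    by (simp add: has_field_derivative_def)
  show "(\<lambda>x. p (f x)) differentiable (at x)" using * by (auto simp: differentiable_def)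
  show "pd i (\<lambda>x. p (f x)) x = q * pd i f x" using pd_eqI[OF *] by (simp add: pd_def)
qed

lemma pd_cong_open:
  assumes "open U" "x \<in> U" "\<And>y. y \<in> U \<Longrightarrow> f y = g y"
  shows "pd i f x = pd i g x"
proof (cases "f differentiable (at x)")
  case True
  show ?thesis
    unfolding pd_def
    by (rule frechet_derivative_transform_within_open[OF True assms(1,2), THEN fun_cong]) (use assms in auto)
next
  case False
  have "(f has_derivative F) (at x) \<longleftrightarrow> (g has_derivative F) (at x)" for F
    using has_derivative_transform_within_open[OF _ assms(1,2)] assms(3) by metis
  then show ?thesis
    by (simp add: pd_def frechet_derivative_def)
qed

lemma differentiable_cong_open:
  assumes "open U" "x \<in> U" "\<And>y. y \<in> U \<Longrightarrow> f y = g y" "f differentiable (at x)"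
  shows "g differentiable (at x)"
  using assms by (metis differentiable_def has_derivative_transform_within_open)

lemma fderiv_expand:
  fixes f :: "real^'n \<Rightarrow> real"
  assumes "f differentiable (at x)"
  shows "frechet_derivative f (at x) v = (\<Sum>i\<in>UNIV. v $ i * pd i f x)"
proof -
  interpret linear "frechet_derivative f (at x)" by (rule linear_frechet_derivative[OF assms])
  have "v = (\<Sum>i\<in>UNIV. v $ i *\<^sub>R axis i 1)"
    by (simp add: basis_expansion[of v, unfolded scalar_mult_eq_scaleR])
  then have "frechet_derivative f (at x) v = frechet_derivative f (at x) (\<Sum>i\<in>UNIV. v $ i *\<^sub>R axis i 1)"
    by simp
  also have "\<dots> = (\<Sum>i\<in>UNIV. v $ i * pd i f x)"
    by (simp add: sum scale pd_def)
  finally show ?thesis .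
qed

lemma C1on_D: "C1on U f \<Longrightarrow> x \<in> U \<Longrightarrow> f differentiable (at x)"
  by (simp add: C1on_def)

lemma C2on_D: "C2on U f \<Longrightarrow> x \<in> U \<Longrightarrow> f differentiable (at x)"
  "C2on U f \<Longrightarrow> x \<in> U \<Longrightarrow> pd i f differentiable (at x)"
  "C2on U f \<Longrightarrow> C1on U (pd i f)"
  by (auto simp: C2on_def C1on_def)

lemma C1on_continuous: "C1on U f \<Longrightarrow> continuous_on U f"
  by (meson C1on_D continuous_at_imp_continuous_on differentiable_imp_continuous_within)

lemma C2on_C1on: "C2on U f \<Longrightarrow> C1on U f"
  unfolding C1on_def[of U f] C2on_def using C1on_continuous by blast

lemma C2on_continuous: "C2on U f \<Longrightarrow> continuous_on U f"
  using C1on_continuous C2on_C1on by blast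

lemma C1on_subset: "C1on U f \<Longrightarrow> V \<subseteq> U \<Longrightarrow> C1on V f"
  unfolding C1on_def by (meson continuous_on_subset subsetD)

lemma C2on_subset: "C2on U f \<Longrightarrow> V \<subseteq> U \<Longrightarrow> C2on V f"
  unfolding C2on_def by (meson C1on_subset subsetD)

lemma C1on_cong:
  assumes "open U" "\<And>x. x \<in> U \<Longrightarrow> f x = g x" "C1on U f"
  shows "C1on U g"
  unfolding C1on_def
proof (intro conjI ballI allI)
  fix x assume "x \<in> U"
  then show "g differentiable at x"
    using differentiable_cong_open[OF assms(1)] assms by (meson C1on_D)
next
  fix i
  have "continuous_on U (pd i f)" using assms(3) by (auto simp: C1on_def)
  then show "continuous_on U (pd i g)"
    by (rule continuous_on_eq) (use assms(1,2) pd_cong_open[of U] in blast)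
qed

lemma C2on_cong:
  assumes "open U" "\<And>x. x \<in> U \<Longrightarrow> f x = g x" "C2on U f"
  shows "C2on U g"
  unfolding C2on_def
proof (intro conjI ballI allI)
  fix x assume "x \<in> U"
  then show "g differentiable at x"
    using differentiable_cong_open[OF assms(1)] assms by (meson C2on_D)
next
  fix i
  have "C1on U (pd i f)" using assms(3) by (auto simp: C2on_def)
  then show "C1on U (pd i g)"
    by (rule C1on_cong[OF assms(1), rotated]) (use assms(1,2) pd_cong_open[of U] in blast)
qed

lemma C1on_const: "C1on U (\<lambda>x. c)"
  by (simp add: C1on_def)

lemma C2on_const: "C2on U (\<lambda>x. c)"
  by (simp add: C2on_def C1on_const)

lemma C2on_nth: "C2on U (\<lambda>x. x $ j)"
  by (auto simp: C2on_def C1on_const intro!: bounded_linear_imp_differentiable bounded_linear_vec_nth)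

lemma C1on_add:
  assumes "C1on U f" "C1on U g" shows "C1on U (\<lambda>x. f x + g x)"
proof -
  have "continuous_on U (pd i (\<lambda>x. f x + g x))" for i
    by (rule continuous_on_eq[of _ "\<lambda>x. pd i f x + pd i g x"])
       (use assms in \<open>auto simp: C1on_def pd_add intro!: continuous_intros\<close>)
  then show ?thesis using assms by (auto simp: C1on_def)
qed

lemma C1on_mult:
  assumes "C1on U f" "C1on U g" shows "C1on U (\<lambda>x. f x * g x)"
proof -
  have "continuous_on U (pd i (\<lambda>x. f x * g x))" for i
    by (rule continuous_on_eq[of _ "\<lambda>x. f x * pd i g x + pd i f x * g x"])
       (use assms C1on_continuous in \<open>auto simp: C1on_def pd_mult intro!: continuous_intros\<close>)
  then show ?thesis using assms by (auto simp: C1on_def)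
qed

lemma C1on_compose:
  assumes "C1on U f" "\<And>t. (p has_real_derivative p' t) (at t)" "continuous_on UNIV p'"
  shows "C1on U (\<lambda>x. p (f x))"
proof -
  have "continuous_on U (pd i (\<lambda>x. p (f x)))" for i
  proof (rule continuous_on_eq[of _ "\<lambda>x. p' (f x) * pd i f x"])
    show "continuous_on U (\<lambda>x. p' (f x) * pd i f x)"
      using assms(1) C1on_continuous[OF assms(1)]
      by (auto simp: C1on_def intro!: continuous_intros continuous_on_compose2[OF assms(3)])
  qed (use assms pd_compose(2) in \<open>force simp: C1on_def\<close>)
  moreover have "(\<lambda>x. p (f x)) differentiable (at x)" if "x \<in> U" for x
    using pd_compose(1)[OF C1on_D[OF assms(1) that] assms(2)] .
  ultimately show ?thesis by (simp add: C1on_def)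
qed

lemma C2on_add:
  assumes "open U" "C2on U f" "C2on U g" shows "C2on U (\<lambda>x. f x + g x)"
proof -
  have "C1on U (pd i (\<lambda>x. f x + g x))" for i
    by (rule C1on_cong[OF assms(1), of "\<lambda>x. pd i f x + pd i g x"])
       (use assms in \<open>auto simp: C2on_def pd_add intro!: C1on_add\<close>)
  then show ?thesis using assms by (auto simp: C2on_def)
qed

lemma C2on_mult:
  assumes "open U" "C2on U f" "C2on U g" shows "C2on U (\<lambda>x. f x * g x)"
proof -
  have "C1on U (pd i (\<lambda>x. f x * g x))" for i
    by (rule C1on_cong[OF assms(1), of "\<lambda>x. f x * pd i g x + pd i f x * g x"])
       (use assms C2on_C1on in \<open>auto simp: C2on_def pd_mult intro!: C1on_add C1on_mult\<close>)
  then show ?thesis using assms by (auto simp: C2on_def)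
qed

lemma C2on_compose:
  assumes "open U" "C2on U f" "\<And>t. (p has_real_derivative p' t) (at t)"
    "\<And>t. (p' has_real_derivative p'' t) (at t)" "continuous_on UNIV p''"
  shows "C2on U (\<lambda>x. p (f x))"
proof -
  have "C1on U (pd i (\<lambda>x. p (f x)))" for i
  proof (rule C1on_cong[OF assms(1), of "\<lambda>x. p' (f x) * pd i f x"])
    show "C1on U (\<lambda>x. p' (f x) * pd i f x)"
      using assms(2) C2on_C1on C1on_mult C1on_compose[OF _ assms(4,5)] by (metis C2on_def)
    show "p' (f x) * pd i f x = pd i (\<lambda>x. p (f x)) x" if "x \<in> U" for x
      using pd_compose(2)[OF C2on_D(1)[OF assms(2) that] assms(3)] by simp
  qed
  moreover have "(\<lambda>x. p (f x)) differentiable (at x)" if "x \<in> U" for x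
    using pd_compose(1)[OF C2on_D(1)[OF assms(2) that] assms(3)] .
  ultimately show ?thesis by (simp add: C2on_def)
qed

lemma C2on_cmult: "open U \<Longrightarrow> C2on U f \<Longrightarrow> C2on U (\<lambda>x. c * f x)"
  using C2on_mult[OF _ C2on_const] by blast

lemma C2on_sum:
  assumes "open U" "\<And>k. k \<in> K \<Longrightarrow> C2on U (f k)"
  shows "C2on U (\<lambda>x. \<Sum>k\<in>K. f k x)"
  using assms(2)
proof (induction K rule: infinite_finite_induct)
  case (insert k K)
  then show ?case using C2on_add[OF assms(1)] by simp
qed (simp_all add: C2on_const)

lemma C2on_inner: "open U \<Longrightarrow> C2on U (\<lambda>x. x \<bullet> e)"
  unfolding inner_vec_def by (auto intro!: C2on_sum C2on_mult C2on_nth C2on_const)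

lemma C2on_sqdist:
  fixes e :: "real^'n"
  assumes U: "open U"
  shows "C2on U (\<lambda>x. (norm (x - e))\<^sup>2)"
proof -
  have "(norm (x - e))\<^sup>2 = (\<Sum>i\<in>UNIV. (x $ i + (- e $ i)) * (x $ i + (- e $ i)))" for x :: "real^'n"
    unfolding power2_norm_eq_inner inner_vec_def by simp
  moreover have "C2on U (\<lambda>x. \<Sum>i\<in>UNIV. (x $ i + (- e $ i)) * (x $ i + (- e $ i)))"
    by (intro C2on_sum C2on_mult C2on_add C2on_nth C2on_const U)
  ultimately show ?thesis by presburger
qed

lemma C2on_exp: "open U \<Longrightarrow> C2on U f \<Longrightarrow> C2on U (\<lambda>x. exp (f x))"
  by (erule C2on_compose[where p' = exp and p'' = exp]) (auto intro!: DERIV_exp continuous_intros)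

lemma C1on_Un: "open U \<Longrightarrow> open V \<Longrightarrow> C1on U f \<Longrightarrow> C1on V f \<Longrightarrow> C1on (U \<union> V) f"
  unfolding C1on_def using continuous_on_open_Un by blast

lemma C2on_Un: "open U \<Longrightarrow> open V \<Longrightarrow> C2on U f \<Longrightarrow> C2on V f \<Longrightarrow> C2on (U \<union> V) f"
  unfolding C2on_def using C1on_Un by blast

text \<open>
  The third power is the lowest one that is twice continuously differentiable at zero; composed with
  \<open>r\<^sup>2 - |x - x\<^sub>0|\<^sup>2\<close> it serves as a cut-off function.
\<close>

definition bump3 :: "real \<Rightarrow> real" where "bump3 t = (max 0 t) ^ 3"

text \<open>
  At zero the difference quotient is itself a power of the positive part, which tends to zero.
\<close>

lemma max0_power_deriv:
  "((\<lambda>t::real. (max 0 t) ^ (n + 2)) has_real_derivative real (n + 2) * (max 0 t) ^ (n + 1)) (at t)"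
proof -
  consider "t < 0" | "t > 0" | "t = 0" by linarith
  then show ?thesis
  proof cases
    case 1
    have "((\<lambda>t::real. 0) has_real_derivative 0) (at t)" by simp
    moreover have "eventually (\<lambda>s. s < 0) (nhds t)"
      using order_tendstoD(2)[OF filterlim_ident 1] .
    then have ev: "eventually (\<lambda>s. 0 = (max 0 s) ^ (n + 2)) (nhds t)"
      by (rule eventually_mono) simp
    ultimately have "((\<lambda>t. (max 0 t) ^ (n + 2)) has_real_derivative 0) (at t)"
      using iffD1[OF DERIV_cong_ev[OF refl ev refl]] by blast
    then show ?thesis using 1 by simp
  next
    case 2
    have "((\<lambda>t::real. t ^ (n+2)) has_real_derivative real (n+2) * t ^ (n+1)) (at t)"
      using DERIV_pow[of "n+2" t] by simp
    moreover have "eventually (\<lambda>s. s > 0) (nhds t)"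
      using order_tendstoD(1)[OF filterlim_ident 2] .
    then have ev: "eventually (\<lambda>s. s ^ (n+2) = (max 0 s) ^ (n + 2)) (nhds t)"
      by (rule eventually_mono) simp
    ultimately have "((\<lambda>t. (max 0 t) ^ (n + 2)) has_real_derivative real (n+2) * t ^ (n+1)) (at t)"
      using iffD1[OF DERIV_cong_ev[OF refl ev refl]] by blast
    then show ?thesis using 2 by simp
  next
    case 3
    have "(\<lambda>h. ((max 0 (0 + h)) ^ (n + 2) - (max 0 0) ^ (n + 2)) / h) \<midarrow>0\<rightarrow> (0::real)"
    proof (rule Lim_transform_eventually)
      have "continuous_on UNIV (\<lambda>h::real. (max 0 h) ^ (n + 1))" by (intro continuous_intros)
      then have "isCont (\<lambda>h::real. (max 0 h) ^ (n + 1)) 0" by (simp add: continuous_on_eq_continuous_at)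
      then show "(\<lambda>h::real. (max 0 h) ^ (n + 1)) \<midarrow>0\<rightarrow> 0" by (simp add: isCont_def)
      have "(max 0 h) ^ (n + 1) = ((max 0 (0 + h)) ^ (n + 2) - (max 0 0) ^ (n + 2)) / h"
        if "h \<noteq> 0" for h :: real using that by (auto simp: max_def)
      then show "\<forall>\<^sub>F h::real in at 0. (max 0 h) ^ (n + 1) = ((max 0 (0 + h)) ^ (n + 2) - (max 0 0) ^ (n + 2)) / h"
        by (simp add: eventually_at_filter)
    qed
    then show ?thesis using 3 by (simp add: DERIV_def)
  qed
qed

lemma C2on_bump3:
  assumes "open U" "C2on U f"
  shows "C2on U (\<lambda>x. bump3 (f x))"
proof (rule C2on_compose[OF assms, where p' = "\<lambda>t. 3 * (max 0 t)\<^sup>2" and p'' = "\<lambda>t. 6 * max 0 t"])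
  show "(bump3 has_real_derivative 3 * (max 0 t)\<^sup>2) (at t)" for t
    using max0_power_deriv[of 1 t] by (simp add: bump3_def[abs_def] numeral_3_eq_3 power2_eq_square)
  show "((\<lambda>t. 3 * (max 0 t)\<^sup>2) has_real_derivative 6 * max 0 t) (at t)" for t :: real
    using DERIV_cmult[OF max0_power_deriv[of 0 t], of 3] by (simp add: power2_eq_square)
qed (intro continuous_intros)

section \<open>The second derivative test\<close>

lemma sum_insert_square:
  fixes F :: "'n \<Rightarrow> 'n \<Rightarrow> real"
  assumes "finite S" "k \<notin> S"
  shows "(\<Sum>i\<in>insert k S. \<Sum>j\<in>insert k S. F i j) =
    F k k + (\<Sum>j\<in>S. F k j) + (\<Sum>i\<in>S. F i k) + (\<Sum>i\<in>S. \<Sum>j\<in>S. F i j)"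
  using assms by (simp add: sum.distrib)

lemma sum_rank_one:
  fixes p q :: "'n \<Rightarrow> real"
  shows "(\<Sum>i\<in>S. \<Sum>j\<in>S. p i * q j) = (\<Sum>i\<in>S. p i) * (\<Sum>j\<in>S. q j)"
  by (simp add: sum_product)

text \<open>
  A Cholesky step, by induction on the index set: splitting off the rank one matrix
  \<open>a\<^sub>i\<^sub>k a\<^sub>j\<^sub>k / a\<^sub>k\<^sub>k\<close> leaves the Schur complement, which is positive definite on the remaining
  indices, and the rank one part pairs nonpositively with \<open>h\<close> by assumption.
\<close>

lemma trace_posdef_negsemidef:
  fixes a h :: "'n \<Rightarrow> 'n \<Rightarrow> real"
  assumes "finite S"
    and "\<And>i j. a i j = a j i"
    and "\<And>v. (\<exists>i\<in>S. v i \<noteq> 0) \<Longrightarrow> 0 < (\<Sum>i\<in>S. \<Sum>j\<in>S. v i * v j * a i j)"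
    and "\<And>v. (\<Sum>i\<in>S. \<Sum>j\<in>S. v i * v j * h i j) \<le> 0"
  shows "(\<Sum>i\<in>S. \<Sum>j\<in>S. a i j * h i j) \<le> 0"
  using assms
proof (induction S arbitrary: a)
  case (insert k S)
  note sis = sum_insert_square[OF insert.hyps]
  have diag: "a k k > 0"
  proof -
    let ?v = "\<lambda>i. if i = k then 1 else 0 :: real"
    have "0 < (\<Sum>i\<in>insert k S. \<Sum>j\<in>insert k S. ?v i * ?v j * a i j)"
      by (rule insert.prems(2)) auto
    also have "\<dots> = a k k"
      using insert.hyps by (simp add: sis sum.neutral cong: if_cong)
    finally show ?thesis .
  qed
  \<comment> \<open>the Schur complement of the entry at \<open>k\<close>\<close>
  define a' where "a' i j = a i j - a i k * a j k / a k k" for i j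
  have a'_S: "0 < (\<Sum>i\<in>S. \<Sum>j\<in>S. v i * v j * a' i j)" if v: "\<exists>i\<in>S. v i \<noteq> 0" for v
  proof -
    define s where "s = (\<Sum>i\<in>S. v i * a i k)"
    \<comment> \<open>the value at \<open>k\<close> that minimises the quadratic form, given the values on \<open>S\<close>\<close>
    define w where "w i = (if i = k then - s / a k k else v i)" for i
    have wS: "w i = v i" if "i \<in> S" for i using that insert.hyps by (auto simp: w_def)
    have "0 < (\<Sum>i\<in>insert k S. \<Sum>j\<in>insert k S. w i * w j * a i j)"
      using insert.prems(2)[of w] v wS by auto
    also have "\<dots> = w k * w k * a k k + (\<Sum>j\<in>S. w k * v j * a k j) + (\<Sum>i\<in>S. v i * w k * a i k)
        + (\<Sum>i\<in>S. \<Sum>j\<in>S. v i * v j * a i j)"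
      unfolding sis using wS by simp
    also have "(\<Sum>j\<in>S. w k * v j * a k j) = w k * s"
      unfolding s_def sum_distrib_left by (intro sum.cong) (auto simp: insert.prems(1)[of k] algebra_simps)
    also have "(\<Sum>i\<in>S. v i * w k * a i k) = w k * s"
      unfolding s_def sum_distrib_left by (intro sum.cong) (auto simp: algebra_simps)
    also have "w k * w k * a k k + w k * s + w k * s = - s * s / a k k"
      using diag by (simp add: w_def field_simps)
    finally have "0 < (\<Sum>i\<in>S. \<Sum>j\<in>S. v i * v j * a i j) - s * s / a k k" by simp
    also have "s * s / a k k = (\<Sum>i\<in>S. \<Sum>j\<in>S. v i * v j * (a i k * a j k / a k k))"
      unfolding s_def sum_rank_one[symmetric] sum_divide_distrib
      by (intro sum.cong refl) (simp add: algebra_simps)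
    finally show ?thesis
      unfolding a'_def by (simp add: right_diff_distrib sum_subtractf)
  qed
  have h_S: "(\<Sum>i\<in>S. \<Sum>j\<in>S. v i * v j * h i j) \<le> 0" for v
  proof -
    define w where "w i = (if i = k then 0 else v i)" for i
    have wS: "w i = v i" if "i \<in> S" for i using that insert.hyps by (auto simp: w_def)
    have "(\<Sum>i\<in>insert k S. \<Sum>j\<in>insert k S. w i * w j * h i j) \<le> 0" by (rule insert.prems(3))
    then show ?thesis unfolding sis using wS by (simp add: w_def)
  qed
  have IH: "(\<Sum>i\<in>S. \<Sum>j\<in>S. a' i j * h i j) \<le> 0"
    by (rule insert.IH) (use insert.prems(1) a'_S h_S in \<open>auto simp: a'_def mult.commute\<close>)
  have a'_row: "a' k j = 0" for j
    using diag insert.prems(1)[of k j] by (simp add: a'_def)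
  have a'_col: "a' i k = 0" for i
    using diag by (simp add: a'_def)
  have "(\<Sum>i\<in>insert k S. \<Sum>j\<in>insert k S. a' i j * h i j) = (\<Sum>i\<in>S. \<Sum>j\<in>S. a' i j * h i j)"
    unfolding sis by (simp add: a'_row a'_col)
  moreover have "(\<Sum>i\<in>insert k S. \<Sum>j\<in>insert k S. a i j * h i j)
     = (\<Sum>i\<in>insert k S. \<Sum>j\<in>insert k S. a i k * a j k * h i j) / a k k
       + (\<Sum>i\<in>insert k S. \<Sum>j\<in>insert k S. a' i j * h i j)"
    unfolding sum_divide_distrib sum.distrib[symmetric] a'_def
    by (intro sum.cong refl) (simp add: algebra_simps)
  moreover have "(\<Sum>i\<in>insert k S. \<Sum>j\<in>insert k S. a i k * a j k * h i j) / a k k \<le> 0"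
    using insert.prems(3)[of "\<lambda>i. a i k"] diag by (simp add: divide_nonpos_pos)
  ultimately show ?case using IH by linarith
qed simp

lemma has_real_derivative_line:
  fixes f :: "real^'n \<Rightarrow> real"
  assumes "f differentiable (at (x + t *\<^sub>R v))"
  shows "((\<lambda>t. f (x + t *\<^sub>R v)) has_real_derivative frechet_derivative f (at (x + t *\<^sub>R v)) v) (at t)"
proof -
  have "((\<lambda>t. x + t *\<^sub>R v) has_derivative (\<lambda>h. h *\<^sub>R v)) (at t)"
    by (auto intro!: derivative_eq_intros)
  from has_derivative_compose[OF this fderiv_works[OF assms]]
  have "((\<lambda>t. f (x + t *\<^sub>R v)) has_derivative (\<lambda>h. frechet_derivative f (at (x + t *\<^sub>R v)) (h *\<^sub>R v))) (at t)" .
  moreover have "(\<lambda>h. frechet_derivative f (at (x + t *\<^sub>R v)) (h *\<^sub>R v)) = (*) (frechet_derivative f (at (x + t *\<^sub>R v)) v)"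
    using linear_cmul[OF linear_frechet_derivative[OF assms]] by (auto simp: fun_eq_iff mult.commute)
  ultimately show ?thesis by (simp add: has_field_derivative_def)
qed

lemma line_in_ball:
  fixes x v :: "'a::real_normed_vector"
  assumes "r > 0"
  shows "\<exists>\<delta>>0. \<forall>t. \<bar>t\<bar> < \<delta> \<longrightarrow> x + t *\<^sub>R v \<in> ball x r"
proof (intro exI conjI allI impI)
  show "r / (norm v + 1) > 0" using assms by (simp add: add_nonneg_pos)
  fix t assume "\<bar>t\<bar> < r / (norm v + 1)"
  then have "\<bar>t\<bar> * (norm v + 1) < r" by (simp add: pos_less_divide_eq add_nonneg_pos)
  moreover have "\<bar>t\<bar> * norm v \<le> \<bar>t\<bar> * (norm v + 1)" by (simp add: algebra_simps)
  ultimately show "x + t *\<^sub>R v \<in> ball x r" by (simp add: dist_norm)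
qed

text \<open>
  Along a line through the maximum, a positive second derivative would make the first derivative
  positive just after the maximum, contradicting the mean value theorem.
\<close>

lemma second_derivative_test:
  fixes f :: "real^'n \<Rightarrow> real"
  assumes r: "r > 0" and C2: "C2on (ball x r) f" and max: "\<And>y. y \<in> ball x r \<Longrightarrow> f y \<le> f x"
  shows "pd i f x = 0" "(\<Sum>i\<in>UNIV. \<Sum>j\<in>UNIV. v $ i * v $ j * pd i (pd j f) x) \<le> 0"
proof -
  have line: "\<exists>d>0. \<forall>t. \<bar>t\<bar> < d \<longrightarrow> x + t *\<^sub>R v \<in> ball x r" for v :: "real^'n"
    by (rule line_in_ball[OF r])
  have g: "((\<lambda>t. f (x + t *\<^sub>R v)) has_real_derivative (\<Sum>j\<in>UNIV. v $ j * pd j f (x + t *\<^sub>R v))) (at t)"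
    if "x + t *\<^sub>R v \<in> ball x r" for t v
    using has_real_derivative_line[of f x t v] C2on_D(1)[OF C2 that] by (simp add: fderiv_expand)
  have g0: "(\<Sum>j\<in>UNIV. v $ j * pd j f x) = 0" for v
  proof -
    obtain d where d: "d > 0" "\<And>t. \<bar>t\<bar> < d \<Longrightarrow> x + t *\<^sub>R v \<in> ball x r" using line by blast
    show ?thesis
      using DERIV_local_max[OF g[of 0 v] d(1)] max d(2) r by simp
  qed
  have "axis i 1 $ j * pd j f x = (if j = i then pd j f x else 0)" for j
    by (simp add: axis_def)
  then have "(\<Sum>j\<in>UNIV. axis i 1 $ j * pd j f x) = pd i f x"
    by simp
  with g0 show "pd i f x = 0" by metis
  define D where "D = (\<Sum>j\<in>UNIV. v $ j * (\<Sum>i\<in>UNIV. v $ i * pd i (pd j f) x))"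
  have "((\<lambda>t. \<Sum>j\<in>UNIV. v $ j * pd j f (x + t *\<^sub>R v)) has_real_derivative D) (at 0)"
    unfolding D_def
  proof (intro DERIV_sum DERIV_cmult)
    fix j
    have "pd j f differentiable (at x)" using C2on_D(2)[OF C2] r by simp
    then show "((\<lambda>t. pd j f (x + t *\<^sub>R v)) has_real_derivative (\<Sum>i\<in>UNIV. v $ i * pd i (pd j f) x)) (at 0)"
      using has_real_derivative_line[of "pd j f" x 0 v] by (simp add: fderiv_expand)
  qed
  note dd = this
  have "D \<le> 0"
  proof (rule ccontr)
    assume "\<not> D \<le> 0"
    then have "0 < D" by simp
    from DERIV_pos_inc_right[OF dd this]
    obtain d1 where d1: "d1 > 0"
      "\<And>h. 0 < h \<Longrightarrow> h < d1 \<Longrightarrow> 0 < (\<Sum>j\<in>UNIV. v $ j * pd j f (x + h *\<^sub>R v))"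
      using g0[of v] by auto
    obtain d2 where d2: "d2 > 0" "\<And>t. \<bar>t\<bar> < d2 \<Longrightarrow> x + t *\<^sub>R v \<in> ball x r" using line by blast
    define h where "h = min d1 d2 / 2"
    have h: "0 < h" "h < d1" "h < d2" using d1 d2 by (auto simp: h_def)
    have "\<exists>z>0. z < h \<and> f (x + h *\<^sub>R v) - f (x + 0 *\<^sub>R v) = (h - 0) * (\<Sum>j\<in>UNIV. v $ j * pd j f (x + z *\<^sub>R v))"
      by (rule MVT2[OF h(1)]) (use g d2(2) h in auto)
    then obtain z where "0 < z" "z < h" "f (x + h *\<^sub>R v) - f x = h * (\<Sum>j\<in>UNIV. v $ j * pd j f (x + z *\<^sub>R v))"
      by auto
    moreover from this have "0 < h * (\<Sum>j\<in>UNIV. v $ j * pd j f (x + z *\<^sub>R v))"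
      using h d1(2)[of z] by (intro mult_pos_pos) auto
    ultimately have "f x < f (x + h *\<^sub>R v)" by linarith
    moreover have "f (x + h *\<^sub>R v) \<le> f x" using d2(2)[of h] h by (intro max) auto
    ultimately show False by linarith
  qed
  also have "D = (\<Sum>i\<in>UNIV. \<Sum>j\<in>UNIV. v $ i * v $ j * pd i (pd j f) x)"
    unfolding D_def sum_distrib_left by (subst sum.swap) (simp add: mult.assoc mult.left_commute)
  finally show "(\<Sum>i\<in>UNIV. \<Sum>j\<in>UNIV. v $ i * v $ j * pd i (pd j f) x) \<le> 0" .
qed

section \<open>The operator in nondivergence form\<close>

lemma sum_Basis_axis:
  fixes F :: "real^'n \<Rightarrow> 'b::comm_monoid_add"
  shows "(\<Sum>e\<in>Basis. F e) = (\<Sum>i\<in>UNIV. F (axis i 1))"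
proof -
  have B: "(Basis::(real^'n) set) = (\<lambda>i. axis i 1) ` UNIV" by (auto simp: Basis_vec_def)
  have inj: "inj (\<lambda>i. axis i 1 :: real^'n)" by (auto simp: inj_on_def axis_eq_axis)
  show ?thesis unfolding B by (subst sum.reindex[OF inj]) (simp add: o_def)
qed

lemma grad_interior: "x \<in> U \<Longrightarrow> grad U f x = (\<chi> i. pd i f x)"
  unfolding grad_def sum_Basis_axis
  by (simp add: partial_deriv_def pd_def vec_eq_iff axis_def if_distrib cong: if_cong)

lemma divg_interior: "x \<in> U \<Longrightarrow> divg U F x = (\<Sum>i\<in>UNIV. pd i F x $ i)"
  unfolding divg_def sum_Basis_axis
  by (simp add: partial_deriv_def pd_def inner_axis)

lemma bounded_bilinear_matrix_vector: "bounded_bilinear ((*v) :: real^'n^'m \<Rightarrow> real^'n \<Rightarrow> real^'m)"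
  unfolding bilinear_conv_bounded_bilinear[symmetric] bilinear_def
  by (auto intro!: linearI simp: matrix_vector_mult_add_rdistrib scaleR_matrix_vector_assoc)

lemma pd_matrix_vector:
  fixes A :: "real^'n \<Rightarrow> real^'n^'n"
  assumes "A differentiable (at x)" "G differentiable (at x)"
  shows "pd i (\<lambda>y. A y *v G y) x = A x *v pd i G x + pd i A x *v G x"
  using pd_eqI[OF bounded_bilinear.FDERIV[OF bounded_bilinear_matrix_vector assms[THEN fderiv_works]]]
  by (simp add: pd_def)

lemma pd_vec:
  fixes g :: "'n \<Rightarrow> real^'n \<Rightarrow> real"
  assumes "\<And>j. g j differentiable (at x)"
  shows "(\<lambda>y. \<chi> j. g j y) differentiable (at x)" "pd i (\<lambda>y. \<chi> j. g j y) x = (\<chi> j. pd i (g j) x)"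
proof -
  have "((\<lambda>y. \<chi> j. g j y) has_derivative (\<lambda>h. \<chi> j. frechet_derivative (g j) (at x) h)) (at x)"
    by (subst has_derivative_componentwise_within)
       (use assms in \<open>auto simp: Basis_vec_def inner_axis intro!: fderiv_works\<close>)
  from this pd_eqI[OF this]
  show "(\<lambda>y. \<chi> j. g j y) differentiable (at x)" "pd i (\<lambda>y. \<chi> j. g j y) x = (\<chi> j. pd i (g j) x)"
    by (auto simp: pd_def differentiable_def)
qed

text \<open>
  The coefficients of the first and zeroth order terms once both divergences are expanded.
\<close>

definition drift :: "(real^'n \<Rightarrow> real^'n^'n) \<Rightarrow> (real^'n \<Rightarrow> real^'n) \<Rightarrow> 'n \<Rightarrow> real^'n \<Rightarrow> real" where
  "drift a b j x = (\<Sum>i\<in>UNIV. pd i a x $ i $ j) + b x $ j"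

definition zeroth :: "(real^'n \<Rightarrow> real^'n) \<Rightarrow> real^'n \<Rightarrow> real" where
  "zeroth b x = (\<Sum>i\<in>UNIV. pd i b x $ i)"

lemma opLz_expand:
  assumes U: "open (cover S)" "x \<in> cover S" and f: "C2on (cover S) f"
    and a: "a differentiable (at x)" and b: "b differentiable (at x)"
  shows "opLz S a b f x = (\<Sum>i\<in>UNIV. \<Sum>j\<in>UNIV. a x $ i $ j * pd i (pd j f) x)
    + (\<Sum>j\<in>UNIV. drift a b j x * pd j f x) + zeroth b x * f x"
proof -
  let ?G = "\<lambda>y. \<chi> j. pd j f y"
  have G: "?G differentiable (at x)" "pd i ?G x = (\<chi> j. pd i (pd j f) x)" for i
    using pd_vec[of "\<lambda>j. pd j f" x] C2on_D(2)[OF f U(2)] by auto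
  have "divg (cover S) (\<lambda>y. a y *v grad (cover S) f y) x
      = (\<Sum>i\<in>UNIV. pd i (\<lambda>y. a y *v ?G y) x $ i)"
    unfolding divg_interior[OF U(2)]
    by (intro sum.cong refl arg_cong[where f="\<lambda>v. v $ _"] pd_cong_open[OF U]) (simp add: grad_interior)
  also have "\<dots> = (\<Sum>i\<in>UNIV. \<Sum>j\<in>UNIV. a x $ i $ j * pd i (pd j f) x)
      + (\<Sum>i\<in>UNIV. \<Sum>j\<in>UNIV. pd i a x $ i $ j * pd j f x)"
    unfolding pd_matrix_vector[OF a G(1)] G(2)
    by (simp add: matrix_vector_mult_def sum.distrib)
  also have "(\<Sum>i\<in>UNIV. \<Sum>j\<in>UNIV. pd i a x $ i $ j * pd j f x) = (\<Sum>j\<in>UNIV. (\<Sum>i\<in>UNIV. pd i a x $ i $ j) * pd j f x)"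
    by (subst sum.swap) (simp add: sum_distrib_right)
  finally have 1: "divg (cover S) (\<lambda>y. a y *v grad (cover S) f y) x =
    (\<Sum>i\<in>UNIV. \<Sum>j\<in>UNIV. a x $ i $ j * pd i (pd j f) x) + (\<Sum>j\<in>UNIV. (\<Sum>i\<in>UNIV. pd i a x $ i $ j) * pd j f x)" .
  have "pd i (\<lambda>y. f y *\<^sub>R b y) x = f x *\<^sub>R pd i b x + pd i f x *\<^sub>R b x" for i
    using pd_eqI[OF has_derivative_scaleR[OF fderiv_works[OF C2on_D(1)[OF f U(2)]] fderiv_works[OF b]]]
    by (simp add: pd_def)
  then have 2: "divg (cover S) (\<lambda>y. f y *\<^sub>R b y) x = zeroth b x * f x + (\<Sum>j\<in>UNIV. b x $ j * pd j f x)"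
    unfolding divg_interior[OF U(2)] zeroth_def sum_distrib_right sum.distrib[symmetric]
    by (intro sum.cong refl) simp
  show ?thesis
    unfolding opLz_def 1 2 drift_def by (simp add: sum.distrib algebra_simps)
qed

lemma pd_lincomb:
  fixes f g :: "real^'n \<Rightarrow> real"
  assumes "f differentiable (at x)" "g differentiable (at x)"
  shows "pd i (\<lambda>y. p * f y + q * g y) x = p * pd i f x + q * pd i g x"
  using assms by (simp add: pd_add pd_mult)

lemma C2on_lincomb:
  assumes "open U" "C2on U f" "C2on U g"
  shows "C2on U (\<lambda>y. p * f y + q * g y)"
  by (intro C2on_add C2on_cmult assms)

lemma pd2_lincomb:
  assumes U: "open U" "x \<in> U" and f: "C2on U f" and g: "C2on U g"
  shows "pd i (pd j (\<lambda>y. p * f y + q * g y)) x = p * pd i (pd j f) x + q * pd i (pd j g) x"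
proof -
  have "pd i (pd j (\<lambda>y. p * f y + q * g y)) x = pd i (\<lambda>y. p * pd j f y + q * pd j g y) x"
    by (rule pd_cong_open[OF U]) (simp add: pd_lincomb C2on_D(1)[OF f] C2on_D(1)[OF g])
  then show ?thesis
    by (simp add: pd_lincomb C2on_D(2)[OF f U(2)] C2on_D(2)[OF g U(2)])
qed

lemma pd2_compose:
  assumes U: "open U" "x \<in> U" and f: "C2on U f"
    and p: "\<And>t. (p has_real_derivative p' t) (at t)" "\<And>t. (p' has_real_derivative p'' t) (at t)"
  shows "pd i (pd j (\<lambda>y. p (f y))) x = p' (f x) * pd i (pd j f) x + p'' (f x) * (pd i f x * pd j f x)"
proof -
  have "pd i (pd j (\<lambda>y. p (f y))) x = pd i (\<lambda>y. p' (f y) * pd j f y) x"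
    by (rule pd_cong_open[OF U]) (rule pd_compose(2)[OF C2on_D(1)[OF f] p(1)])
  also have "\<dots> = p' (f x) * pd i (pd j f) x + p'' (f x) * pd i f x * pd j f x"
    using pd_mult[OF pd_compose(1)[OF C2on_D(1)[OF f U(2)] p(2)] C2on_D(2)[OF f U(2)]]
      pd_compose(2)[OF C2on_D(1)[OF f U(2)] p(2)] by simp
  finally show ?thesis by (simp add: mult.assoc)
qed

section \<open>Conormal derivatives and outward normals\<close>

text \<open>
  The continuous extension of the first derivatives is what bounds the coefficients of the expanded
  operator near the boundary.
\<close>

definition C1_up_to_boundary :: "(real^'n) set \<Rightarrow> (real^'n \<Rightarrow> 'b::real_normed_vector) \<Rightarrow> bool" where
  "C1_up_to_boundary U f \<longleftrightarrow> continuous_on (closure U) f \<and> (\<forall>x\<in>U. f differentiable (at x)) \<and>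
     (\<forall>i. \<exists>g. continuous_on (closure U) g \<and> (\<forall>x\<in>U. pd i f x = g x))"

text \<open>
  The density \<open>\<nabla>f \<cdot> a\<nabla>f\<close>, the second order term in the chain rule for the operator.
\<close>

definition quad :: "(real^'n \<Rightarrow> real^'n^'n) \<Rightarrow> (real^'n \<Rightarrow> real) \<Rightarrow> real^'n \<Rightarrow> real" where
  "quad a f x = (\<Sum>i\<in>UNIV. \<Sum>j\<in>UNIV. a x $ i $ j * (pd i f x * pd j f x))"

abbreviation inward_slope :: "(real^'n \<Rightarrow> real^'n^'n) \<Rightarrow> (real^'n \<Rightarrow> real) \<Rightarrow> real^'n \<Rightarrow> real^'n \<Rightarrow> real \<Rightarrow> real" where
  "inward_slope a f x \<nu> \<equiv> \<lambda>t. frechet_derivative f (at (x + t *\<^sub>R (- (a x *v \<nu>)))) (a x *v \<nu>)"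

text \<open>
  The conormal derivative is the limit along the segment that enters the domain in the
  direction \<open>-a\<nu>\<close>.  In this form it makes sense for functions that are differentiable in the
  interior only.
\<close>

definition conormal :: "(real^'n) space \<Rightarrow> (real^'n \<Rightarrow> real^'n^'n) \<Rightarrow> (real^'n \<Rightarrow> real) \<Rightarrow> real^'n \<Rightarrow> real \<Rightarrow> bool" where
  "conormal S a f x \<kappa> \<longleftrightarrow> (\<exists>\<nu>. outward_unit_normal (cover S) x \<nu> \<and>
     (inward_slope a f x \<nu> \<longlongrightarrow> \<kappa>) (at_right 0))"

lemma conormalE:
  assumes "conormal S a f x \<kappa>"
  obtains \<nu> where "outward_unit_normal (cover S) x \<nu>"
    "(inward_slope a f x \<nu> \<longlongrightarrow> \<kappa>) (at_right 0)"
  using assms unfolding conormal_def by (elim exE conjE) (rule that)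

lemma conormalI:
  assumes "outward_unit_normal (cover S) x \<nu>"
    "(inward_slope a f x \<nu> \<longlongrightarrow> \<kappa>) (at_right 0)"
  shows "conormal S a f x \<kappa>"
  unfolding conormal_def by (intro exI conjI) (rule assms)+

lemma gderiv_line:
  assumes "GDERIV \<rho> x :> D"
  shows "((\<lambda>t. \<rho> (x + t *\<^sub>R v)) has_real_derivative v \<bullet> D) (at 0)"
proof -
  have "((\<lambda>t. x + t *\<^sub>R v) has_derivative (\<lambda>h. h *\<^sub>R v)) (at 0)"
    by (auto intro!: derivative_eq_intros)
  from has_derivative_compose[OF this, of \<rho> "\<lambda>h. h \<bullet> D"] assms
  have "((\<lambda>t. \<rho> (x + t *\<^sub>R v)) has_derivative (\<lambda>h. (h *\<^sub>R v) \<bullet> D)) (at 0)"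
    by (simp add: gderiv_def)
  moreover have "(\<lambda>h. (h *\<^sub>R v) \<bullet> D) = (*) (v \<bullet> D)" by (auto simp: mult.commute)
  ultimately show ?thesis by (simp add: has_field_derivative_def)
qed

text \<open>
  The local defining function decreases in every direction that makes an obtuse angle with the normal.
\<close>

lemma inward_line:
  assumes "outward_unit_normal \<Omega> x \<nu>" "v \<bullet> \<nu> < 0"
  shows "\<exists>\<delta>>0. \<forall>t. 0 < t \<and> t < \<delta> \<longrightarrow> x + t *\<^sub>R v \<in> \<Omega>"
proof -
  obtain r \<rho> d where *: "r > 0" "d > 0" "\<rho> x = 0" "GDERIV \<rho> x :> d *\<^sub>R \<nu>"
      "\<Omega> \<inter> ball x r = {x' \<in> ball x r. \<rho> x' < (0::real)}"
    using assms(1) unfolding outward_unit_normal_def by blast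
  have "v \<bullet> (d *\<^sub>R \<nu>) < 0" using assms(2) *(2) by (simp add: mult_pos_neg)
  from has_real_derivative_neg_dec_right[OF gderiv_line[OF *(4)] this]
  obtain \<delta>1 where \<delta>1: "\<delta>1 > 0" "\<And>t. 0 < t \<Longrightarrow> t < \<delta>1 \<Longrightarrow> \<rho> (x + t *\<^sub>R v) < 0"
    using *(3) by auto
  obtain \<delta>2 where \<delta>2: "\<delta>2 > 0" "\<And>t. \<bar>t\<bar> < \<delta>2 \<Longrightarrow> x + t *\<^sub>R v \<in> ball x r"
    using line_in_ball[OF *(1)] by blast
  have "x + t *\<^sub>R v \<in> \<Omega>" if "0 < t" "t < min \<delta>1 \<delta>2" for t
    using \<delta>1(2)[of t] \<delta>2(2)[of t] *(5) that by auto
  then show ?thesis using \<delta>1(1) \<delta>2(1) by (intro exI[of _ "min \<delta>1 \<delta>2"]) auto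
qed

lemma outward_line:
  assumes "outward_unit_normal \<Omega> x \<nu>" "v \<bullet> \<nu> > 0"
  shows "\<exists>\<delta>>0. \<forall>t. 0 < t \<and> t < \<delta> \<longrightarrow> x + t *\<^sub>R v \<notin> \<Omega>"
proof -
  obtain r \<rho> d where *: "r > 0" "d > 0" "\<rho> x = 0" "GDERIV \<rho> x :> d *\<^sub>R \<nu>"
      "\<Omega> \<inter> ball x r = {x' \<in> ball x r. \<rho> x' < (0::real)}"
    using assms(1) unfolding outward_unit_normal_def by blast
  have "v \<bullet> (d *\<^sub>R \<nu>) > 0" using assms(2) *(2) by simp
  from has_real_derivative_pos_inc_right[OF gderiv_line[OF *(4)] this]
  obtain \<delta>1 where \<delta>1: "\<delta>1 > 0" "\<And>t. 0 < t \<Longrightarrow> t < \<delta>1 \<Longrightarrow> \<rho> (x + t *\<^sub>R v) > 0"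
    using *(3) by auto
  obtain \<delta>2 where \<delta>2: "\<delta>2 > 0" "\<And>t. \<bar>t\<bar> < \<delta>2 \<Longrightarrow> x + t *\<^sub>R v \<in> ball x r"
    using line_in_ball[OF *(1)] by blast
  have "x + t *\<^sub>R v \<notin> \<Omega>" if "0 < t" "t < min \<delta>1 \<delta>2" for t
  proof
    assume "x + t *\<^sub>R v \<in> \<Omega>"
    moreover have "x + t *\<^sub>R v \<in> ball x r" using \<delta>2(2)[of t] that by simp
    ultimately have "\<rho> (x + t *\<^sub>R v) < 0" using *(5) by blast
    with \<delta>1(2)[of t] that show False by simp
  qed
  then show ?thesis using \<delta>1(1) \<delta>2(1) by (intro exI[of _ "min \<delta>1 \<delta>2"]) auto
qed

text \<open>
  For two different unit normals the direction \<open>\<nu>' - \<nu>\<close> would point into the domain according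
  to one and out of it according to the other.
\<close>

lemma outward_unit_normal_unique:
  assumes "outward_unit_normal \<Omega> x \<nu>" "outward_unit_normal \<Omega> x \<nu>'"
  shows "\<nu> = \<nu>'"
proof (rule ccontr)
  assume ne: "\<nu> \<noteq> \<nu>'"
  have n: "\<nu> \<bullet> \<nu> = 1" "\<nu>' \<bullet> \<nu>' = 1"
    using assms by (auto simp: outward_unit_normal_def norm_eq_1)
  have "0 < (\<nu>' - \<nu>) \<bullet> (\<nu>' - \<nu>)" using ne by simp
  then have "(\<nu>' - \<nu>) \<bullet> \<nu> < 0" "(\<nu>' - \<nu>) \<bullet> \<nu>' > 0"
    using n by (auto simp: algebra_simps inner_commute[of \<nu>' \<nu>])
  from inward_line[OF assms(1) this(1)] outward_line[OF assms(2) this(2)]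
  obtain \<delta> \<delta>' where "\<delta> > 0" "\<And>t. 0 < t \<and> t < \<delta> \<Longrightarrow> x + t *\<^sub>R (\<nu>' - \<nu>) \<in> \<Omega>"
    "\<delta>' > 0" "\<And>t. 0 < t \<and> t < \<delta>' \<Longrightarrow> x + t *\<^sub>R (\<nu>' - \<nu>) \<notin> \<Omega>" by blast
  moreover have "0 < min \<delta> \<delta>' / 2 \<and> min \<delta> \<delta>' / 2 < \<delta>" "0 < min \<delta> \<delta>' / 2 \<and> min \<delta> \<delta>' / 2 < \<delta>'"
    using calculation(1,3) by auto
  ultimately show False by blast
qed

section \<open>The touching principle\<close>

locale elliptic_op =
  fixes S :: "(real^'n) space" and a :: "real^'n \<Rightarrow> real^'n^'n" and b :: "real^'n \<Rightarrow> real^'n"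
  assumes open_cover: "open (cover S)"
    and a_C1: "C1_up_to_boundary (cover S) a" and b_C1: "C1_up_to_boundary (cover S) b"
    and ell: "symmetric_elliptic S a"
begin

lemma a_diff: "x \<in> cover S \<Longrightarrow> a differentiable (at x)"
  using a_C1 by (simp add: C1_up_to_boundary_def)

lemma b_diff: "x \<in> cover S \<Longrightarrow> b differentiable (at x)"
  using b_C1 by (simp add: C1_up_to_boundary_def)

lemmas expand = opLz_expand[OF open_cover _ _ a_diff b_diff]

lemma a_transpose: "x \<in> closure (cover S) \<Longrightarrow> transpose (a x) = a x"
  using ell by (simp add: symmetric_elliptic_def)

lemma a_sym: "x \<in> closure (cover S) \<Longrightarrow> a x $ i $ j = a x $ j $ i"
  by (subst a_transpose[symmetric]) (simp_all add: transpose_def)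

lemma a_sym_inner: "x \<in> closure (cover S) \<Longrightarrow> u \<bullet> (a x *v v) = (a x *v u) \<bullet> v"
  by (subst (2) a_transpose[symmetric]) (simp_all add: transpose_matrix_vector dot_lmul_matrix)

lemma a_pos:
  assumes "x \<in> closure (cover S)" "v \<noteq> 0"
  shows "0 < v \<bullet> (a x *v v)"
proof -
  obtain lo where lo: "lo > 0" "\<forall>x\<in>closure (cover S). \<forall>\<xi>. lo * (norm \<xi>)\<^sup>2 \<le> \<xi> \<bullet> (a x *v \<xi>)"
    using ell unfolding symmetric_elliptic_def by auto
  have "0 < lo * (norm v)\<^sup>2" using lo(1) assms(2) by simp
  also have "\<dots> \<le> v \<bullet> (a x *v v)" using lo(2) assms(1) by simp
  finally show ?thesis .
qed

lemma quad_lower: "\<exists>lo>0. \<forall>x\<in>closure (cover S). \<forall>f. lo * (norm (\<chi> i. pd i f x))\<^sup>2 \<le> quad a f x"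
proof -
  obtain lo where lo: "lo > 0" "\<forall>x\<in>closure (cover S). \<forall>\<xi>. lo * (norm \<xi>)\<^sup>2 \<le> \<xi> \<bullet> (a x *v \<xi>)"
    using ell unfolding symmetric_elliptic_def by auto
  have "quad a f x = (\<chi> i. pd i f x) \<bullet> (a x *v (\<chi> i. pd i f x))" for f x
    unfolding quad_def inner_vec_def matrix_vector_mult_def
    by (simp add: sum_distrib_left algebra_simps)
  with lo show ?thesis by (intro exI[of _ lo]) auto
qed

lemma opLz_lincomb:
  assumes "x \<in> cover S" "C2on (cover S) f" "C2on (cover S) g"
  shows "opLz S a b (\<lambda>y. p * f y + q * g y) x = p * opLz S a b f x + q * opLz S a b g x"
proof -
  note f = C2on_D(1)[OF assms(2,1)] and g = C2on_D(1)[OF assms(3,1)]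
  show ?thesis
    unfolding expand[OF assms(1) C2on_lincomb[OF open_cover assms(2,3)] assms(1) assms(1)]
      expand[OF assms(1,2) assms(1) assms(1)] expand[OF assms(1,3) assms(1) assms(1)]
      pd2_lincomb[OF open_cover assms] pd_lincomb[OF f g]
    by (simp add: sum.distrib sum_distrib_left algebra_simps)
qed

lemma opLz_const: "x \<in> cover S \<Longrightarrow> opLz S a b (\<lambda>y. k) x = zeroth b x * k"
  using expand[OF _ C2on_const] by simp

lemma opLz_cmult:
  assumes "x \<in> cover S" "C2on (cover S) f"
  shows "opLz S a b (\<lambda>y. p * f y) x = p * opLz S a b f x"
  using opLz_lincomb[OF assms C2on_const, of p 0 0] by simp

lemma opLz_compose:
  assumes "x \<in> cover S" "C2on (cover S) f"
    and p: "\<And>t. (p has_real_derivative p' t) (at t)" "\<And>t. (p' has_real_derivative p'' t) (at t)"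
      "continuous_on UNIV p''"
  shows "opLz S a b (\<lambda>y. p (f y)) x =
    p' (f x) * (opLz S a b f x - zeroth b x * f x) + p'' (f x) * quad a f x + zeroth b x * p (f x)"
proof -
  note d = pd_compose(2)[OF C2on_D(1)[OF assms(2,1)] p(1)]
  show ?thesis
    unfolding expand[OF assms(1) C2on_compose[OF open_cover assms(2) p] assms(1) assms(1)]
      expand[OF assms(1,2) assms(1) assms(1)] d pd2_compose[OF open_cover assms(1,2) p(1,2)] quad_def
    by (simp add: sum.distrib sum_distrib_left algebra_simps)
qed

text \<open>
  At an interior maximum of \<open>f\<^sub>1 - f\<^sub>2\<close> with value zero the gradient vanishes and the Hessian is
  negative semidefinite, so only the second order term of the operator survives, with a sign.
\<close>

lemma opLz_touch:
  assumes x: "x \<in> cover S" and C2: "C2on (cover S) f1" "C2on (cover S) f2"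
    and r: "r > 0" "\<And>y. y \<in> cover S \<Longrightarrow> y \<in> ball x r \<Longrightarrow> f1 y \<le> f2 y" and eq: "f1 x = f2 x"
  shows "opLz S a b f1 x \<le> opLz S a b f2 x"
proof -
  define h where "h = (\<lambda>y. 1 * f1 y + (-1) * f2 y)"
  have h: "C2on (cover S) h" unfolding h_def by (rule C2on_lincomb[OF open_cover C2])
  obtain r' where r': "r' > 0" "ball x r' \<subseteq> cover S" "r' \<le> r"
  proof -
    obtain e where e: "e > 0" "ball x e \<subseteq> cover S" using open_cover x openE by blast
    show ?thesis by (rule that[of "min e r"]) (use e r in auto)
  qed
  have hmax: "h y \<le> h x" if "y \<in> ball x r'" for y
    using r(2)[of y] that r' eq by (auto simp: h_def)
  note t = second_derivative_test[OF r'(1) C2on_subset[OF h r'(2)] hmax]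
  have xc: "x \<in> closure (cover S)" using x closure_subset by blast
  have "(\<Sum>i\<in>UNIV. \<Sum>j\<in>UNIV. a x $ i $ j * pd i (pd j h) x) \<le> 0"
  proof (rule trace_posdef_negsemidef)
    fix v :: "'n \<Rightarrow> real"
    show "(\<Sum>i\<in>UNIV. \<Sum>j\<in>UNIV. v i * v j * pd i (pd j h) x) \<le> 0"
      using t(2)[of "\<chi> i. v i"] by simp
    assume "\<exists>i\<in>UNIV. v i \<noteq> 0"
    then have "(\<chi> i. v i) \<noteq> 0" by (auto simp: vec_eq_iff)
    from a_pos[OF xc this]
    show "0 < (\<Sum>i\<in>UNIV. \<Sum>j\<in>UNIV. v i * v j * a x $ i $ j)"
      unfolding inner_vec_def matrix_vector_mult_def by (simp add: sum_distrib_left algebra_simps)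
  qed (use a_sym[OF xc] in auto)
  then have "opLz S a b h x \<le> 0"
    unfolding expand[OF x h x x] using t(1) eq by (simp add: h_def)
  then show ?thesis
    unfolding h_def opLz_lincomb[OF x C2] by simp
qed

lemma conormal_lincomb:
  assumes x: "x \<in> frontier (cover S)" and C2: "C2on (cover S) f" "C2on (cover S) g"
    and "conormal S a f x \<kappa>" "conormal S a g x \<mu>"
  shows "conormal S a (\<lambda>y. p * f y + q * g y) x (p * \<kappa> + q * \<mu>)"
proof -
  obtain \<nu> where nu: "outward_unit_normal (cover S) x \<nu>"
    and f: "(inward_slope a f x \<nu> \<longlongrightarrow> \<kappa>) (at_right 0)"
    using conormalE[OF assms(4)] .
  obtain \<nu>' where nu': "outward_unit_normal (cover S) x \<nu>'"
    and g': "(inward_slope a g x \<nu>' \<longlongrightarrow> \<mu>) (at_right 0)"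
    using conormalE[OF assms(5)] .
  have g: "(inward_slope a g x \<nu> \<longlongrightarrow> \<mu>) (at_right 0)"
    unfolding outward_unit_normal_unique[OF nu nu'] by (rule g')
  have xc: "x \<in> closure (cover S)" using x by (simp add: frontier_def)
  have "\<nu> \<noteq> 0" using nu by (auto simp: outward_unit_normal_def)
  then have "(- (a x *v \<nu>)) \<bullet> \<nu> < 0" using a_pos[OF xc, of \<nu>] by (simp add: inner_commute)
  from inward_line[OF nu this] obtain \<delta> where
    \<delta>: "\<delta> > 0" "\<And>t. 0 < t \<and> t < \<delta> \<Longrightarrow> x + t *\<^sub>R (- (a x *v \<nu>)) \<in> cover S" by blast
  have lin: "frechet_derivative (\<lambda>y. p * f y + q * g y) (at z) v = p * frechet_derivative f (at z) v + q * frechet_derivative g (at z) v"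
    if z: "z \<in> cover S" for z v
  proof -
    note fz = C2on_D(1)[OF C2(1) z] and gz = C2on_D(1)[OF C2(2) z]
    have "(\<lambda>y. p * f y + q * g y) differentiable (at z)" using fz gz by simp
    then show ?thesis using fz gz
      by (simp add: fderiv_expand pd_lincomb sum.distrib sum_distrib_left algebra_simps)
  qed
  have "(inward_slope a (\<lambda>y. p * f y + q * g y) x \<nu> \<longlongrightarrow> p * \<kappa> + q * \<mu>) (at_right 0)"
  proof (rule Lim_transform_eventually)
    show "((\<lambda>t. p * inward_slope a f x \<nu> t
        + q * inward_slope a g x \<nu> t) \<longlongrightarrow> p * \<kappa> + q * \<mu>) (at_right 0)"
      by (intro tendsto_intros f g)
    show "\<forall>\<^sub>F t in at_right 0. p * inward_slope a f x \<nu> t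
        + q * inward_slope a g x \<nu> t
        = inward_slope a (\<lambda>y. p * f y + q * g y) x \<nu> t"
      unfolding eventually_at_right_field using \<delta> lin by (intro exI[of _ \<delta>]) auto
  qed
  with nu show ?thesis by (rule conormalI)
qed

text \<open>
  Entering the domain from the contact point, \<open>f\<^sub>2 - f\<^sub>1\<close> has negative derivative, so it would
  become negative immediately.
\<close>

lemma no_touch_frontier:
  assumes x: "x \<in> frontier (cover S)" and C2: "C2on (cover S) f1" "C2on (cover S) f2"
    and cont: "continuous_on (closure (cover S)) f1" "continuous_on (closure (cover S)) f2"
    and r: "r > 0" "\<And>y. y \<in> closure (cover S) \<Longrightarrow> y \<in> ball x r \<Longrightarrow> f1 y \<le> f2 y" and eq: "f1 x = f2 x"
    and con: "conormal S a f1 x 0" "conormal S a f2 x \<kappa>" "\<kappa> > 0"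
  shows False
proof -
  define h where "h = (\<lambda>y. 1 * f2 y + (-1) * f1 y)"
  have h: "C2on (cover S) h" unfolding h_def by (rule C2on_lincomb[OF open_cover C2(2,1)])
  have hc: "continuous_on (closure (cover S)) h"
    unfolding h_def by (intro continuous_intros cont)
  have hcon: "conormal S a h x \<kappa>"
    using conormal_lincomb[OF x C2(2,1) con(2,1), of 1 "-1"] by (simp add: h_def)
  obtain \<nu> where nu: "outward_unit_normal (cover S) x \<nu>"
    and lim: "(inward_slope a h x \<nu> \<longlongrightarrow> \<kappa>) (at_right 0)"
    using conormalE[OF hcon] .
  define v where "v = - (a x *v \<nu>)"
  have xc: "x \<in> closure (cover S)" using x by (simp add: frontier_def)
  have "\<nu> \<noteq> 0" using nu by (auto simp: outward_unit_normal_def)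
  then have "v \<bullet> \<nu> < 0" using a_pos[OF xc, of \<nu>] by (simp add: v_def inner_commute)
  from inward_line[OF nu this] obtain \<delta>1 where
    \<delta>1: "\<delta>1 > 0" "\<And>t. 0 < t \<and> t < \<delta>1 \<Longrightarrow> x + t *\<^sub>R v \<in> cover S" by blast
  obtain \<delta>2 where \<delta>2: "\<delta>2 > 0" "\<And>t. 0 < t \<Longrightarrow> t < \<delta>2 \<Longrightarrow> 0 < frechet_derivative h (at (x + t *\<^sub>R v)) (a x *v \<nu>)"
    using order_tendstoD(1)[OF lim con(3)] unfolding eventually_at_right_field v_def by auto
  obtain \<delta>3 where \<delta>3: "\<delta>3 > 0" "\<And>t. \<bar>t\<bar> < \<delta>3 \<Longrightarrow> x + t *\<^sub>R v \<in> ball x r"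
    using line_in_ball[OF r(1)] by blast
  define s where "s = min \<delta>1 (min \<delta>2 \<delta>3) / 2"
  have s: "0 < s" "s < \<delta>1" "s < \<delta>2" "s < \<delta>3" using \<delta>1 \<delta>2 \<delta>3 by (auto simp: s_def)
  have inS: "x + t *\<^sub>R v \<in> closure (cover S)" if "0 \<le> t" "t \<le> s" for t
    using that s xc \<delta>1(2)[of t] closure_subset by (cases "t = 0") auto
  have der: "((\<lambda>t. h (x + t *\<^sub>R v)) has_real_derivative frechet_derivative h (at (x + t *\<^sub>R v)) v) (at t)"
    if "0 < t" "t < s" for t
    using has_real_derivative_line[OF C2on_D(1)[OF h]] \<delta>1(2)[of t] that s by auto
  have "\<exists>l z. 0 < z \<and> z < s \<and> ((\<lambda>t. h (x + t *\<^sub>R v)) has_real_derivative l) (at z)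
      \<and> h (x + s *\<^sub>R v) - h (x + 0 *\<^sub>R v) = (s - 0) * l"
  proof (rule MVT)
    show "continuous_on {0..s} (\<lambda>t. h (x + t *\<^sub>R v))"
      by (rule continuous_on_compose2[OF hc]) (use inS in \<open>auto intro!: continuous_intros\<close>)
    show "(\<lambda>t. h (x + t *\<^sub>R v)) differentiable at t" if "0 < t" "t < s" for t
      using der[OF that] real_differentiable_def by blast
  qed (use s in auto)
  then obtain l z where z: "0 < z" "z < s" "((\<lambda>t. h (x + t *\<^sub>R v)) has_real_derivative l) (at z)"
    "h (x + s *\<^sub>R v) - h x = s * l" by auto
  have "l = frechet_derivative h (at (x + z *\<^sub>R v)) v" using DERIV_unique[OF z(3) der[OF z(1,2)]] .
  also have "\<dots> = - frechet_derivative h (at (x + z *\<^sub>R v)) (a x *v \<nu>)"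
    unfolding v_def[symmetric]
    using C2on_D(1)[OF h \<delta>1(2)[of z]] z s by (simp add: v_def linear_neg linear_frechet_derivative)
  finally have "l < 0" using \<delta>2(2)[of z] z s by simp
  then have "s * l < 0" using s by (simp add: mult_pos_neg)
  moreover have "h x = 0" using eq by (simp add: h_def)
  moreover have "0 \<le> h (x + s *\<^sub>R v)"
    using r(2)[OF inS, of s] \<delta>3(2)[of s] s by (simp add: h_def)
  ultimately show False using z(4) by linarith
qed

lemma touching:
  assumes x: "x \<in> closure (cover S)" and C2: "C2on (cover S) f1" "C2on (cover S) f2"
    and cont: "continuous_on (closure (cover S)) f1" "continuous_on (closure (cover S)) f2"
    and r: "r > 0" "\<And>y. y \<in> closure (cover S) \<Longrightarrow> y \<in> ball x r \<Longrightarrow> f1 y \<le> f2 y" and eq: "f1 x = f2 x"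
    and con: "x \<in> frontier (cover S) \<Longrightarrow> conormal S a f1 x 0"
      "x \<in> frontier (cover S) \<Longrightarrow> \<exists>\<kappa>>0. conormal S a f2 x \<kappa>"
  shows "x \<in> cover S \<and> opLz S a b f1 x \<le> opLz S a b f2 x"
proof -
  have "x \<notin> frontier (cover S)"
    using no_touch_frontier[OF _ C2 cont r eq] con by metis
  then have xS: "x \<in> cover S"
    using x open_cover by (simp add: frontier_def interior_open)
  have "opLz S a b f1 x \<le> opLz S a b f2 x"
    by (rule opLz_touch[OF xS C2 r(1) _ eq]) (use r(2) closure_subset in blast)
  with xS show ?thesis ..
qed

text \<open>
  For a function that is smooth up to the boundary the operator is a combination of functions that
  extend continuously to the closure; compactness then gives the bounds used later.
\<close>

lemma opLz_extends:
  assumes f: "C2on UNIV f"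
  shows "\<exists>F. continuous_on (closure (cover S)) F \<and> (\<forall>x\<in>cover S. opLz S a b f x = F x)"
proof -
  obtain da where da: "\<And>i. continuous_on (closure (cover S)) (da i)" "\<And>i x. x \<in> cover S \<Longrightarrow> pd i a x = da i x"
    using a_C1 unfolding C1_up_to_boundary_def by metis
  obtain db where db: "\<And>i. continuous_on (closure (cover S)) (db i)" "\<And>i x. x \<in> cover S \<Longrightarrow> pd i b x = db i x"
    using b_C1 unfolding C1_up_to_boundary_def by metis
  have ca: "continuous_on (closure (cover S)) a" and cb: "continuous_on (closure (cover S)) b"
    using a_C1 b_C1 by (auto simp: C1_up_to_boundary_def)
  have fS: "C2on (cover S) f" using C2on_subset[OF f] by simp
  have c0: "continuous_on (closure (cover S)) f" using C2on_continuous[OF f] continuous_on_subset by blast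
  have c1: "continuous_on (closure (cover S)) (pd i f)" for i
    using f continuous_on_subset C1on_continuous by (metis C2on_def subset_UNIV)
  have c2: "continuous_on (closure (cover S)) (pd i (pd j f))" for i j
    using f continuous_on_subset by (metis C2on_def C1on_def subset_UNIV)
  let ?F = "\<lambda>x. (\<Sum>i\<in>UNIV. \<Sum>j\<in>UNIV. a x $ i $ j * pd i (pd j f) x)
    + (\<Sum>j\<in>UNIV. ((\<Sum>i\<in>UNIV. da i x $ i $ j) + b x $ j) * pd j f x) + (\<Sum>i\<in>UNIV. db i x $ i) * f x"
  have "continuous_on (closure (cover S)) ?F"
    by (intro continuous_intros continuous_on_component ca cb da(1) db(1) c0 c1 c2)
  moreover have "opLz S a b f x = ?F x" if "x \<in> cover S" for x
    unfolding expand[OF that fS that that] drift_def zeroth_def using da(2) db(2) that by simp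
  ultimately show ?thesis by blast
qed

lemma opLz_bounded:
  assumes f: "C2on UNIV f" and T: "compact T" "T \<subseteq> closure (cover S)"
  shows "\<exists>C\<ge>0. \<forall>x\<in>T \<inter> cover S. \<bar>opLz S a b f x\<bar> \<le> C"
proof -
  obtain F where F: "continuous_on (closure (cover S)) F" "\<forall>x\<in>cover S. opLz S a b f x = F x"
    using opLz_extends[OF f] by blast
  have "compact (F ` T)"
    using compact_continuous_image[OF continuous_on_subset[OF F(1) T(2)] T(1)] .
  then obtain C where "\<forall>y\<in>F ` T. \<bar>y\<bar> \<le> C" using compact_imp_bounded bounded_real by metis
  then show ?thesis using F(2) by (intro exI[of _ "max C 0"]) (auto simp: max_def)
qed

end

section \<open>Hoelder functions and their slices\<close>

lemma holder_on_0_continuous: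
  assumes "0 < \<alpha>" "holder_on 0 \<alpha> \<Omega> f"
  shows "continuous_on (closure \<Omega>) f"
  unfolding continuous_on_iff
proof (intro ballI allI impI)
  obtain C where C: "\<And>x y. x \<in> closure \<Omega> \<Longrightarrow> y \<in> closure \<Omega> \<Longrightarrow> dist (f x) (f y) \<le> C * dist x y powr \<alpha>"
    using assms(2) by auto
  fix x e assume x: "x \<in> closure \<Omega>" and e: "0 < (e::real)"
  define \<delta> where "\<delta> = (e / (\<bar>C\<bar> + 1)) powr (1 / \<alpha>)"
  have pos: "e / (\<bar>C\<bar> + 1) > 0" using e by (simp add: add_nonneg_pos)
  have "dist (f y) (f x) < e" if y: "y \<in> closure \<Omega>" "dist y x < \<delta>" for y
  proof -
    have "dist y x powr \<alpha> < \<delta> powr \<alpha>" using assms(1) y(2) by (intro powr_less_mono2) auto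
    also have "\<dots> = e / (\<bar>C\<bar> + 1)" using assms(1) pos e by (simp add: \<delta>_def powr_powr)
    finally have "dist y x powr \<alpha> * (\<bar>C\<bar> + 1) < e" by (simp add: pos_less_divide_eq add_nonneg_pos)
    moreover have "C * dist y x powr \<alpha> \<le> (\<bar>C\<bar> + 1) * dist y x powr \<alpha>"
      by (intro mult_right_mono) auto
    ultimately show ?thesis using C[OF y(1) x] by (simp add: mult.commute)
  qed
  moreover have "\<delta> > 0" unfolding \<delta>_def using pos by (metis powr_gt_zero less_irrefl)
  ultimately show "\<exists>d>0. \<forall>x'\<in>closure \<Omega>. dist x' x < d \<longrightarrow> dist (f x') (f x) < e" by blast
qed

lemma holder_on_continuous:
  "0 < \<alpha> \<Longrightarrow> holder_on k \<alpha> \<Omega> f \<Longrightarrow> continuous_on (closure \<Omega>) f"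
  using holder_on_0_continuous by (cases k) auto

lemma holder_on_Suc_D:
  assumes "holder_on (Suc k) \<alpha> \<Omega> f" "open \<Omega>"
  shows "x \<in> \<Omega> \<Longrightarrow> f differentiable (at x)" "i \<in> Basis \<Longrightarrow> holder_on k \<alpha> \<Omega> (partial_deriv \<Omega> i f)"
  using assms differentiable_on_eq_differentiable_at by auto

lemma axis_Basis: "axis i (1::real) \<in> Basis"
  by (auto simp: Basis_vec_def)

lemma holder_on_C1_up_to_boundary:
  fixes f :: "real^'n \<Rightarrow> 'b::real_normed_vector"
  assumes "0 < \<alpha>" "holder_on (Suc k) \<alpha> \<Omega> f" "open \<Omega>"
  shows "C1_up_to_boundary \<Omega> f"
proof -
  have "continuous_on (closure \<Omega>) (partial_deriv \<Omega> (axis i 1) f)" for i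
    using holder_on_continuous[OF assms(1) holder_on_Suc_D(2)[OF assms(2,3) axis_Basis]] .
  moreover have "pd i f x = partial_deriv \<Omega> (axis i 1) f x" if "x \<in> \<Omega>" for i x
    using that by (simp add: pd_def partial_deriv_def)
  ultimately show ?thesis
    using holder_on_continuous[OF assms(1,2)] holder_on_Suc_D(1)[OF assms(2,3)] unfolding C1_up_to_boundary_def by blast
qed

lemma C1_up_to_boundary_const: "C1_up_to_boundary U (\<lambda>x. c)"
  unfolding C1_up_to_boundary_def pd_const
  by (intro conjI allI ballI exI[of _ "\<lambda>x. 0"]) auto

text \<open>
  Freezing all but one group of variables is composition with an affine map \<open>x \<mapsto> \<iota> x + p\<close> that
  sends basis vectors to basis vectors, so that partial derivatives of the slice are partial
  derivatives of the original function, also in their continuous extensions to the boundary.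
  The choice \<open>\<iota> = id\<close>, \<open>p = 0\<close> covers functions of one space.
\<close>

locale slice =
  fixes \<Omega> :: "'a::euclidean_space set" and \<iota> :: "real^'n \<Rightarrow> 'a" and p :: 'a and U :: "(real^'n) set"
  assumes lin: "bounded_linear \<iota>" and basis: "\<And>i. \<iota> (axis i 1) \<in> Basis"
    and op: "open \<Omega>" "open U" and into: "\<And>x. x \<in> U \<Longrightarrow> \<iota> x + p \<in> \<Omega>"
begin

lemma slice_deriv:
  fixes f :: "'a \<Rightarrow> real"
  assumes "x \<in> U" "f differentiable (at (\<iota> x + p))"
  shows "(\<lambda>y. f (\<iota> y + p)) differentiable (at x)"
    "pd i (\<lambda>y. f (\<iota> y + p)) x = partial_deriv \<Omega> (\<iota> (axis i 1)) f (\<iota> x + p)"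
proof -
  have "((\<lambda>y. \<iota> y + p) has_derivative \<iota>) (at x)"
    using has_derivative_add[OF bounded_linear.has_derivative[OF lin has_derivative_ident] has_derivative_const] by simp
  from has_derivative_compose[OF this fderiv_works[OF assms(2)]]
  have *: "((\<lambda>y. f (\<iota> y + p)) has_derivative (\<lambda>h. frechet_derivative f (at (\<iota> x + p)) (\<iota> h))) (at x)" .
  then show "(\<lambda>y. f (\<iota> y + p)) differentiable (at x)" by (auto simp: differentiable_def)
  show "pd i (\<lambda>y. f (\<iota> y + p)) x = partial_deriv \<Omega> (\<iota> (axis i 1)) f (\<iota> x + p)"
    using pd_eqI[OF *] into[OF assms(1)] by (simp add: partial_deriv_def)
qed

lemma cont_e: "continuous_on T (\<lambda>y. \<iota> y + p)"
  by (rule continuous_on_add[OF linear_continuous_on[OF lin] continuous_on_const])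

lemma C1on_slice:
  fixes f :: "'a \<Rightarrow> real"
  assumes "0 < \<alpha>" "holder_on (Suc k) \<alpha> \<Omega> f"
  shows "C1on U (\<lambda>y. f (\<iota> y + p))"
  unfolding C1on_def
proof (intro conjI ballI allI)
  note d = slice_deriv[OF _ holder_on_Suc_D(1)[OF assms(2) op(1) into]]
  show "(\<lambda>y. f (\<iota> y + p)) differentiable at x" if "x \<in> U" for x using d that by blast
  fix i
  have "continuous_on \<Omega> (partial_deriv \<Omega> (\<iota> (axis i 1)) f)"
    by (rule continuous_on_subset[OF holder_on_continuous[OF assms(1) holder_on_Suc_D(2)[OF assms(2) op(1) basis]]
          closure_subset])
  then have "continuous_on U (\<lambda>y. partial_deriv \<Omega> (\<iota> (axis i 1)) f (\<iota> y + p))"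
    by (rule continuous_on_compose2[OF _ cont_e]) (use into in auto)
  then show "continuous_on U (pd i (\<lambda>y. f (\<iota> y + p)))"
    by (rule continuous_on_eq) (use d in auto)
qed

lemma C2on_slice:
  fixes f :: "'a \<Rightarrow> real"
  assumes "0 < \<alpha>" "holder_on 2 \<alpha> \<Omega> f"
  shows "C2on U (\<lambda>y. f (\<iota> y + p))"
  unfolding C2on_def
proof (intro conjI ballI allI)
  have h: "holder_on (Suc (Suc 0)) \<alpha> \<Omega> f" using assms(2) by (simp only: numeral_2_eq_2)
  note d = slice_deriv[OF _ holder_on_Suc_D(1)[OF h op(1) into]]
  show "(\<lambda>y. f (\<iota> y + p)) differentiable at x" if "x \<in> U" for x using d that by blast
  fix i
  show "C1on U (pd i (\<lambda>y. f (\<iota> y + p)))"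
    by (rule C1on_cong[OF op(2) _ C1on_slice[OF assms(1) holder_on_Suc_D(2)[OF h op(1) basis[of i]]]]) (use d in auto)
qed

lemma grad_inner: "grad \<Omega> f w \<bullet> \<iota> v = (\<Sum>i\<in>UNIV. v $ i * partial_deriv \<Omega> (\<iota> (axis i 1)) f w)"
proof -
  interpret linear \<iota> using bounded_linear.linear[OF lin] .
  have g: "grad \<Omega> f w \<bullet> e = partial_deriv \<Omega> e f w" if "e \<in> Basis" for e
    using that by (simp add: grad_def)
  have "v = (\<Sum>i\<in>UNIV. v $ i *\<^sub>R axis i 1)"
    by (simp add: basis_expansion[of v, unfolded scalar_mult_eq_scaleR])
  then have "\<iota> v = \<iota> (\<Sum>i\<in>UNIV. v $ i *\<^sub>R axis i 1)" by simp
  also have "\<dots> = (\<Sum>i\<in>UNIV. v $ i *\<^sub>R \<iota> (axis i 1))" by (simp add: sum scale)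
  finally show ?thesis by (simp add: inner_sum_right g[OF basis])
qed

end

context elliptic_op
begin

lemma conormal_path:
  assumes "x \<in> closure (cover S)" "outward_unit_normal (cover S) x \<nu>"
  shows "\<forall>\<^sub>F t in at_right 0. x + t *\<^sub>R (- (a x *v \<nu>)) \<in> cover S"
    "((\<lambda>t. x + t *\<^sub>R (- (a x *v \<nu>))) \<longlongrightarrow> x) (at_right 0)"
proof -
  have "\<nu> \<noteq> 0" using assms(2) by (auto simp: outward_unit_normal_def)
  then have "(- (a x *v \<nu>)) \<bullet> \<nu> < 0" using a_pos[OF assms(1), of \<nu>] by (simp add: inner_commute)
  from inward_line[OF assms(2) this] show "\<forall>\<^sub>F t in at_right 0. x + t *\<^sub>R (- (a x *v \<nu>)) \<in> cover S"
    unfolding eventually_at_right_field by auto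
  have "((\<lambda>t. x + t *\<^sub>R (- (a x *v \<nu>))) \<longlongrightarrow> x + 0 *\<^sub>R (- (a x *v \<nu>))) (at_right 0)"
    by (intro tendsto_intros)
  then show "((\<lambda>t. x + t *\<^sub>R (- (a x *v \<nu>))) \<longlongrightarrow> x) (at_right 0)" by simp
qed

lemma conormal_extension:
  assumes x: "x \<in> closure (cover S)" and nu: "outward_unit_normal (cover S) x \<nu>"
    and f: "\<And>y. y \<in> cover S \<Longrightarrow> f differentiable (at y)"
    and g: "\<And>i y. y \<in> cover S \<Longrightarrow> pd i f y = g i y" "\<And>i. continuous_on (closure (cover S)) (g i)"
  shows "conormal S a f x (\<Sum>i\<in>UNIV. (a x *v \<nu>) $ i * g i x)"
proof (rule conormalI[OF nu])
  note path = conormal_path[OF x nu]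
  show "(inward_slope a f x \<nu> \<longlongrightarrow> (\<Sum>i\<in>UNIV. (a x *v \<nu>) $ i * g i x)) (at_right 0)"
  proof (rule Lim_transform_eventually)
    show "((\<lambda>t. \<Sum>i\<in>UNIV. (a x *v \<nu>) $ i * g i (x + t *\<^sub>R (- (a x *v \<nu>)))) \<longlongrightarrow> (\<Sum>i\<in>UNIV. (a x *v \<nu>) $ i * g i x)) (at_right 0)"
    proof (intro tendsto_intros continuous_on_tendsto_compose[OF g(2) path(2) x])
      show "\<forall>\<^sub>F t in at_right 0. x + t *\<^sub>R (- (a x *v \<nu>)) \<in> closure (cover S)"
        by (rule eventually_mono[OF path(1)]) (use closure_subset in blast)
    qed
    show "\<forall>\<^sub>F t in at_right 0. (\<Sum>i\<in>UNIV. (a x *v \<nu>) $ i * g i (x + t *\<^sub>R (- (a x *v \<nu>))))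
        = inward_slope a f x \<nu> t"
      by (rule eventually_mono[OF path(1)]) (simp add: fderiv_expand f g(1))
  qed
qed

text \<open>
  The Neumann condition is stated with the continuous extension of the gradient; this lemma identifies
  it with the limit that defines the conormal derivative of a slice.
\<close>

lemma conormal_slice:
  fixes f :: "'c::euclidean_space \<Rightarrow> real"
  assumes sl: "slice \<Omega> \<iota> p (cover S)" and "0 < \<alpha>" and h: "holder_on (Suc k) \<alpha> \<Omega> f"
    and x: "x \<in> closure (cover S)" and nu: "outward_unit_normal (cover S) x \<nu>"
  shows "conormal S a (\<lambda>y. f (\<iota> y + p)) x (grad \<Omega> f (\<iota> x + p) \<bullet> \<iota> (a x *v \<nu>))"
proof -
  interpret slice \<Omega> \<iota> p "cover S" by (rule sl)
  note d = slice_deriv[OF _ holder_on_Suc_D(1)[OF h op(1) into]]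
  have cl: "\<iota> y + p \<in> closure \<Omega>" if "y \<in> closure (cover S)" for y
  proof -
    have "(\<lambda>y. \<iota> y + p) ` closure (cover S) \<subseteq> closure \<Omega>"
      by (rule image_closure_subset[OF cont_e]) (use into closure_subset in auto)
    then show ?thesis using that by auto
  qed
  have "conormal S a (\<lambda>y. f (\<iota> y + p)) x (\<Sum>i\<in>UNIV. (a x *v \<nu>) $ i * (partial_deriv \<Omega> (\<iota> (axis i 1)) f (\<iota> x + p)))"
  proof (rule conormal_extension[OF x nu])
    show "continuous_on (closure (cover S)) (\<lambda>x. partial_deriv \<Omega> (\<iota> (axis i 1)) f (\<iota> x + p))" for i
      by (rule continuous_on_compose2[OF holder_on_continuous[OF assms(2) holder_on_Suc_D(2)[OF h op(1) basis[of i]]] cont_e])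
         (use cl in auto)
  qed (use d in auto)
  then show ?thesis by (simp add: grad_inner)
qed

lemma conormal_C2:
  assumes x: "x \<in> closure (cover S)" and nu: "outward_unit_normal (cover S) x \<nu>" and f: "C2on UNIV f"
  shows "conormal S a f x (\<Sum>i\<in>UNIV. (a x *v \<nu>) $ i * pd i f x)"
proof (rule conormal_extension[OF x nu])
  show "continuous_on (closure (cover S)) (pd i f)" for i
    using C1on_continuous[OF C2on_D(3)[OF f]] continuous_on_subset subset_UNIV by blast
qed (use C2on_D(1)[OF f] in auto)

end

section \<open>Defining functions of domains\<close>

lemma C2on_holder:
  assumes "0 < \<alpha>" "holder_on 2 \<alpha> \<Omega> f" "open \<Omega>"
  shows "C2on \<Omega> (f :: real^'n \<Rightarrow> real)"
proof -
  interpret slice \<Omega> "\<lambda>x. x" 0 \<Omega>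
    by unfold_locales (use assms in \<open>auto simp: axis_Basis intro: exI[of _ 1]\<close>)
  show ?thesis using C2on_slice[OF assms(1,2)] by simp
qed

lemma gderiv_pd:
  fixes f :: "real^'n \<Rightarrow> real"
  assumes "GDERIV f x :> D"
  shows "f differentiable (at x)" "pd i f x = D $ i"
  using assms pd_eqI[of f "\<lambda>h. h \<bullet> D" x i]
  by (auto simp: gderiv_def differentiable_def inner_axis' inner_commute[of D])

lemma gderiv_exists:
  fixes f :: "real^'n \<Rightarrow> real"
  assumes "f differentiable (at x)"
  shows "GDERIV f x :> (\<chi> i. pd i f x)"
proof -
  have "frechet_derivative f (at x) = (\<lambda>h. h \<bullet> (\<chi> i. pd i f x))"
    by (rule ext) (simp add: fderiv_expand[OF assms] inner_vec_def)
  then show ?thesis using fderiv_works[OF assms] by (simp add: gderiv_def)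
qed

text \<open>
  The derivative of \<open>\<gamma> y - y \<bullet> e\<close> along \<open>e\<close> is \<open>-1\<close>, since \<open>\<gamma>\<close> is constant in that direction.
  Hence the gradient does not vanish, and normalising it gives an outward unit normal.
\<close>

lemma graph_chart:
  fixes U :: "(real^'n) set"
  assumes \<alpha>: "0 < \<alpha>" and U: "open U" and r: "r > 0" and e: "norm e = 1"
    and \<gamma>: "\<And>x t. \<gamma> (x + t *\<^sub>R e) = \<gamma> x" "holder_on 2 \<alpha> (ball x0 r) \<gamma>"
    and chart: "U \<inter> ball x0 r = {x \<in> ball x0 r. \<gamma> x < x \<bullet> e}"
    and \<sigma>: "\<And>y. \<sigma> y = \<gamma> y - y \<bullet> e"
  shows "C2on (ball x0 r) \<sigma>"
    "x \<in> frontier U \<Longrightarrow> x \<in> ball x0 r \<Longrightarrow>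
      \<sigma> x = 0 \<and> (\<exists>\<nu> d. d > 0 \<and> outward_unit_normal U x \<nu> \<and> (GDERIV \<sigma> x :> d *\<^sub>R \<nu>))"
proof -
  have g: "C2on (ball x0 r) \<gamma>" by (rule C2on_holder[OF \<alpha> \<gamma>(2)]) simp
  have "\<sigma> = (\<lambda>y. 1 * \<gamma> y + (-1) * (y \<bullet> e))" using \<sigma> by auto
  then show C2: "C2on (ball x0 r) \<sigma>"
    using C2on_lincomb[OF _ g C2on_inner, of 1 "-1" e] by simp
  assume x: "x \<in> frontier U" "x \<in> ball x0 r"
  have "x \<notin> U" using x U by (simp add: frontier_def interior_open)
  then have "\<sigma> x \<ge> 0" using chart x(2) \<sigma> by force
  moreover have "\<sigma> x \<le> 0"
  proof (rule ccontr)
    assume "\<not> \<sigma> x \<le> 0"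
    moreover have "isCont \<sigma> x"
      using C2on_continuous[OF C2] x(2) continuous_on_eq_continuous_at[OF open_ball] by blast
    ultimately have "\<forall>\<^sub>F y in nhds x. \<sigma> y > 0"
      using order_tendstoD(1)[of \<sigma> "\<sigma> x" "nhds x" 0] by (simp add: isCont_def tendsto_at_iff_tendsto_nhds)
    moreover have "\<forall>\<^sub>F y in nhds x. y \<in> ball x0 r" using x(2) by (intro eventually_nhds_in_open) auto
    ultimately have "\<forall>\<^sub>F y in nhds x. \<sigma> y > 0 \<and> y \<in> ball x0 r" by (rule eventually_conj)
    then obtain V where V: "open V" "x \<in> V" "\<forall>y\<in>V. \<sigma> y > 0 \<and> y \<in> ball x0 r"
      unfolding eventually_nhds by blast
    then have "V \<inter> U = {}" using chart \<sigma> by force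
    moreover have "x \<in> closure U" using x by (simp add: frontier_def)
    ultimately show False using V(1,2) by (metis Int_commute disjoint_iff open_Int_closure_eq_empty)
  qed
  ultimately have s0: "\<sigma> x = 0" by simp
  define D where "D = (\<chi> i. pd i \<sigma> x)"
  have D: "GDERIV \<sigma> x :> D" unfolding D_def by (rule gderiv_exists[OF C2on_D(1)[OF C2 x(2)]])
  have "(\<lambda>t. \<sigma> (x + t *\<^sub>R e)) = (\<lambda>t. \<sigma> x - t)"
    using e by (simp add: \<sigma> \<gamma>(1) inner_add_left norm_eq_1 fun_eq_iff)
  moreover have "((\<lambda>t. \<sigma> x - t) has_real_derivative -1) (at 0)" by (auto intro!: derivative_eq_intros)
  ultimately have "e \<bullet> D = -1" using DERIV_unique[OF gderiv_line[OF D, of e]] by simp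
  then have D0: "norm D > 0" by auto
  obtain s where s: "s > 0" "ball x s \<subseteq> ball x0 r" using x(2) open_ball openE by blast
  have "outward_unit_normal U x (D /\<^sub>R norm D)"
    unfolding outward_unit_normal_def
  proof (intro conjI exI)
    show "norm (D /\<^sub>R norm D) = 1" using D0 by simp
    show "s > 0" "norm D > 0" "\<sigma> x = 0" using s D0 s0 by auto
    show "GDERIV \<sigma> x :> norm D *\<^sub>R (D /\<^sub>R norm D)" using D D0 by simp
    \<comment> \<open>the chart ball is centred at \<open>x0\<close>, the definition asks for a ball centred at \<open>x\<close>\<close>
    show "U \<inter> ball x s = {x' \<in> ball x s. \<sigma> x' < 0}"
      using chart s(2) \<sigma> by (auto simp: set_eq_iff) (metis IntI mem_ball subsetD)+
  qed
  moreover have "GDERIV \<sigma> x :> norm D *\<^sub>R (D /\<^sub>R norm D)" using D D0 by simp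
  ultimately show "\<sigma> x = 0 \<and> (\<exists>\<nu> d. d > 0 \<and> outward_unit_normal U x \<nu> \<and> (GDERIV \<sigma> x :> d *\<^sub>R \<nu>))"
    using s0 D0 by blast
qed

text \<open>
  The chart function is multiplied by a cut-off supported in half the chart ball.  On the boundary the
  chart function vanishes, so the gradient of the product is the cut-off times the gradient of the
  chart function: a nonnegative multiple of the normal.
\<close>

lemma local_defining_function:
  fixes U :: "(real^'n) set"
  assumes \<alpha>: "0 < \<alpha>" and U: "open U" and hb: "holder_boundary 2 \<alpha> U" and x0: "x0 \<in> frontier U"
  shows "\<exists>h s. s > 0 \<and> C2on UNIV h \<and> (\<exists>\<nu>. outward_unit_normal U x0 \<nu>) \<and>
    (\<forall>x\<in>frontier U. h x = 0 \<and> (\<forall>\<nu>. outward_unit_normal U x \<nu> \<longrightarrow>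
       (\<exists>\<kappa>\<ge>0. (GDERIV h x :> \<kappa> *\<^sub>R \<nu>) \<and> (x \<in> ball x0 s \<longrightarrow> \<kappa> > 0))))"
proof -
  obtain r e \<gamma> where r: "r > 0" "norm e = 1" "\<forall>x t. \<gamma> (x + t *\<^sub>R e) = \<gamma> x" "holder_on 2 \<alpha> (ball x0 r) \<gamma>"
    "U \<inter> ball x0 r = {x \<in> ball x0 r. \<gamma> x < x \<bullet> e}"
    using bspec[OF hb[unfolded holder_boundary_def] x0] by (elim exE conjE) (rule that)
  define \<sigma> where "\<sigma> y = \<gamma> y - y \<bullet> e" for y
  note ch = graph_chart[OF \<alpha> U r(1,2) r(3)[rule_format] r(4,5) \<sigma>_def]
  define \<chi>f where "\<chi>f y = bump3 ((r/2)\<^sup>2 - (norm (y - x0))\<^sup>2)" for y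
  define h where "h y = \<chi>f y * \<sigma> y" for y
  have chi: "C2on UNIV \<chi>f"
  proof -
    have "C2on UNIV (\<lambda>y. 1 * (r/2)\<^sup>2 + (-1) * (norm (y - x0))\<^sup>2)"
      by (intro C2on_lincomb C2on_const C2on_sqdist) auto
    from C2on_bump3[OF open_UNIV this] show ?thesis by (simp add: \<chi>f_def[abs_def])
  qed
  have chi_pos: "\<chi>f y > 0" if "y \<in> ball x0 (r/2)" for y
  proof -
    have "(norm (y - x0))\<^sup>2 < (r/2)\<^sup>2"
      using that by (intro power_strict_mono) (auto simp: dist_norm norm_minus_commute)
    then show ?thesis by (simp add: \<chi>f_def bump3_def)
  qed
  have chi_0: "\<chi>f y = 0" if "y \<notin> ball x0 (r/2)" for y
  proof -
    have "(r/2)\<^sup>2 \<le> (norm (y - x0))\<^sup>2"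
      using that r(1) by (intro power_mono) (auto simp: dist_norm norm_minus_commute)
    then show ?thesis by (simp add: \<chi>f_def bump3_def)
  qed
  have chi_nonneg: "\<chi>f y \<ge> 0" for y by (simp add: \<chi>f_def bump3_def)
  have h0: "h y = 0" if "y \<in> - cball x0 (r/2)" for y using chi_0[of y] that by (simp add: h_def)
  have "C2on (ball x0 r \<union> - cball x0 (r/2)) h"
  proof (rule C2on_Un)
    show "C2on (ball x0 r) h" unfolding h_def[abs_def]
      by (intro C2on_mult ch(1) C2on_subset[OF chi]) auto
    show "C2on (- cball x0 (r/2)) h"
      by (rule C2on_cong[OF _ _ C2on_const[of _ 0]]) (use h0 in auto)
  qed auto
  moreover have "ball x0 r \<union> - cball x0 (r/2) = UNIV" using r(1) by auto
  ultimately have C2: "C2on UNIV h" by simp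
  have main: "h x = 0 \<and> (\<forall>\<nu>. outward_unit_normal U x \<nu> \<longrightarrow>
       (\<exists>\<kappa>\<ge>0. (GDERIV h x :> \<kappa> *\<^sub>R \<nu>) \<and> (x \<in> ball x0 (r/2) \<longrightarrow> \<kappa> > 0)))" if x: "x \<in> frontier U" for x
  proof (cases "x \<in> ball x0 r")
    case True
    obtain \<nu> d where d: "d > 0" "outward_unit_normal U x \<nu>" "GDERIV \<sigma> x :> d *\<^sub>R \<nu>" and s0: "\<sigma> x = 0"
      using ch(2)[OF x True] by blast
    have "GDERIV \<chi>f x :> (\<chi> i. pd i \<chi>f x)" by (rule gderiv_exists[OF C2on_D(1)[OF chi]]) simp
    from GDERIV_mult[OF this d(3)] have "GDERIV h x :> (\<chi>f x * d) *\<^sub>R \<nu>"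
      using s0 by (simp add: h_def[abs_def])
    moreover have "\<chi>f x * d \<ge> 0" "x \<in> ball x0 (r/2) \<longrightarrow> \<chi>f x * d > 0"
      using chi_pos chi_nonneg d(1) by auto
    ultimately show ?thesis using outward_unit_normal_unique[OF d(2)] s0 by (auto simp: h_def)
  next
    case False
    then have xc: "x \<in> - cball x0 (r/2)" using r(1) by auto
    have "(h has_derivative (\<lambda>h. 0)) (at x)"
      by (rule has_derivative_transform_within_open[OF has_derivative_const[of 0] _ xc]) (use h0 in auto)
    then have "GDERIV h x :> 0 *\<^sub>R \<nu>" for \<nu> by (simp add: gderiv_def)
    moreover have "x \<notin> ball x0 (r/2)" using xc by auto
    ultimately show ?thesis using h0[OF xc] by blast
  qed
  have "\<exists>\<nu>. outward_unit_normal U x0 \<nu>" using ch(2)[OF x0] r(1) by auto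
  then show ?thesis using C2 main r(1) by (intro exI[of _ h] exI[of _ "r/2"]) auto
qed

text \<open>
  Finitely many half balls cover the boundary.  As all the local functions have gradients in the
  direction of the same normal, their sum does not degenerate.
\<close>

lemma defining_function_domain:
  fixes U :: "(real^'n) set"
  assumes \<alpha>: "0 < \<alpha>" and U: "open U" "bounded U" and hb: "holder_boundary 2 \<alpha> U"
  shows "\<exists>\<rho>. C2on UNIV \<rho> \<and> (\<forall>x\<in>frontier U. \<rho> x = 0 \<and>
     (\<exists>\<nu> d. d > 0 \<and> outward_unit_normal U x \<nu> \<and> (GDERIV \<rho> x :> d *\<^sub>R \<nu>)))"
proof -
  have "\<forall>x0\<in>frontier U. \<exists>h s. s > 0 \<and> C2on UNIV h \<and> (\<exists>\<nu>. outward_unit_normal U x0 \<nu>) \<and>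
    (\<forall>x\<in>frontier U. h x = 0 \<and> (\<forall>\<nu>. outward_unit_normal U x \<nu> \<longrightarrow>
       (\<exists>\<kappa>\<ge>0. (GDERIV h x :> \<kappa> *\<^sub>R \<nu>) \<and> (x \<in> ball x0 s \<longrightarrow> \<kappa> > 0))))"
    using local_defining_function[OF \<alpha> U(1) hb] by blast
  then obtain h s where hs: "\<And>x0. x0 \<in> frontier U \<Longrightarrow> s x0 > 0 \<and> C2on UNIV (h x0) \<and> (\<exists>\<nu>. outward_unit_normal U x0 \<nu>) \<and>
    (\<forall>x\<in>frontier U. h x0 x = 0 \<and> (\<forall>\<nu>. outward_unit_normal U x \<nu> \<longrightarrow>
       (\<exists>\<kappa>\<ge>0. (GDERIV (h x0) x :> \<kappa> *\<^sub>R \<nu>) \<and> (x \<in> ball x0 (s x0) \<longrightarrow> \<kappa> > 0))))"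
    unfolding bchoice_iff by metis
  have "compact (frontier U)" using U(2) by (rule compact_frontier_bounded)
  then obtain K where K: "K \<subseteq> frontier U" "finite K" "frontier U \<subseteq> (\<Union>x0\<in>K. ball x0 (s x0))"
    by (rule compactE_image[where C = "frontier U" and f = "\<lambda>x0. ball x0 (s x0)"]) (use hs in force)+
  define \<rho> where "\<rho> x = (\<Sum>x0\<in>K. h x0 x)" for x
  have "C2on UNIV \<rho>" unfolding \<rho>_def[abs_def] by (intro C2on_sum) (use hs K in auto)
  moreover have "\<rho> x = 0 \<and> (\<exists>\<nu> d. d > 0 \<and> outward_unit_normal U x \<nu> \<and> (GDERIV \<rho> x :> d *\<^sub>R \<nu>))"
    if x: "x \<in> frontier U" for x
  proof -
    obtain \<nu> where nu: "outward_unit_normal U x \<nu>" using hs[OF x] by blast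
    have "\<forall>x0\<in>K. \<exists>\<kappa>\<ge>0. (GDERIV (h x0) x :> \<kappa> *\<^sub>R \<nu>) \<and> (x \<in> ball x0 (s x0) \<longrightarrow> \<kappa> > 0)"
      using hs K(1) x nu by blast
    then obtain \<kappa> where \<kappa>: "\<And>x0. x0 \<in> K \<Longrightarrow> \<kappa> x0 \<ge> 0 \<and> (GDERIV (h x0) x :> \<kappa> x0 *\<^sub>R \<nu>) \<and> (x \<in> ball x0 (s x0) \<longrightarrow> \<kappa> x0 > 0)"
      by metis
    have "(\<rho> has_derivative (\<lambda>v. \<Sum>x0\<in>K. v \<bullet> (\<kappa> x0 *\<^sub>R \<nu>))) (at x)"
      unfolding \<rho>_def[abs_def] by (intro has_derivative_sum) (use \<kappa> in \<open>auto simp: gderiv_def\<close>)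
    then have "GDERIV \<rho> x :> (\<Sum>x0\<in>K. \<kappa> x0) *\<^sub>R \<nu>"
      by (simp add: gderiv_def sum_distrib_right)
    moreover have "(\<Sum>x0\<in>K. \<kappa> x0) > 0"
    proof -
      obtain x0 where "x0 \<in> K" "x \<in> ball x0 (s x0)" using K(3) x by blast
      then show ?thesis using \<kappa> by (intro sum_pos2[OF K(2), of x0]) auto
    qed
    moreover have "\<rho> x = 0" unfolding \<rho>_def using hs K(1) x by (intro sum.neutral) blast
    ultimately show ?thesis using nu by blast
  qed
  ultimately show ?thesis by blast
qed

lemma defining_function:
  fixes S :: "(real^'n) space"
  assumes "0 < \<alpha>" "admissible \<alpha> S"
  shows "\<exists>\<rho>. C2on UNIV \<rho> \<and> descends S \<rho> \<and> (\<forall>x\<in>frontier (cover S). \<rho> x = 0 \<and>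
     (\<exists>\<nu> d. d > 0 \<and> outward_unit_normal (cover S) x \<nu> \<and> (GDERIV \<rho> x :> d *\<^sub>R \<nu>)))"
proof (cases S)
  case Torus
  then show ?thesis by (intro exI[of _ "\<lambda>x. 0"]) (simp add: C2on_const)
next
  case (Domain U)
  then show ?thesis using defining_function_domain[OF assms(1), of U] assms(2) by simp
qed

section \<open>Periodicity and compactness\<close>

text \<open>
  A compact set on which a function on the space takes all its values.
\<close>

fun closed_cell :: "(real^'n) space \<Rightarrow> (real^'n) set" where
  "closed_cell Torus = cbox 0 1"
| "closed_cell (Domain U) = closure U"

lemma closed_cell_subset: "closed_cell S \<subseteq> closure (cover S)"
  by (cases S) auto

lemma compact_closed_cell: "admissible \<alpha> S \<Longrightarrow> compact (closed_cell S)"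
  by (cases S) auto

lemma open_cover_admissible: "admissible \<alpha> S \<Longrightarrow> open (cover S)"
  by (cases S) auto

lemma cover_nonempty: "admissible \<alpha> S \<Longrightarrow> cover S \<noteq> {}"
  by (cases S) auto

lemma closed_cell_rep:
  assumes "x \<in> closure (cover S)"
  obtains x' where "x' \<in> closed_cell S" "\<And>f::real^'n \<Rightarrow> real. descends S f \<Longrightarrow> f x' = f x"
proof (cases S)
  case Torus
  define m :: "real^'n" where "m = (\<chi> i. - of_int \<lfloor>x $ i\<rfloor>)"
  have "x + m \<in> closed_cell S"
    unfolding Torus by (auto simp: mem_box_cart m_def) linarith
  moreover have "f (x + m) = f x" if "descends S f" for f :: "real^'n \<Rightarrow> real"
  proof -
    have "\<forall>i. m $ i \<in> \<int>" by (simp add: m_def)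
    then show ?thesis using that Torus by simp
  qed
  ultimately show ?thesis using that by blast
next
  case (Domain U)
  then show ?thesis using that[of x] assms by simp
qed

lemma descends_binop:
  assumes "descends S f" "descends S g"
  shows "descends S (\<lambda>x. h (f x) (g x))"
  using assms by (cases S) auto

lemma descends_const: "descends S (\<lambda>x. c)"
  by (cases S) auto

lemma periodic_max:
  fixes h :: "real^'n \<Rightarrow> real"
  assumes "admissible \<alpha> S" "continuous_on (closure (cover S)) h" "descends S h"
  obtains x where "x \<in> closure (cover S)" "\<And>z. z \<in> closure (cover S) \<Longrightarrow> h z \<le> h x"
proof -
  have ne: "closed_cell S \<noteq> {}"
    using cover_nonempty[OF assms(1)] closed_cell_rep closure_subset by (metis empty_iff equals0I subsetD)
  obtain x where x: "x \<in> closed_cell S" "\<forall>z\<in>closed_cell S. h z \<le> h x"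
    using continuous_attains_sup[OF compact_closed_cell[OF assms(1)] ne continuous_on_subset[OF assms(2) closed_cell_subset]] by blast
  have "h z \<le> h x" if z: "z \<in> closure (cover S)" for z
  proof -
    obtain z' where "z' \<in> closed_cell S" "h z' = h z" using closed_cell_rep[OF z] assms(3) by metis
    then show ?thesis using x(2) by fastforce
  qed
  then show ?thesis using that x(1) closed_cell_subset by blast
qed

lemma periodic_bounded:
  fixes h :: "real^'n \<Rightarrow> real"
  assumes "admissible \<alpha> S" "continuous_on (closure (cover S)) h" "descends S h"
  obtains C where "C \<ge> 0" "\<And>z. z \<in> closure (cover S) \<Longrightarrow> \<bar>h z\<bar> \<le> C"
proof -
  have "descends S (\<lambda>x. \<bar>h x\<bar>)" using descends_binop[OF assms(3,3), of "\<lambda>a b. \<bar>a\<bar>"] .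
  moreover have "continuous_on (closure (cover S)) (\<lambda>x. \<bar>h x\<bar>)" using assms(2) by (intro continuous_intros)
  ultimately obtain x where "\<And>z. z \<in> closure (cover S) \<Longrightarrow> \<bar>h z\<bar> \<le> \<bar>h x\<bar>"
    using periodic_max[OF assms(1)] by metis
  then show ?thesis using that[of "\<bar>h x\<bar>"] by simp
qed

lemma elliptic_op_intro:
  assumes "0 < \<alpha>" "admissible \<alpha> S" "holder_space (Suc k) \<alpha> S a" "symmetric_elliptic S a"
    "C1_up_to_boundary (cover S) b"
  shows "elliptic_op S a b"
proof
  show "C1_up_to_boundary (cover S) a"
    using holder_on_C1_up_to_boundary[OF assms(1) _ open_cover_admissible[OF assms(2)]] assms(3)
    unfolding holder_space_def by blast
qed (use assms open_cover_admissible in auto)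

section \<open>Correctors and comparison of eigenvalues\<close>

locale elliptic_space = elliptic_op S a b for S :: "(real^'n) space" and a b +
  fixes \<alpha> :: real
  assumes alpha: "0 < \<alpha>" and adm: "admissible \<alpha> S"
begin

lemma subset_cover: "C2on UNIV f \<Longrightarrow> C2on (cover S) f"
  using C2on_subset by blast

text \<open>
  On the boundary \<open>g = 1 + \<rho> - M \<rho>\<^sup>2\<close> has value 1 and the same gradient as \<open>\<rho>\<close>, whatever \<open>M\<close> is,
  while the operator contributes \<open>-2 M \<nabla>\<rho> \<cdot> a\<nabla>\<rho>\<close>.  So \<open>M\<close> can be chosen to dominate all other
  terms, in a neighbourhood of the boundary that shrinks as \<open>M\<close> grows; \<open>K\<close> is what is left of the
  closed domain.
\<close>

lemma barrier_domain:
  assumes S: "S = Domain U" and \<Lambda>: "\<Lambda> \<ge> 0"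
  obtains g K where "C2on UNIV g" "compact K" "K \<subseteq> cover S"
    "\<And>x. x \<in> frontier (cover S) \<Longrightarrow> \<exists>\<kappa>>0. conormal S a g x \<kappa>"
    "\<And>x. x \<in> closure (cover S) - K \<Longrightarrow> g x > 0"
    "\<And>x. x \<in> cover S - K \<Longrightarrow> opLz S a b g x + \<Lambda> * g x \<le> 0"
proof -
  have comp: "compact (closure (cover S))" using adm S by simp
  obtain \<rho> where \<rho>: "C2on UNIV \<rho>" "\<And>x. x \<in> frontier (cover S) \<Longrightarrow> \<rho> x = 0 \<and>
     (\<exists>\<nu> d. d > 0 \<and> outward_unit_normal (cover S) x \<nu> \<and> (GDERIV \<rho> x :> d *\<^sub>R \<nu>))"
    using defining_function[OF alpha adm] by blast
  obtain C1 where C1: "C1 \<ge> 0" "\<And>x. x \<in> cover S \<Longrightarrow> \<bar>opLz S a b \<rho> x\<bar> \<le> C1"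
    using opLz_bounded[OF \<rho>(1) comp] closure_subset by blast
  \<comment> \<open>\<open>zeroth b\<close> is the operator applied to the constant 1\<close>
  obtain C2 where C2: "C2 \<ge> 0" "\<And>x. x \<in> cover S \<Longrightarrow> \<bar>zeroth b x\<bar> \<le> C2"
    using opLz_bounded[OF C2on_const[of UNIV 1] comp order_refl] closure_subset opLz_const[of _ 1] by fastforce
  obtain lo where lo: "lo > 0" "\<forall>x\<in>closure (cover S). \<forall>f. lo * (norm (\<chi> i. pd i f x))\<^sup>2 \<le> quad a f x"
    using quad_lower by blast
  define N where "N x = (norm (\<chi> i. pd i \<rho> x))\<^sup>2" for x
  have contpd: "continuous_on UNIV (pd i \<rho>)" for i
    using C1on_continuous[OF C2on_D(3)[OF \<rho>(1)]] .
  have Ncont: "continuous_on UNIV N"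
    unfolding N_def by (intro continuous_intros continuous_on_vec_lambda contpd)
  have grad0: "(\<chi> i. pd i \<rho> x) \<noteq> 0" if x: "x \<in> frontier (cover S)" for x
  proof -
    obtain \<nu> d where "d > 0" "outward_unit_normal (cover S) x \<nu>" "GDERIV \<rho> x :> d *\<^sub>R \<nu>"
      using \<rho>(2)[OF x] by blast
    moreover have "(\<chi> i. pd i \<rho> x) = d *\<^sub>R \<nu>"
      using gderiv_pd(2)[OF calculation(3)] by (simp add: vec_eq_iff)
    ultimately show ?thesis by (auto simp: outward_unit_normal_def)
  qed
  obtain m where m: "m > 0" "\<And>x. x \<in> frontier (cover S) \<Longrightarrow> N x > m"
  proof (cases "frontier (cover S) = {}")
    case False
    have "compact (frontier (cover S))" using adm S by (auto intro: compact_frontier_bounded)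
    then obtain x where x: "x \<in> frontier (cover S)" "\<forall>y\<in>frontier (cover S). N x \<le> N y"
      using continuous_attains_inf[OF _ False continuous_on_subset[OF Ncont subset_UNIV]] by blast
    have "N x > 0" using grad0[OF x(1)] by (simp add: N_def)
    then show ?thesis using that[of "N x / 2"] x(2) by fastforce
  qed (use that[of 1] in auto)
  define M where "M = (C1 + 2 * C2 + \<Lambda>) / (lo * m)"
  have M: "M \<ge> 0" "M * (lo * m) = C1 + 2 * C2 + \<Lambda>"
    using C1 C2 \<Lambda> lo m by (auto simp: M_def)
  \<comment> \<open>small enough for \<open>0 < g \<le> 2\<close> wherever \<open>\<bar>\<rho>\<bar> < s\<close>\<close>
  define s where "s = 1 / (4 * (M + 1))"
  have s: "s > 0" "s \<le> 1/4" "M * s \<le> 1/4" using M(1) by (auto simp: s_def field_simps)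
  define g where "g x = 1 + \<rho> x - M * (\<rho> x)\<^sup>2" for x
  let ?p = "\<lambda>t::real. 1 + t - M * t\<^sup>2" and ?p' = "\<lambda>t::real. 1 - 2 * M * t" and ?p'' = "\<lambda>t::real. - 2 * M"
  have p: "(?p has_real_derivative ?p' t) (at t)" "(?p' has_real_derivative ?p'' t) (at t)" "continuous_on UNIV ?p''" for t
    by (auto intro!: derivative_eq_intros)
  define V where "V = {x. m < N x} \<inter> {x. \<bar>\<rho> x\<bar> < s}"
  have "open V" unfolding V_def
    by (intro open_Int open_Collect_less continuous_intros Ncont C2on_continuous[OF \<rho>(1)])
  have fV: "frontier (cover S) \<subseteq> V" using m(2) \<rho>(2) s(1) by (auto simp: V_def)
  have gV: "g x > 0" "g x \<le> 2" "\<bar>1 - 2 * M * \<rho> x\<bar> \<le> 2" "\<bar>\<rho> x\<bar> \<le> 1" if "x \<in> V" for x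
  proof -
    have r: "\<bar>\<rho> x\<bar> < s" using that by (simp add: V_def)
    have Mr: "M * \<bar>\<rho> x\<bar> \<le> 1/4" using mult_left_mono[of "\<bar>\<rho> x\<bar>" s M] r M(1) s(3) by linarith
    have "M * \<bar>\<rho> x\<bar> * \<bar>\<rho> x\<bar> \<le> 1/4 * 1"
      by (rule mult_mono[OF Mr]) (use r s in auto)
    then have "M * (\<rho> x)\<^sup>2 \<le> 1/4" by (simp add: power2_eq_square mult.assoc)
    moreover have "0 \<le> M * (\<rho> x)\<^sup>2" using M(1) by simp
    ultimately show "g x > 0" "g x \<le> 2" unfolding g_def using r s(2) by linarith+
    have "\<bar>M * \<rho> x\<bar> \<le> 1/4" using Mr M(1) by (simp add: abs_mult)
    then show "\<bar>1 - 2 * M * \<rho> x\<bar> \<le> 2" by linarith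
    show "\<bar>\<rho> x\<bar> \<le> 1" using r s by linarith
  qed
  have g2: "C2on UNIV g" unfolding g_def[abs_def] by (rule C2on_compose[OF open_UNIV \<rho>(1) p])
  show ?thesis
  proof (rule that[OF g2])
    have K: "closure (cover S) - V = closure (cover S) \<inter> (- V)" by blast
    show "compact (closure (cover S) - V)"
      unfolding K using comp \<open>open V\<close> by (intro compact_Int_closed) auto
    show "closure (cover S) - V \<subseteq> cover S"
      using fV open_cover by (auto simp: frontier_def interior_open)
    show "g x > 0" if "x \<in> closure (cover S) - (closure (cover S) - V)" for x
      using gV(1) that by blast
    show "\<exists>\<kappa>>0. conormal S a g x \<kappa>" if x: "x \<in> frontier (cover S)" for x
    proof -
      obtain \<nu> d where d: "d > 0" "outward_unit_normal (cover S) x \<nu>" "GDERIV \<rho> x :> d *\<^sub>R \<nu>" and r0: "\<rho> x = 0"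
        using \<rho>(2)[OF x] by blast
      have xc: "x \<in> closure (cover S)" using x by (simp add: frontier_def)
      have "pd i g x = d * \<nu> $ i" for i
        unfolding g_def[abs_def] using pd_compose(2)[OF gderiv_pd(1)[OF d(3)] p(1)] gderiv_pd(2)[OF d(3)] r0
        by simp
      then have "(\<Sum>i\<in>UNIV. (a x *v \<nu>) $ i * pd i g x) = d * (\<nu> \<bullet> (a x *v \<nu>))"
        by (simp add: inner_vec_def sum_distrib_left algebra_simps)
      moreover have "\<nu> \<noteq> 0" using d(2) by (auto simp: outward_unit_normal_def)
      ultimately show ?thesis
        using conormal_C2[OF xc d(2) g2] a_pos[OF xc, of \<nu>] d(1)
        by (intro exI[of _ "d * (\<nu> \<bullet> (a x *v \<nu>))"]) auto
    qed
    show "opLz S a b g x + \<Lambda> * g x \<le> 0" if "x \<in> cover S - (closure (cover S) - V)" for x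
    proof -
      have x: "x \<in> cover S" "x \<in> V" using that closure_subset by auto
      have xc: "x \<in> closure (cover S)" using x(1) closure_subset by blast
      have "opLz S a b g x = (1 - 2 * M * \<rho> x) * (opLz S a b \<rho> x - zeroth b x * \<rho> x) + (- 2 * M) * quad a \<rho> x + zeroth b x * g x"
        unfolding g_def[abs_def] by (rule opLz_compose[OF x(1) subset_cover[OF \<rho>(1)] p])
      moreover have "(1 - 2 * M * \<rho> x) * (opLz S a b \<rho> x - zeroth b x * \<rho> x) \<le> 2 * (C1 + C2)"
      proof -
        have "\<bar>zeroth b x * \<rho> x\<bar> \<le> C2 * 1"
          unfolding abs_mult using C2(1) C2(2)[OF x(1)] gV(4)[OF x(2)] by (intro mult_mono) auto
        then have "\<bar>opLz S a b \<rho> x - zeroth b x * \<rho> x\<bar> \<le> C1 + C2"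
          using C1(2)[OF x(1)] by linarith
        then have "\<bar>(1 - 2 * M * \<rho> x) * (opLz S a b \<rho> x - zeroth b x * \<rho> x)\<bar> \<le> 2 * (C1 + C2)"
          unfolding abs_mult using gV(3)[OF x(2)] by (intro mult_mono) auto
        then show ?thesis by linarith
      qed
      moreover have "M * (lo * m) \<le> M * quad a \<rho> x"
      proof (rule mult_left_mono[OF _ M(1)])
        have "lo * m \<le> lo * N x" using x(2) lo(1) by (simp add: V_def)
        also have "\<dots> \<le> quad a \<rho> x" using lo(2) xc unfolding N_def by blast
        finally show "lo * m \<le> quad a \<rho> x" .
      qed
      moreover have "zeroth b x * g x \<le> C2 * 2"
        using C2(1) C2(2)[OF x(1)] gV(1,2)[OF x(2)] by (intro mult_mono) auto
      moreover have "\<Lambda> * g x \<le> \<Lambda> * 2" using \<Lambda> gV(2)[OF x(2)] by (intro mult_left_mono) auto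
      ultimately show ?thesis using M(2) by simp
    qed
  qed
qed

text \<open>
  A small multiple of the barrier.  Outside \<open>K\<close> the barrier has the right sign; on the compact set
  \<open>K\<close> the function \<open>f\<close> is bounded below by some \<open>m > 0\<close>, and everything that the barrier contributes
  is made small against \<open>m\<close>.  The parameter \<open>t\<close> is there because the same corrector has to serve all
  \<open>y\<close> in a compact set.  A torus has no boundary, and zero will do.
\<close>

lemma corrector:
  fixes f :: "'c::metric_space \<times> (real^'n) \<Rightarrow> real"
  assumes T: "compact T" and cont: "continuous_on (T \<times> closure (cover S)) f"
    and pos: "\<And>t z. t \<in> T \<Longrightarrow> z \<in> cover S \<Longrightarrow> f (t, z) > 0"
    and kap: "\<kappa> > 0" and \<Lambda>: "\<Lambda> \<ge> 0"
  obtains g where "C2on UNIV g" "descends S g"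
    "\<And>x. x \<in> frontier (cover S) \<Longrightarrow> \<exists>\<mu>>0. conormal S a g x \<mu>"
    "\<And>t z. t \<in> T \<Longrightarrow> z \<in> closure (cover S) \<Longrightarrow> f (t, z) + g z > 0"
    "\<And>t z l. t \<in> T \<Longrightarrow> z \<in> cover S \<Longrightarrow> \<bar>l\<bar> \<le> \<Lambda> \<Longrightarrow> opLz S a b g z + l * g z \<le> \<kappa> * (f (t, z) + g z)"
proof (cases S)
  case Torus
  have c: "cover S = UNIV" using Torus by simp
  show ?thesis
  proof (rule that[of "\<lambda>x. 0"])
    show "opLz S a b (\<lambda>x. 0) z + l * 0 \<le> \<kappa> * (f (t, z) + 0)" if "t \<in> T" for t z l
      using opLz_const[of z 0] pos[OF that, of z] kap c by simp
  qed (use pos c in \<open>auto simp: C2on_const descends_const\<close>)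
next
  case (Domain U)
  obtain g K where g: "C2on UNIV g" "compact K" "K \<subseteq> cover S"
    "\<And>x. x \<in> frontier (cover S) \<Longrightarrow> \<exists>\<kappa>>0. conormal S a g x \<kappa>"
    "\<And>x. x \<in> closure (cover S) - K \<Longrightarrow> g x > 0"
    "\<And>x. x \<in> cover S - K \<Longrightarrow> opLz S a b g x + \<Lambda> * g x \<le> 0"
    using barrier_domain[OF Domain \<Lambda>] by blast
  have Kc: "K \<subseteq> closure (cover S)" using g(3) closure_subset by blast
  obtain C where C: "C \<ge> 0" "\<And>x. x \<in> K \<Longrightarrow> \<bar>opLz S a b g x\<bar> \<le> C"
    using opLz_bounded[OF g(1,2) Kc] g(3) by blast
  obtain G where G: "G \<ge> 0" "\<And>x. x \<in> K \<Longrightarrow> \<bar>g x\<bar> \<le> G"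
  proof -
    have "compact (g ` K)"
      using compact_continuous_image[OF continuous_on_subset[OF C2on_continuous[OF g(1)] subset_UNIV] g(2)] .
    then obtain B where "\<forall>y\<in>g ` K. \<bar>y\<bar> \<le> B" using compact_imp_bounded bounded_real by metis
    then have "\<bar>g x\<bar> \<le> max B 0" if "x \<in> K" for x using that by (simp add: max.coboundedI1)
    then show ?thesis using that[of "max B 0"] by simp
  qed
  obtain m where m: "m > 0" "\<And>t z. t \<in> T \<Longrightarrow> z \<in> K \<Longrightarrow> f (t, z) \<ge> m"
  proof (cases "T \<times> K = {}")
    case False
    have "continuous_on (T \<times> K) f" by (rule continuous_on_subset[OF cont]) (use Kc in blast)
    then obtain w where w: "w \<in> T \<times> K" "\<forall>v\<in>T \<times> K. f w \<le> f v"
      using continuous_attains_inf[OF compact_Times[OF T g(2)] False] by blast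
    have "f w > 0" using w(1) pos g(3) by auto
    then show ?thesis using that[of "f w"] w(2) by auto
  qed (use that[of 1] in auto)
  define \<tau> where "\<tau> = m * min 1 \<kappa> / (2 * (C + \<Lambda> * G + G + 1))"
  have den: "C + \<Lambda> * G + G + 1 > 0" using C G \<Lambda> by (simp add: add_nonneg_pos)
  have \<tau>: "\<tau> > 0" using m kap den by (simp add: \<tau>_def)
  have \<tau>eq: "\<tau> * (C + \<Lambda> * G + G + 1) = m * min 1 \<kappa> / 2"
    using den unfolding \<tau>_def by (simp add: field_simps)
  have \<tau>nn: "0 \<le> \<tau> * C" "0 \<le> \<tau> * (\<Lambda> * G)" "0 \<le> \<tau> * G" using \<tau> C G \<Lambda> by auto
  have mm: "m * min 1 \<kappa> \<le> m" "m * min 1 \<kappa> \<le> m * \<kappa>" using m by (auto intro: mult_left_le)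
  have split: "\<tau> * (C + \<Lambda> * G + G + 1) = \<tau> * C + \<tau> * (\<Lambda> * G) + \<tau> * G + \<tau>"
    "\<tau> * (C + \<Lambda> * G) = \<tau> * C + \<tau> * (\<Lambda> * G)" "\<kappa> * (m / 2) = m * \<kappa> / 2"
    by (simp_all add: distrib_left)
  have \<tau>G: "\<tau> * G \<le> m / 2" using \<tau>eq \<tau>nn mm(1) \<tau> split(1) by linarith
  have \<tau>C: "\<tau> * (C + \<Lambda> * G) \<le> \<kappa> * (m / 2)"
    using \<tau>eq \<tau>nn mm(2) \<tau> unfolding split by linarith
  have nonneg: "f (t, z) \<ge> 0" if "t \<in> T" "z \<in> closure (cover S)" for t z
  proof (rule continuous_ge_on_closure[OF _ that(2)])
    show "continuous_on (closure (cover S)) (\<lambda>z. f (t, z))"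
      by (rule continuous_on_compose2[OF cont]) (use that in \<open>auto intro!: continuous_intros\<close>)
  qed (use pos that in \<open>auto intro: less_imp_le\<close>)
  have inK: "f (t, z) + \<tau> * g z \<ge> m / 2" if "t \<in> T" "z \<in> K" for t z
  proof -
    have "\<bar>\<tau> * g z\<bar> \<le> \<tau> * G" unfolding abs_mult using \<tau> G(2)[OF that(2)] by simp
    then show ?thesis using \<tau>G m(2)[OF that] by linarith
  qed
  have pos': "f (t, z) + \<tau> * g z > 0" if "t \<in> T" "z \<in> closure (cover S)" for t z
  proof (cases "z \<in> K")
    case True
    then show ?thesis using inK[OF that(1)] m(1) by fastforce
  next
    case False
    then show ?thesis using nonneg[OF that] g(5)[of z] that \<tau> by (simp add: add_nonneg_pos)
  qed
  show ?thesis
  proof (rule that[of "\<lambda>x. \<tau> * g x"])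
    show "C2on UNIV (\<lambda>x. \<tau> * g x)" by (rule C2on_cmult[OF open_UNIV g(1)])
    show "descends S (\<lambda>x. \<tau> * g x)" by (simp add: Domain)
    show "\<exists>\<mu>>0. conormal S a (\<lambda>x. \<tau> * g x) x \<mu>" if x: "x \<in> frontier (cover S)" for x
    proof -
      obtain \<mu> where "\<mu> > 0" "conormal S a g x \<mu>" using g(4)[OF x] by blast
      with conormal_lincomb[OF x subset_cover[OF g(1)] subset_cover[OF g(1)] this(2,2), of \<tau> 0] \<tau>
      show ?thesis by (intro exI[of _ "\<tau> * \<mu>"]) auto
    qed
    show "f (t, z) + \<tau> * g z > 0" if "t \<in> T" "z \<in> closure (cover S)" for t z by (rule pos'[OF that])
    show "opLz S a b (\<lambda>x. \<tau> * g x) z + l * (\<tau> * g z) \<le> \<kappa> * (f (t, z) + \<tau> * g z)"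
      if t: "t \<in> T" and z: "z \<in> cover S" and l: "\<bar>l\<bar> \<le> \<Lambda>" for t z l
    proof -
      have zc: "z \<in> closure (cover S)" using z closure_subset by blast
      have eq: "opLz S a b (\<lambda>x. \<tau> * g x) z + l * (\<tau> * g z) = \<tau> * (opLz S a b g z + l * g z)"
        using opLz_cmult[OF z subset_cover[OF g(1)]] by (simp add: algebra_simps)
      show ?thesis
      proof (cases "z \<in> K")
        case True
        have "\<bar>l * g z\<bar> \<le> \<Lambda> * G" unfolding abs_mult using l G(2)[OF True] \<Lambda> by (intro mult_mono) auto
        then have "opLz S a b g z + l * g z \<le> C + \<Lambda> * G" using C(2)[OF True] by linarith
        then have "\<tau> * (opLz S a b g z + l * g z) \<le> \<tau> * (C + \<Lambda> * G)" using \<tau> by (intro mult_left_mono) auto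
        also have "\<dots> \<le> \<kappa> * (m / 2)" by (rule \<tau>C)
        also have "\<dots> \<le> \<kappa> * (f (t, z) + \<tau> * g z)" using inK[OF t True] kap by (intro mult_left_mono) auto
        finally show ?thesis unfolding eq .
      next
        case False
        have "l * g z \<le> \<Lambda> * g z" using l g(5)[of z] False zc by (intro mult_right_mono) auto
        then have "opLz S a b g z + l * g z \<le> 0" using g(6)[of z] False z by simp
        then have "\<tau> * (opLz S a b g z + l * g z) \<le> 0" using \<tau> by (simp add: mult_nonneg_nonpos)
        also have "0 \<le> \<kappa> * (f (t, z) + \<tau> * g z)" using pos'[OF t zc] kap by simp
        finally show ?thesis unfolding eq .
      qed
    qed
  qed
qed

definition neumann_eigen :: "(real^'n \<Rightarrow> real) \<Rightarrow> (real^'n \<Rightarrow> real) \<Rightarrow> real \<Rightarrow> bool" where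
  "neumann_eigen c \<psi> k \<longleftrightarrow> C2on (cover S) \<psi> \<and> continuous_on (closure (cover S)) \<psi> \<and> descends S \<psi> \<and>
     (\<forall>z\<in>cover S. \<psi> z > 0) \<and> (\<forall>z\<in>cover S. opLz S a b \<psi> z + c z * \<psi> z = k * \<psi> z) \<and>
     (\<forall>z\<in>frontier (cover S). conormal S a \<psi> z 0)"

text \<open>
  The comparison functions on the larger side of the touching principle: positive up to the boundary
  and with strictly positive conormal derivative.
\<close>

definition strict_super :: "(real^'n \<Rightarrow> real) \<Rightarrow> (real^'n \<Rightarrow> real) \<Rightarrow> real \<Rightarrow> bool" where
  "strict_super c \<psi> k \<longleftrightarrow> C2on (cover S) \<psi> \<and> continuous_on (closure (cover S)) \<psi> \<and> descends S \<psi> \<and>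
     (\<forall>z\<in>closure (cover S). \<psi> z > 0) \<and> (\<forall>z\<in>cover S. opLz S a b \<psi> z + c z * \<psi> z \<le> k * \<psi> z) \<and>
     (\<forall>z\<in>frontier (cover S). \<exists>\<mu>>0. conormal S a \<psi> z \<mu>)"

lemma strict_super_exists:
  assumes e: "neumann_eigen c \<psi> k" and c: "continuous_on (closure (cover S)) c" "descends S c" and kap: "\<kappa> > 0"
  obtains \<psi>' where "strict_super c \<psi>' (k + \<kappa>)"
proof -
  have p: "C2on (cover S) \<psi>" "continuous_on (closure (cover S)) \<psi>" "descends S \<psi>"
     "\<And>z. z \<in> cover S \<Longrightarrow> \<psi> z > 0" "\<And>z. z \<in> cover S \<Longrightarrow> opLz S a b \<psi> z + c z * \<psi> z = k * \<psi> z"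
     "\<And>z. z \<in> frontier (cover S) \<Longrightarrow> conormal S a \<psi> z 0"
    using e by (auto simp: neumann_eigen_def)
  obtain C where C: "C \<ge> 0" "\<And>z. z \<in> closure (cover S) \<Longrightarrow> \<bar>c z\<bar> \<le> C"
    using periodic_bounded[OF adm c] by blast
  \<comment> \<open>the parameter set is a single dummy point\<close>
  obtain g where g: "C2on UNIV g" "descends S g"
    "\<And>x. x \<in> frontier (cover S) \<Longrightarrow> \<exists>\<mu>>0. conormal S a g x \<mu>"
    "\<And>t z. t \<in> {0::real} \<Longrightarrow> z \<in> closure (cover S) \<Longrightarrow> \<psi> (snd (t, z)) + g z > 0"
    "\<And>t z l. t \<in> {0::real} \<Longrightarrow> z \<in> cover S \<Longrightarrow> \<bar>l\<bar> \<le> C + \<bar>k\<bar> \<Longrightarrow> opLz S a b g z + l * g z \<le> \<kappa> * (\<psi> (snd (t, z)) + g z)"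
  proof (rule corrector[of "{0::real}" "\<lambda>w. \<psi> (snd w)" \<kappa> "C + \<bar>k\<bar>"])
    show "continuous_on ({0} \<times> closure (cover S)) (\<lambda>w. \<psi> (snd w))"
      by (rule continuous_on_compose2[OF p(2)]) (auto intro!: continuous_intros)
  qed (use p kap C in auto)
  have gS: "C2on (cover S) g" by (rule subset_cover[OF g(1)])
  define f where "f y = 1 * \<psi> y + 1 * g y" for y
  have "strict_super c f (k + \<kappa>)"
    unfolding strict_super_def
  proof (intro conjI ballI)
    show "C2on (cover S) f" unfolding f_def[abs_def] by (rule C2on_lincomb[OF open_cover p(1) gS])
    show "continuous_on (closure (cover S)) f"
      unfolding f_def[abs_def] using C2on_continuous[OF g(1)] continuous_on_subset
      by (intro continuous_intros p(2)) blast+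
    show "descends S f" unfolding f_def[abs_def] by (rule descends_binop[OF p(3) g(2)])
    show "f z > 0" if "z \<in> closure (cover S)" for z using g(4)[OF _ that] by (simp add: f_def)
    show "opLz S a b f z + c z * f z \<le> (k + \<kappa>) * f z" if z: "z \<in> cover S" for z
    proof -
      have zc: "z \<in> closure (cover S)" using z closure_subset by blast
      have "opLz S a b f z = opLz S a b \<psi> z + opLz S a b g z"
        unfolding f_def[abs_def] using opLz_lincomb[OF z p(1) gS, of 1 1] by simp
      moreover have "\<bar>c z - k\<bar> \<le> C + \<bar>k\<bar>" using C(2)[OF zc] by linarith
      with g(5)[of 0, OF _ z] have "opLz S a b g z + (c z - k) * g z \<le> \<kappa> * f z"
        by (simp add: f_def)
      ultimately show ?thesis using p(5)[OF z] by (simp add: f_def algebra_simps)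
    qed
    show "\<exists>\<mu>>0. conormal S a f z \<mu>" if z: "z \<in> frontier (cover S)" for z
    proof -
      obtain \<mu> where "\<mu> > 0" "conormal S a g z \<mu>" using g(3)[OF z] by blast
      then show ?thesis
        unfolding f_def[abs_def] using conormal_lincomb[OF z p(1) gS p(6)[OF z], of \<mu> 1 1]
        by (intro exI[of _ \<mu>]) simp
    qed
  qed
  then show ?thesis using that by blast
qed

text \<open>
  Let \<open>\<psi>'\<close> be a corrected eigenfunction of the second problem.  The two sides touch where
  \<open>\<psi>\<^sub>1 / \<psi>'\<close> is maximal.
\<close>

lemma eigenvalue_compare:
  assumes e1: "neumann_eigen c1 \<psi>1 k1" and e2: "neumann_eigen c2 \<psi>2 k2"
    and c: "continuous_on (closure (cover S)) c2" "descends S c2"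
    and D: "\<And>z. z \<in> cover S \<Longrightarrow> c1 z - c2 z \<le> D"
  shows "k1 \<le> k2 + D"
proof (rule field_le_epsilon)
  fix \<kappa> :: real assume "\<kappa> > 0"
  then obtain \<psi>' where "strict_super c2 \<psi>' (k2 + \<kappa>)" using strict_super_exists[OF e2 c] by blast
  then have s: "C2on (cover S) \<psi>'" "continuous_on (closure (cover S)) \<psi>'" "descends S \<psi>'"
     "\<And>z. z \<in> closure (cover S) \<Longrightarrow> \<psi>' z > 0" "\<And>z. z \<in> cover S \<Longrightarrow> opLz S a b \<psi>' z + c2 z * \<psi>' z \<le> (k2 + \<kappa>) * \<psi>' z"
     "\<And>z. z \<in> frontier (cover S) \<Longrightarrow> \<exists>\<mu>>0. conormal S a \<psi>' z \<mu>"
    by (auto simp: strict_super_def)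
  have p: "C2on (cover S) \<psi>1" "continuous_on (closure (cover S)) \<psi>1" "descends S \<psi>1"
     "\<And>z. z \<in> cover S \<Longrightarrow> \<psi>1 z > 0" "\<And>z. z \<in> cover S \<Longrightarrow> opLz S a b \<psi>1 z + c1 z * \<psi>1 z = k1 * \<psi>1 z"
     "\<And>z. z \<in> frontier (cover S) \<Longrightarrow> conormal S a \<psi>1 z 0"
    using e1 by (auto simp: neumann_eigen_def)
  have "continuous_on (closure (cover S)) (\<lambda>z. \<psi>1 z / \<psi>' z)"
    using s(4) by (intro continuous_intros p(2) s(2)) force
  then obtain x where x: "x \<in> closure (cover S)" "\<And>z. z \<in> closure (cover S) \<Longrightarrow> \<psi>1 z / \<psi>' z \<le> \<psi>1 x / \<psi>' x"
    using periodic_max[OF adm _ descends_binop[OF p(3) s(3), of "(/)"]] by blast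
  define M where "M = \<psi>1 x / \<psi>' x"
  obtain z0 where z0: "z0 \<in> cover S" using cover_nonempty[OF adm] by blast
  have z0c: "z0 \<in> closure (cover S)" using z0 closure_subset by blast
  have "0 < \<psi>1 z0 / \<psi>' z0" using p(4)[OF z0] s(4)[OF z0c] by simp
  also have "\<dots> \<le> M" unfolding M_def by (rule x(2)[OF z0c])
  finally have M: "M > 0" .
  have le: "\<psi>1 z \<le> M * \<psi>' z" if "z \<in> closure (cover S)" for z
    using x(2)[OF that] s(4)[OF that] by (simp add: M_def pos_divide_le_eq)
  have eq: "\<psi>1 x = M * \<psi>' x" using s(4)[OF x(1)] by (simp add: M_def)
  have con: "\<exists>\<mu>>0. conormal S a (\<lambda>y. M * \<psi>' y) x \<mu>" if f: "x \<in> frontier (cover S)"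
  proof -
    obtain \<mu> where "\<mu> > 0" "conormal S a \<psi>' x \<mu>" using s(6)[OF f] by blast
    then show ?thesis using conormal_lincomb[OF f s(1,1), of \<mu> \<mu> M 0] M by (intro exI[of _ "M * \<mu>"]) auto
  qed
  have cont2: "continuous_on (closure (cover S)) (\<lambda>y. M * \<psi>' y)" by (intro continuous_intros s(2))
  note t = touching[OF x(1) p(1) C2on_cmult[OF open_cover s(1)] p(2) cont2 zero_less_one le eq p(6) con]
  have xS: "x \<in> cover S" using t by blast
  have "opLz S a b \<psi>1 x \<le> M * opLz S a b \<psi>' x"
    using t opLz_cmult[OF xS s(1)] by simp
  moreover have "M * (opLz S a b \<psi>' x + c2 x * \<psi>' x) \<le> M * ((k2 + \<kappa>) * \<psi>' x)"
    using s(5)[OF xS] M by (intro mult_left_mono) auto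
  ultimately have "opLz S a b \<psi>1 x + c2 x * \<psi>1 x \<le> (k2 + \<kappa>) * \<psi>1 x"
    unfolding eq by (simp add: algebra_simps)
  moreover have "(c1 x - c2 x) * \<psi>1 x \<le> D * \<psi>1 x"
    using D[OF xS] p(4)[OF xS] by (intro mult_right_mono) auto
  ultimately have "k1 * \<psi>1 x \<le> (k2 + \<kappa> + D) * \<psi>1 x"
    using p(5)[OF xS] by (simp add: algebra_simps)
  then show "k1 \<le> k2 + D + \<kappa>" using p(4)[OF xS] by simp
qed

end

section \<open>The product problem\<close>

text \<open>
  Composing a defining function with \<open>\<pi>\<close> gives a defining function of the preimage; \<open>e\<close> is the image
  of the normal under the adjoint map.
\<close>

lemma outward_normal_preimage:
  fixes \<pi> :: "'a::euclidean_space \<Rightarrow> 'b::euclidean_space"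
  assumes "outward_unit_normal U (\<pi> w) \<nu>" and \<pi>: "bounded_linear \<pi>" "\<And>v v'. dist (\<pi> v) (\<pi> v') \<le> dist v v'"
    and e: "norm e = 1" "\<And>h. \<pi> h \<bullet> \<nu> = h \<bullet> e"
  shows "outward_unit_normal (\<pi> -` U) w e"
proof -
  obtain r \<rho> d where *: "r > 0" "d > 0" "\<rho> (\<pi> w) = 0" "GDERIV \<rho> (\<pi> w) :> d *\<^sub>R \<nu>"
      "U \<inter> ball (\<pi> w) r = {x' \<in> ball (\<pi> w) r. \<rho> x' < (0::real)}"
    using assms(1) unfolding outward_unit_normal_def by blast
  have "((\<lambda>v. \<rho> (\<pi> v)) has_derivative (\<lambda>h. \<pi> h \<bullet> (d *\<^sub>R \<nu>))) (at w)"
    by (rule has_derivative_compose[OF bounded_linear.has_derivative[OF \<pi>(1) has_derivative_ident]])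
       (use *(4) in \<open>simp add: gderiv_def\<close>)
  then have g: "GDERIV (\<lambda>v. \<rho> (\<pi> v)) w :> d *\<^sub>R e"
    by (simp add: gderiv_def e(2))
  have b: "\<pi> v \<in> ball (\<pi> w) r" if "v \<in> ball w r" for v
    using that \<pi>(2)[of w v] by auto
  have "\<pi> -` U \<inter> ball w r = {x' \<in> ball w r. \<rho> (\<pi> x') < 0}"
    using *(5) b by (auto simp: set_eq_iff)
  then show ?thesis
    unfolding outward_unit_normal_def using *(1-3) e(1) g
    by (intro conjI exI[of _ r] exI[of _ "\<lambda>v. \<rho> (\<pi> v)"] exI[of _ d]) auto
qed

lemma outward_normal_cylinder:
  fixes y :: "'a::euclidean_space" and z :: "'b::euclidean_space"
  shows "outward_unit_normal U y \<nu> \<Longrightarrow> outward_unit_normal (U \<times> UNIV) (y, z) (\<nu>, 0)"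
    and "outward_unit_normal V z \<mu> \<Longrightarrow> outward_unit_normal (UNIV \<times> V) (y, z) (0, \<mu>)"
  using outward_normal_preimage[of U fst "(y, z)" \<nu> "(\<nu>, 0)"] outward_normal_preimage[of V snd "(y, z)" \<mu> "(0, \<mu>)"]
  by (auto simp: outward_unit_normal_def[of U] outward_unit_normal_def[of V] bounded_linear_fst bounded_linear_snd
      dist_fst_le dist_snd_le norm_Pair inner_prod_def vimage_fst vimage_snd)

context elliptic_space
begin

lemma normal_exists: "x \<in> frontier (cover S) \<Longrightarrow> \<exists>\<nu>. outward_unit_normal (cover S) x \<nu>"
  using defining_function[OF alpha adm] by blast

lemma local_neumann_eigen:
  fixes c :: "(real^'m) \<times> (real^'n) \<Rightarrow> real"
  assumes "local_eigenpair \<alpha> S a b c y0 \<psi> k"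
  shows "neumann_eigen (\<lambda>z. c (y0, z)) \<psi> k"
proof -
  have h: "holder_on 2 \<alpha> (cover S) \<psi>" "descends S \<psi>"
    and e: "\<And>z. z \<in> cover S \<Longrightarrow> opLz S a b \<psi> z + c (y0, z) * \<psi> z = k * \<psi> z"
    and pos: "\<And>z. z \<in> cover S \<Longrightarrow> \<psi> z > 0"
    and neu: "\<And>z \<nu>. z \<in> frontier (cover S) \<Longrightarrow> outward_unit_normal (cover S) z \<nu> \<Longrightarrow>
        \<nu> \<bullet> (a z *v grad (cover S) \<psi> z) = 0"
    using assms unfolding local_eigenpair_def holder_space_def by auto
  have sl: "slice (cover S) (\<lambda>x. x) 0 (cover S)"
    by unfold_locales (use open_cover in \<open>auto simp: axis_Basis intro: exI[of _ 1]\<close>)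
  have "conormal S a \<psi> z 0" if z: "z \<in> frontier (cover S)" for z
  proof -
    obtain \<nu> where nu: "outward_unit_normal (cover S) z \<nu>" using normal_exists[OF z] by blast
    have zc: "z \<in> closure (cover S)" using z by (simp add: frontier_def)
    have "conormal S a (\<lambda>y. \<psi> (y + 0)) z (grad (cover S) \<psi> (z + 0) \<bullet> (a z *v \<nu>))"
      using conormal_slice[OF sl alpha h(1)[unfolded numeral_2_eq_2] zc nu] by simp
    moreover have "grad (cover S) \<psi> z \<bullet> (a z *v \<nu>) = 0"
      using neu[OF z nu] a_sym_inner[OF zc] by (metis inner_commute)
    ultimately show ?thesis by simp
  qed
  then show ?thesis
    unfolding neumann_eigen_def
    using C2on_holder[OF alpha h(1) open_cover] holder_on_continuous[OF alpha h(1)] h(2) e pos by blast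
qed

end

locale product_problem =
  Y: elliptic_space Y A "\<lambda>_. 0" \<alpha> + Z: elliptic_space Z a b \<alpha>
  for Y :: "(real^'n) space" and Z :: "(real^'p) space" and A a b and \<alpha> :: real +
  fixes c :: "(real^'n) \<times> (real^'p) \<Rightarrow> real" and L :: real
  assumes torus: "Y = Torus \<or> Z = Torus" and c_desc: "descendsW Y Z c"
    and c_lip: "L-lipschitz_on (closure (coverW Y Z)) c"
begin

abbreviation "clY \<equiv> closure (cover Y)"
abbreviation "clZ \<equiv> closure (cover Z)"

abbreviation "LY \<equiv> opLz Y A (\<lambda>_. 0)"
abbreviation "LZ \<equiv> opLz Z a b"

lemma clW: "closure (coverW Y Z) = clY \<times> clZ"
  by (simp add: coverW_def closure_Times)

lemma L_nonneg: "L \<ge> 0"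
  using c_lip by (rule lipschitz_on_nonneg)

lemma c_lip_y: "y \<in> clY \<Longrightarrow> y' \<in> clY \<Longrightarrow> z \<in> clZ \<Longrightarrow> \<bar>c (y, z) - c (y', z)\<bar> \<le> L * dist y y'"
  using lipschitz_onD[OF c_lip, of "(y, z)" "(y', z)"] by (simp add: clW dist_Pair_Pair dist_real_def)

lemma c_cont: "continuous_on (clY \<times> clZ) c"
  using lipschitz_on_continuous_on[OF c_lip] by (simp add: clW)

lemma c_desc_y: "z \<in> clZ \<Longrightarrow> descends Y (\<lambda>y. c (y, z))"
  and c_desc_z: "y \<in> clY \<Longrightarrow> descends Z (\<lambda>z. c (y, z))"
  using c_desc by (auto simp: descendsW_def)

lemma cont_slice_z:
  assumes "continuous_on (clY \<times> clZ) f" "y \<in> clY"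
  shows "continuous_on clZ (\<lambda>z. f (y, z))"
  by (rule continuous_on_compose2[OF assms(1)]) (use assms(2) in \<open>auto intro!: continuous_intros\<close>)

lemma cont_slice_y:
  assumes "continuous_on (clY \<times> clZ) f" "z \<in> clZ"
  shows "continuous_on clY (\<lambda>y. f (y, z))"
  by (rule continuous_on_compose2[OF assms(1)]) (use assms(2) in \<open>auto intro!: continuous_intros\<close>)

lemma c_bounded:
  obtains C where "C \<ge> 0" "\<And>y z. y \<in> clY \<Longrightarrow> z \<in> clZ \<Longrightarrow> \<bar>c (y, z)\<bar> \<le> C"
proof -
  have "compact (c ` (closed_cell Y \<times> closed_cell Z))"
    by (intro compact_continuous_image compact_Times compact_closed_cell[OF Y.adm] compact_closed_cell[OF Z.adm]
        continuous_on_subset[OF c_cont] Sigma_mono closed_cell_subset)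
  then obtain C where C: "\<forall>x\<in>c ` (closed_cell Y \<times> closed_cell Z). \<bar>x\<bar> \<le> C" using compact_imp_bounded bounded_real by metis
  have "\<bar>c (y, z)\<bar> \<le> max C 0" if yz: "y \<in> clY" "z \<in> clZ" for y z
  proof -
    obtain y' where y': "y' \<in> closed_cell Y" "c (y', z) = c (y, z)"
      using closed_cell_rep[OF yz(1)] c_desc_y[OF yz(2)] by metis
    obtain z' where z': "z' \<in> closed_cell Z" "c (y', z') = c (y', z)"
      using closed_cell_rep[OF yz(2)] c_desc_z[of y'] y'(1) closed_cell_subset by (metis subsetD)
    have "\<bar>c (y', z')\<bar> \<le> C" using C y'(1) z'(1) by blast
    then show ?thesis using y' z' by simp
  qed
  then show ?thesis using that[of "max C 0"] by simp
qed

lemma Y_zeroth: "zeroth (\<lambda>_. 0) y = 0"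
  by (simp add: zeroth_def)

text \<open>
  The global problem seen through its slices.  As at most one factor has a boundary, each slice lives
  in the interior of the other factor whenever it meets the boundary of its own.
\<close>

definition slicewise_solution :: "real \<Rightarrow> ((real^'n) \<times> (real^'p) \<Rightarrow> real) \<Rightarrow> real \<Rightarrow> bool" where
  "slicewise_solution \<epsilon> \<phi> k \<longleftrightarrow> continuous_on (clY \<times> clZ) \<phi> \<and> descendsW Y Z \<phi> \<and>
     (\<forall>y\<in>cover Y. \<forall>z\<in>cover Z. \<phi> (y, z) > 0) \<and>
     (\<forall>z\<in>cover Z. C2on (cover Y) (\<lambda>y. \<phi> (y, z))) \<and>
     (\<forall>y\<in>cover Y. C2on (cover Z) (\<lambda>z. \<phi> (y, z))) \<and>
     (\<forall>y\<in>cover Y. \<forall>z\<in>cover Z. \<epsilon>\<^sup>2 * LY (\<lambda>y. \<phi> (y, z)) y + LZ (\<lambda>z. \<phi> (y, z)) z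
        + c (y, z) * \<phi> (y, z) = k * \<phi> (y, z)) \<and>
     (\<forall>y\<in>frontier (cover Y). \<forall>z\<in>cover Z. conormal Y A (\<lambda>y. \<phi> (y, z)) y 0) \<and>
     (\<forall>y\<in>cover Y. \<forall>z\<in>frontier (cover Z). conormal Z a (\<lambda>z. \<phi> (y, z)) z 0)"

lemma slicewise_solutionD:
  assumes "slicewise_solution \<epsilon> \<phi> k"
  shows "continuous_on (clY \<times> clZ) \<phi>" "descendsW Y Z \<phi>"
    "\<And>y z. y \<in> cover Y \<Longrightarrow> z \<in> cover Z \<Longrightarrow> \<phi> (y, z) > 0"
    "\<And>z. z \<in> cover Z \<Longrightarrow> C2on (cover Y) (\<lambda>y. \<phi> (y, z))"
    "\<And>y. y \<in> cover Y \<Longrightarrow> C2on (cover Z) (\<lambda>z. \<phi> (y, z))"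
    "\<And>y z. y \<in> cover Y \<Longrightarrow> z \<in> cover Z \<Longrightarrow> \<epsilon>\<^sup>2 * LY (\<lambda>y. \<phi> (y, z)) y
      + LZ (\<lambda>z. \<phi> (y, z)) z + c (y, z) * \<phi> (y, z) = k * \<phi> (y, z)"
    "\<And>y z. y \<in> cover Y \<Longrightarrow> z \<in> frontier (cover Z) \<Longrightarrow> conormal Z a (\<lambda>z. \<phi> (y, z)) z 0"
    "\<And>y z. y \<in> frontier (cover Y) \<Longrightarrow> z \<in> cover Z \<Longrightarrow> conormal Y A (\<lambda>y. \<phi> (y, z)) y 0"
  using assms by (auto simp: slicewise_solution_def)

lemma slice_left: "z \<in> cover Z \<Longrightarrow> slice (coverW Y Z) (\<lambda>y. (y, 0)) (0, z) (cover Y)"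
  by unfold_locales
     (auto simp: coverW_def Basis_prod_def axis_Basis norm_Pair intro!: open_Times Y.open_cover Z.open_cover exI[of _ 1])

lemma slice_right: "y \<in> cover Y \<Longrightarrow> slice (coverW Y Z) (\<lambda>z. (0, z)) (y, 0) (cover Z)"
  by unfold_locales
     (auto simp: coverW_def Basis_prod_def axis_Basis norm_Pair intro!: open_Times Y.open_cover Z.open_cover exI[of _ 1])

lemma slicewise_solutionI:
  assumes g: "global_eigenpair \<alpha> Y Z A B a b c \<epsilon> \<phi> k" and B0: "\<forall>y\<in>closure (cover Y). B y = 0"
  shows "slicewise_solution \<epsilon> \<phi> k"
proof -
  have h: "descendsW Y Z \<phi>" "holder_on 2 \<alpha> (coverW Y Z) \<phi>"
    and e: "\<And>y z. y \<in> cover Y \<Longrightarrow> z \<in> cover Z \<Longrightarrow> opLy Y A B \<epsilon> (\<lambda>y'. \<phi> (y', z)) y + LZ (\<lambda>z'. \<phi> (y, z')) z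
          + c (y, z) * \<phi> (y, z) = k * \<phi> (y, z)"
    and pos: "\<And>y z. y \<in> cover Y \<Longrightarrow> z \<in> cover Z \<Longrightarrow> \<phi> (y, z) > 0"
    and neu: "\<And>y z \<nu>. (y, z) \<in> frontier (coverW Y Z) \<Longrightarrow> outward_unit_normal (coverW Y Z) (y, z) \<nu> \<Longrightarrow>
        \<nu> \<bullet> block_diag_mult (A y) (a z) (grad (coverW Y Z) \<phi> (y, z)) = 0"
    using g unfolding global_eigenpair_def coverW_def by auto
  have "opLy Y A B \<epsilon> f y = \<epsilon>\<^sup>2 * LY f y" if y: "y \<in> cover Y" for f y
  proof -
    have "pd i (\<lambda>y'. f y' *\<^sub>R B y') y = pd i (\<lambda>y'. 0) y" for i
      by (rule pd_cong_open[OF Y.open_cover y]) (use B0 closure_subset in force)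
    then have "divg (cover Y) (\<lambda>y'. f y' *\<^sub>R B y') y = 0" "divg (cover Y) (\<lambda>y'. 0) y = 0"
      by (simp_all add: divg_interior[OF y])
    then show ?thesis by (simp add: opLy_def opLz_def)
  qed
  then have e': "\<epsilon>\<^sup>2 * LY (\<lambda>y. \<phi> (y, z)) y + LZ (\<lambda>z. \<phi> (y, z)) z
        + c (y, z) * \<phi> (y, z) = k * \<phi> (y, z)" if "y \<in> cover Y" "z \<in> cover Z" for y z
    using e[OF that] that by simp
  have c1: "C2on (cover Y) (\<lambda>y. \<phi> (y, z))" if "z \<in> cover Z" for z
    using slice.C2on_slice[OF slice_left[OF that] Y.alpha h(2)] by simp
  have c2: "C2on (cover Z) (\<lambda>z. \<phi> (y, z))" if "y \<in> cover Y" for y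
    using slice.C2on_slice[OF slice_right[OF that] Y.alpha h(2)] by simp
  have n1: "conormal Y A (\<lambda>y. \<phi> (y, z)) y 0" if y: "y \<in> frontier (cover Y)" and z: "z \<in> cover Z" for y z
  proof -
    have "Y \<noteq> Torus" using y by auto
    then have Z: "Z = Torus" using torus by simp
    obtain \<nu> where nu: "outward_unit_normal (cover Y) y \<nu>" using Y.normal_exists[OF y] by blast
    have yc: "y \<in> clY" using y by (simp add: frontier_def)
    have "outward_unit_normal (coverW Y Z) (y, z) (\<nu>, 0)"
      using outward_normal_cylinder(1)[OF nu] by (simp add: coverW_def Z)
    moreover have "(y, z) \<in> frontier (coverW Y Z)"
      using y by (auto simp: frontier_def coverW_def Z closure_Times interior_Times)
    ultimately have "\<nu> \<bullet> (A y *v fst (grad (coverW Y Z) \<phi> (y, z))) = 0"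
      using neu[of y z "(\<nu>, 0)"] by (simp add: block_diag_mult_def inner_prod_def)
    then have "grad (coverW Y Z) \<phi> (y, z) \<bullet> (A y *v \<nu>, 0) = 0"
      using Y.a_sym_inner[OF yc] by (simp add: inner_prod_def) (metis inner_commute)
    then show ?thesis
      using Y.conormal_slice[OF slice_left[OF z] Y.alpha h(2)[unfolded numeral_2_eq_2] yc nu] by simp
  qed
  have n2: "conormal Z a (\<lambda>z. \<phi> (y, z)) z 0" if y: "y \<in> cover Y" and z: "z \<in> frontier (cover Z)" for y z
  proof -
    have "Z \<noteq> Torus" using z by auto
    then have Y: "Y = Torus" using torus by simp
    obtain \<nu> where nu: "outward_unit_normal (cover Z) z \<nu>" using Z.normal_exists[OF z] by blast
    have zc: "z \<in> clZ" using z by (simp add: frontier_def)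
    have "outward_unit_normal (coverW Y Z) (y, z) (0, \<nu>)"
      using outward_normal_cylinder(2)[OF nu] by (simp add: coverW_def Y)
    moreover have "(y, z) \<in> frontier (coverW Y Z)"
      using z by (auto simp: frontier_def coverW_def Y closure_Times interior_Times)
    ultimately have "\<nu> \<bullet> (a z *v snd (grad (coverW Y Z) \<phi> (y, z))) = 0"
      using neu[of y z "(0, \<nu>)"] by (simp add: block_diag_mult_def inner_prod_def)
    then have "grad (coverW Y Z) \<phi> (y, z) \<bullet> (0, a z *v \<nu>) = 0"
      using Z.a_sym_inner[OF zc] by (simp add: inner_prod_def) (metis inner_commute)
    then show ?thesis
      using Z.conormal_slice[OF slice_right[OF y] Y.alpha h(2)[unfolded numeral_2_eq_2] zc nu] by simp
  qed
  show ?thesis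
    unfolding slicewise_solution_def
    using holder_on_continuous[OF Y.alpha h(2)] h(1) pos c1 c2 e' n1 n2 by (simp add: clW)
qed

section \<open>The lower bound\<close>

text \<open>
  With \<open>s = \<delta>\<^sup>2 - |y - y\<^sub>0|\<^sup>2\<close>, the chain rule gives \<open>2 s L s + 2 \<nabla>s \<cdot> A\<nabla>s\<close> for \<open>s\<^sup>2\<close>.
  Near the edge of the ball the second term, of size \<open>\<delta>\<^sup>2\<close>, beats the first, of size \<open>s\<close>;
  away from the edge \<open>s\<close> is bounded below, so that \<open>s\<close> is at most a multiple of \<open>s\<^sup>2\<close>.
\<close>

lemma bump_estimate:
  assumes d: "\<delta> > 0" "cball y0 \<delta> \<subseteq> cover Y"
  obtains C where "C \<ge> 0" "\<And>y. y \<in> cball y0 \<delta> \<Longrightarrow>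
    LY (\<lambda>y. (\<delta>\<^sup>2 - (norm (y - y0))\<^sup>2)\<^sup>2) y \<ge> - C * (\<delta>\<^sup>2 - (norm (y - y0))\<^sup>2)\<^sup>2"
proof -
  define s where "s y = \<delta>\<^sup>2 - (norm (y - y0))\<^sup>2" for y
  have s2: "C2on UNIV s"
    using C2on_lincomb[OF open_UNIV C2on_const[of UNIV "\<delta>\<^sup>2"] C2on_sqdist[OF open_UNIV, of y0], of 1 "-1"]
    by (simp add: s_def[abs_def])
  have sub: "cball y0 \<delta> \<subseteq> clY" using d(2) closure_subset by blast
  obtain C1 where C1: "C1 \<ge> 0" "\<And>y. y \<in> cball y0 \<delta> \<Longrightarrow> \<bar>LY s y\<bar> \<le> C1"
    using Y.opLz_bounded[OF s2 compact_cball sub] d(2) by blast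
  obtain lo where lo: "lo > 0" "\<forall>x\<in>clY. \<forall>f. lo * (norm (\<chi> i. pd i f x))\<^sup>2 \<le> quad A f x"
    using Y.quad_lower by blast
  have grad_s: "(norm (\<chi> i. pd i s y))\<^sup>2 = 4 * (\<delta>\<^sup>2 - s y)" for y
  proof -
    have "(s has_derivative (\<lambda>h. - (2 * (h \<bullet> (y - y0))))) (at y)"
      unfolding s_def[abs_def] power2_norm_eq_inner
      by (auto intro!: derivative_eq_intros simp: inner_commute)
    then have "pd i s y = - 2 * (y - y0) $ i" for i
      using pd_eqI[of s _ y i] by (simp add: inner_axis')
    then have "(\<chi> i. pd i s y) = (-2) *\<^sub>R (y - y0)" by (simp add: vec_eq_iff)
    then show ?thesis by (simp add: s_def power_mult_distrib)
  qed
  \<comment> \<open>where the two competing terms balance\<close>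
  define s1 where "s1 = 4 * lo * \<delta>\<^sup>2 / (C1 + 4 * lo)"
  have s1: "s1 > 0" "s1 * (C1 + 4 * lo) = 4 * lo * \<delta>\<^sup>2" using lo C1 d(1) by (auto simp: s1_def add_nonneg_pos)
  define C where "C = 2 * C1 / s1"
  have C: "C \<ge> 0" "C * s1 = 2 * C1" using C1 s1 by (auto simp: C_def)
  show ?thesis
  proof (rule that[OF C(1)])
    fix y assume y: "y \<in> cball y0 \<delta>"
    have yY: "y \<in> cover Y" using y d(2) by blast
    have "norm (y - y0) \<le> \<delta>" using y by (simp add: dist_norm norm_minus_commute)
    then have "(norm (y - y0))\<^sup>2 \<le> \<delta>\<^sup>2" by (intro power_mono) auto
    then have s0: "0 \<le> s y" "s y \<le> \<delta>\<^sup>2" by (auto simp: s_def)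
    have "LY (\<lambda>y. (s y)\<^sup>2) y = 2 * s y * LY s y + 2 * quad A s y"
      by (subst Y.opLz_compose[OF yY Y.subset_cover[OF s2], where p' = "\<lambda>t. 2 * t" and p'' = "\<lambda>t. 2"])
         (auto intro!: derivative_eq_intros simp: Y_zeroth)
    moreover have "4 * lo * (\<delta>\<^sup>2 - s y) \<le> quad A s y"
    proof -
      have "y \<in> clY" using yY closure_subset by blast
      with lo(2) have "lo * (norm (\<chi> i. pd i s y))\<^sup>2 \<le> quad A s y" by blast
      then show ?thesis unfolding grad_s by (simp add: mult.assoc mult.left_commute)
    qed
    moreover have "- (s y * C1) \<le> s y * LY s y"
    proof -
      have "s y * (- C1) \<le> s y * LY s y"
        using C1(2)[OF y] s0(1) by (intro mult_left_mono) auto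
      then show ?thesis by simp
    qed
    ultimately have 1: "LY (\<lambda>y. (s y)\<^sup>2) y \<ge> - 2 * (s y * C1) + 8 * lo * (\<delta>\<^sup>2 - s y)" by simp
    have "- 2 * (s y * C1) + 8 * lo * (\<delta>\<^sup>2 - s y) \<ge> - C * (s y)\<^sup>2"
    proof (cases "s y \<le> s1")
      case True
      have "s y * (C1 + 4 * lo) \<le> 4 * lo * \<delta>\<^sup>2"
        unfolding s1(2)[symmetric] using True C1(1) lo(1) by (intro mult_right_mono) auto
      then have "- 2 * (s y * C1) + 8 * lo * (\<delta>\<^sup>2 - s y) \<ge> 0" by (simp add: algebra_simps)
      moreover have "C * (s y)\<^sup>2 \<ge> 0" using C(1) by simp
      ultimately show ?thesis by linarith
    next
      case False
      have "C * s1 * s y \<le> C * s y * s y" using False C(1) s0 by (intro mult_right_mono mult_left_mono) auto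
      moreover have "C * s y * s y = C * (s y)\<^sup>2" "C * s1 * s y = 2 * (s y * C1)"
        by (simp_all add: power2_eq_square C(2))
      moreover have "8 * lo * (\<delta>\<^sup>2 - s y) \<ge> 0" using lo s0 by simp
      ultimately show ?thesis by linarith
    qed
    with 1 have "LY (\<lambda>y. (s y)\<^sup>2) y \<ge> - C * (s y)\<^sup>2" by linarith
    then show "LY (\<lambda>y. (\<delta>\<^sup>2 - (norm (y - y0))\<^sup>2)\<^sup>2) y \<ge> - C * (\<delta>\<^sup>2 - (norm (y - y0))\<^sup>2)\<^sup>2"
      by (simp add: s_def)
  qed
qed

text \<open>
  The variable \<open>z\<close> may range over a noncompact cover; periodicity brings it back to a compact cell.
\<close>

lemma product_max:
  fixes R :: "(real^'n) \<times> (real^'p) \<Rightarrow> real"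
  assumes T: "compact T" "T \<noteq> {}" and R: "continuous_on (T \<times> clZ) R" "\<And>y. y \<in> T \<Longrightarrow> descends Z (\<lambda>z. R (y, z))"
  obtains y z where "y \<in> T" "z \<in> clZ" "\<And>y' z'. y' \<in> T \<Longrightarrow> z' \<in> clZ \<Longrightarrow> R (y', z') \<le> R (y, z)"
proof -
  have ne: "T \<times> closed_cell Z \<noteq> {}"
    using T(2) cover_nonempty[OF Z.adm] closed_cell_rep closure_subset by (metis Sigma_empty_iff all_not_in_conv subsetD)
  have "continuous_on (T \<times> closed_cell Z) R"
    by (rule continuous_on_subset[OF R(1)]) (use closed_cell_subset[of Z] in blast)
  then obtain w where w: "w \<in> T \<times> closed_cell Z" "\<forall>v\<in>T \<times> closed_cell Z. R v \<le> R w"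
    using continuous_attains_sup[OF compact_Times[OF T(1) compact_closed_cell[OF Z.adm]] ne] by blast
  have "R (y', z') \<le> R w" if y': "y' \<in> T" and z': "z' \<in> clZ" for y' z'
  proof -
    obtain z'' where "z'' \<in> closed_cell Z" "R (y', z'') = R (y', z')"
      using closed_cell_rep[OF z'] R(2)[OF y'] by metis
    then show ?thesis using w(2) y' by (metis SigmaI)
  qed
  then show ?thesis using that[of "fst w" "snd w"] w(1) closed_cell_subset[of Z] by auto
qed

text \<open>
  The bump times the local eigenfunction is compared with the global eigenfunction, corrected by a
  function \<open>g\<close> of \<open>z\<close> alone, at the point where their ratio is maximal.  The ratio vanishes on the edge
  of the ball, so the point is interior in \<open>y\<close>; the slice in \<open>z\<close> is treated first, to learn that the
  point is interior in \<open>z\<close> as well.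
\<close>

lemma lower_bound:
  assumes d: "\<delta> > 0" "cball y0 \<delta> \<subseteq> cover Y" and e: "Z.neumann_eigen (\<lambda>z. c (y0, z)) \<psi> k0"
  shows "\<exists>C\<ge>0. \<forall>\<epsilon>>0. \<forall>\<phi> k. slicewise_solution \<epsilon> \<phi> k \<longrightarrow> k0 - L * \<delta> - \<epsilon>\<^sup>2 * C \<le> k"
proof -
  define \<eta> where "\<eta> y = (\<delta>\<^sup>2 - (norm (y - y0))\<^sup>2)\<^sup>2" for y
  obtain C where C: "C \<ge> 0" "\<And>y. y \<in> cball y0 \<delta> \<Longrightarrow> LY \<eta> y \<ge> - C * \<eta> y"
    using bump_estimate[OF d] unfolding \<eta>_def[abs_def] by blast
  have \<eta>2: "C2on UNIV \<eta>"
  proof -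
    have "C2on UNIV (\<lambda>y. 1 * \<delta>\<^sup>2 + (-1) * (norm (y - y0))\<^sup>2)"
      by (intro C2on_lincomb C2on_const C2on_sqdist open_UNIV)
    then have "C2on UNIV (\<lambda>y. (1 * \<delta>\<^sup>2 + (-1) * (norm (y - y0))\<^sup>2) * (1 * \<delta>\<^sup>2 + (-1) * (norm (y - y0))\<^sup>2))"
      by (intro C2on_mult open_UNIV)
    then show ?thesis by (simp add: \<eta>_def[abs_def] power2_eq_square)
  qed
  note \<eta>Y = Y.subset_cover[OF \<eta>2]
  have sub: "cball y0 \<delta> \<subseteq> clY" using d(2) closure_subset by blast
  have y0: "y0 \<in> cball y0 \<delta>" "y0 \<in> cover Y" "y0 \<in> clY" using d sub by auto
  obtain Cc where Cc: "Cc \<ge> 0" "\<And>y z. y \<in> clY \<Longrightarrow> z \<in> clZ \<Longrightarrow> \<bar>c (y, z)\<bar> \<le> Cc" using c_bounded by blast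
  have p: "C2on (cover Z) \<psi>" "continuous_on clZ \<psi>" "descends Z \<psi>"
     "\<And>z. z \<in> cover Z \<Longrightarrow> \<psi> z > 0" "\<And>z. z \<in> cover Z \<Longrightarrow> LZ \<psi> z + c (y0, z) * \<psi> z = k0 * \<psi> z"
     "\<And>z. z \<in> frontier (cover Z) \<Longrightarrow> conormal Z a \<psi> z 0"
    using e by (auto simp: Z.neumann_eigen_def)
  have "k0 - L * \<delta> - \<epsilon>\<^sup>2 * C \<le> k" if eps: "\<epsilon> > 0" and sol: "slicewise_solution \<epsilon> \<phi> k" for \<epsilon> \<phi> k
  proof (rule field_le_epsilon)
    fix \<kappa> :: real assume kap: "\<kappa> > 0"
    note f = slicewise_solutionD[OF sol]
    have fT: "continuous_on (cball y0 \<delta> \<times> clZ) \<phi>"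
      by (rule continuous_on_subset[OF f(1)]) (use sub in blast)
    have \<Lambda>: "Cc + \<bar>k\<bar> \<ge> 0" using Cc(1) by simp
    obtain g where g: "C2on UNIV g" "descends Z g"
      "\<And>x. x \<in> frontier (cover Z) \<Longrightarrow> \<exists>\<mu>>0. conormal Z a g x \<mu>"
      "\<And>t z. t \<in> cball y0 \<delta> \<Longrightarrow> z \<in> clZ \<Longrightarrow> \<phi> (t, z) + g z > 0"
      "\<And>t z l. t \<in> cball y0 \<delta> \<Longrightarrow> z \<in> cover Z \<Longrightarrow> \<bar>l\<bar> \<le> Cc + \<bar>k\<bar> \<Longrightarrow> LZ g z + l * g z \<le> \<kappa> * (\<phi> (t, z) + g z)"
      using Z.corrector[OF compact_cball fT _ kap \<Lambda>] f(3) d(2) by blast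
    note gZ = Z.subset_cover[OF g(1)]
    have gc: "continuous_on V g" for V using C2on_continuous[OF g(1)] continuous_on_subset by blast
    define R where "R w = \<eta> (fst w) * \<psi> (snd w) / (\<phi> w + g (snd w))" for w
    have "continuous_on (cball y0 \<delta> \<times> clZ) R"
      unfolding R_def
    proof (intro continuous_intros)
      show "continuous_on (cball y0 \<delta> \<times> clZ) (\<lambda>w. \<eta> (fst w))"
        by (rule continuous_on_compose2[OF C2on_continuous[OF \<eta>2]]) (auto intro!: continuous_intros)
      show "continuous_on (cball y0 \<delta> \<times> clZ) (\<lambda>w. \<psi> (snd w))"
        by (rule continuous_on_compose2[OF p(2)]) (auto intro!: continuous_intros)
      show "continuous_on (cball y0 \<delta> \<times> clZ) (\<lambda>w. g (snd w))"
        by (rule continuous_on_compose2[OF gc[of UNIV]]) (auto intro!: continuous_intros)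
      show "\<forall>w\<in>cball y0 \<delta> \<times> clZ. \<phi> w + g (snd w) \<noteq> 0" using g(4) by force
    qed (rule fT)
    moreover have "descends Z (\<lambda>z. R (y, z))" if "y \<in> cball y0 \<delta>" for y
    proof -
      have "descends Z (\<lambda>z. \<phi> (y, z))" using f(2) sub that by (auto simp: descendsW_def)
      from descends_binop[where h = "(/)", OF descends_binop[where h = "(*)", OF descends_const[where c = "\<eta> y"] p(3)]
        descends_binop[where h = "(+)", OF this g(2)]]
      show ?thesis by (simp add: R_def)
    qed
    moreover have "cball y0 \<delta> \<noteq> {}" using y0(1) by blast
    ultimately obtain y z where yz: "y \<in> cball y0 \<delta>" "z \<in> clZ"
      and max: "\<And>y' z'. y' \<in> cball y0 \<delta> \<Longrightarrow> z' \<in> clZ \<Longrightarrow> R (y', z') \<le> R (y, z)"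
      using product_max[OF compact_cball] by metis
    define M where "M = R (y, z)"
    have yY: "y \<in> cover Y" using yz(1) d(2) by blast
    obtain z0 where z0: "z0 \<in> cover Z" using cover_nonempty[OF Z.adm] by blast
    have z0c: "z0 \<in> clZ" using z0 closure_subset by blast
    have "0 < R (y0, z0)"
      using p(4)[OF z0] g(4)[OF y0(1) z0c] d(1) by (simp add: R_def \<eta>_def)
    also have "\<dots> \<le> M" unfolding M_def by (rule max[OF y0(1) z0c])
    finally have M: "M > 0" .
    have le: "\<eta> y' * \<psi> z' \<le> M * (\<phi> (y', z') + g z')" if "y' \<in> cball y0 \<delta>" "z' \<in> clZ" for y' z'
      using max[OF that] g(4)[OF that] by (simp add: M_def[symmetric]) (simp add: R_def pos_divide_le_eq)
    have eq: "\<eta> y * \<psi> z = M * (\<phi> (y, z) + g z)"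
      using g(4)[OF yz] by (simp add: M_def R_def)
    have prodpos: "\<eta> y * \<psi> z > 0" unfolding eq using M g(4)[OF yz] by simp
    have \<eta>pos: "\<eta> y > 0"
      using prodpos by (metis \<eta>_def less_irrefl mult_zero_left zero_le_power2 order_le_less)
    have ynear: "dist y0 y < \<delta>"
    proof (rule ccontr)
      assume "\<not> dist y0 y < \<delta>"
      then have "norm (y - y0) = \<delta>" using yz(1) by (simp add: dist_norm norm_minus_commute)
      then show False using \<eta>pos by (simp add: \<eta>_def)
    qed
    note phiZ = f(5)[OF yY]
    have psi2: "C2on (cover Z) (\<lambda>z. \<eta> y * \<psi> z)" by (rule C2on_cmult[OF Z.open_cover p(1)])
    have phi2: "C2on (cover Z) (\<lambda>z. M * \<phi> (y, z) + M * g z)" by (rule C2on_lincomb[OF Z.open_cover phiZ gZ])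
    have zt': "z \<in> cover Z \<and> LZ (\<lambda>z. \<eta> y * \<psi> z) z \<le> LZ (\<lambda>z. M * \<phi> (y, z) + M * g z) z"
    proof (rule Z.touching[OF yz(2) psi2 phi2 _ _ zero_less_one])
      show "continuous_on clZ (\<lambda>z. \<eta> y * \<psi> z)" by (intro continuous_intros p(2))
      show "continuous_on clZ (\<lambda>z. M * \<phi> (y, z) + M * g z)"
        using sub yz(1) by (intro continuous_intros cont_slice_z[OF f(1)] gc) auto
      show "\<eta> y * \<psi> z' \<le> M * \<phi> (y, z') + M * g z'" if "z' \<in> clZ" for z'
        using le[OF yz(1) that] by (simp add: distrib_left)
      show "\<eta> y * \<psi> z = M * \<phi> (y, z) + M * g z" using eq by (simp add: distrib_left)
      show "conormal Z a (\<lambda>z. \<eta> y * \<psi> z) z 0" if "z \<in> frontier (cover Z)"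
        using Z.conormal_lincomb[OF that p(1,1) p(6)[OF that] p(6)[OF that], of "\<eta> y" 0] by simp
      show "\<exists>\<kappa>>0. conormal Z a (\<lambda>z. M * \<phi> (y, z) + M * g z) z \<kappa>" if fr: "z \<in> frontier (cover Z)"
      proof -
        obtain \<mu> where "\<mu> > 0" "conormal Z a g z \<mu>" using g(3)[OF fr] by blast
        then show ?thesis using Z.conormal_lincomb[OF fr phiZ gZ f(7)[OF yY fr], of \<mu> M M] M
          by (intro exI[of _ "M * \<mu>"]) auto
      qed
    qed
    note zt = conjunct1[OF zt'] conjunct2[OF zt']
    have zin: "\<eta> y * LZ \<psi> z \<le> M * LZ (\<lambda>z. \<phi> (y, z)) z + M * LZ g z"
      using zt(2) unfolding Z.opLz_cmult[OF zt(1) p(1)] Z.opLz_lincomb[OF zt(1) phiZ gZ] .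
    note phiY = f(4)[OF zt(1)]
    have one: "C2on (cover Y) (\<lambda>y. 1)" by (rule C2on_const)
    \<comment> \<open>the corrector is constant in \<open>y\<close> and is moved to the other side\<close>
    have "LY (\<lambda>y. \<psi> z * \<eta> y + (- M * g z) * 1) y \<le> LY (\<lambda>y. M * \<phi> (y, z)) y"
    proof (rule Y.opLz_touch[OF yY])
      show "C2on (cover Y) (\<lambda>y. \<psi> z * \<eta> y + (- M * g z) * 1)" by (rule C2on_lincomb[OF Y.open_cover \<eta>Y one])
      show "C2on (cover Y) (\<lambda>y. M * \<phi> (y, z))" by (rule C2on_cmult[OF Y.open_cover phiY])
      show "\<delta> - dist y0 y > 0" using ynear by simp
      show "\<psi> z * \<eta> y' + (- M * g z) * 1 \<le> M * \<phi> (y', z)" if "y' \<in> ball y (\<delta> - dist y0 y)" for y'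
      proof -
        have "dist y0 y' \<le> dist y0 y + dist y y'" by (rule dist_triangle)
        then have "y' \<in> cball y0 \<delta>" using that by simp
        from le[OF this yz(2)] show ?thesis by (simp add: algebra_simps)
      qed
      show "\<psi> z * \<eta> y + (- M * g z) * 1 = M * \<phi> (y, z)" using eq by (simp add: algebra_simps)
    qed
    then have yin: "\<psi> z * LY \<eta> y \<le> M * LY (\<lambda>y. \<phi> (y, z)) y"
      unfolding Y.opLz_cmult[OF yY phiY] Y.opLz_lincomb[OF yY \<eta>Y one] Y.opLz_const[OF yY] by (simp add: Y_zeroth)
    have ycl: "y \<in> clY" using yY closure_subset by blast
    define P where "P = \<phi> (y, z)"
    define Q where "Q = P + g z"
    have Q: "\<eta> y * \<psi> z = M * Q" "Q > 0" using eq g(4)[OF yz] by (simp_all add: Q_def P_def)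
    have pz: "\<psi> z > 0" using p(4)[OF zt(1)] .
    have "\<bar>c (y, z) - k\<bar> \<le> Cc + \<bar>k\<bar>" using Cc(2)[OF ycl yz(2)] by linarith
    from g(5)[OF yz(1) zt(1) this] have gg: "LZ g z + (c (y, z) - k) * g z \<le> \<kappa> * Q" by (simp add: Q_def P_def)
    have pde: "\<epsilon>\<^sup>2 * LY (\<lambda>y. \<phi> (y, z)) y + LZ (\<lambda>z. \<phi> (y, z)) z + c (y, z) * P = k * P"
      using f(6)[OF yY zt(1)] by (simp add: P_def)
    have "\<psi> z * (- C * \<eta> y) \<le> \<psi> z * LY \<eta> y"
      using C(2)[OF yz(1)] pz by (intro mult_left_mono) auto
    with yin have "- C * (M * Q) \<le> M * LY (\<lambda>y. \<phi> (y, z)) y"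
      unfolding Q(1)[symmetric] by (simp add: mult.commute mult.left_commute)
    then have 1: "\<epsilon>\<^sup>2 * (- C * (M * Q)) \<le> \<epsilon>\<^sup>2 * (M * LY (\<lambda>y. \<phi> (y, z)) y)"
      by (intro mult_left_mono) auto
    have "LZ \<psi> z = (k0 - c (y0, z)) * \<psi> z"
      using p(5)[OF zt(1)] by (simp add: algebra_simps)
    then have "\<eta> y * LZ \<psi> z = (k0 - c (y0, z)) * (M * Q)"
      unfolding Q(1)[symmetric] by simp
    with zin have 2: "(k0 - c (y0, z)) * (M * Q) \<le> M * LZ (\<lambda>z. \<phi> (y, z)) z + M * LZ g z" by simp
    have "c (y0, z) - c (y, z) \<le> L * \<delta>"
    proof -
      have "c (y0, z) - c (y, z) \<le> L * dist y0 y" using c_lip_y[OF y0(3) ycl yz(2)] by linarith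
      also have "\<dots> \<le> L * \<delta>" using ynear L_nonneg by (intro mult_left_mono) auto
      finally show ?thesis .
    qed
    then have 3: "(c (y0, z) - c (y, z)) * (M * Q) \<le> L * \<delta> * (M * Q)"
      using M Q(2) by (intro mult_right_mono) auto
    have 4: "M * (LZ g z + (c (y, z) - k) * g z) \<le> M * (\<kappa> * Q)" using gg M by (intro mult_left_mono) auto
    have 5: "M * (\<epsilon>\<^sup>2 * LY (\<lambda>y. \<phi> (y, z)) y + LZ (\<lambda>z. \<phi> (y, z)) z + c (y, z) * P) = M * (k * P)"
      unfolding pde ..
    have "(k0 - L * \<delta> - \<epsilon>\<^sup>2 * C) * (M * Q) \<le> (k + \<kappa>) * (M * Q)"
      using 1 2 3 4 5 unfolding Q_def by (simp add: algebra_simps)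
    then show "k0 - L * \<delta> - \<epsilon>\<^sup>2 * C \<le> k + \<kappa>" using M Q(2) by simp
  qed
  then show ?thesis using C(1) by blast
qed

end

section \<open>The upper bound\<close>

context elliptic_space
begin

text \<open>
  On the boundary \<open>\<nabla>\<rho> = d \<nu>\<close> with \<open>d > 0\<close>, so the conormal derivative of the exponential has the
  sign of \<open>\<nabla>D \<cdot> a\<nabla>\<rho> + K \<nabla>\<rho> \<cdot> a\<nabla>\<rho>\<close>.  The first term is bounded and the second factor of
  \<open>K\<close> is bounded away from zero on the compact boundary.
\<close>

lemma weight_flux:
  assumes \<rho>: "C2on UNIV \<rho>"
    "\<And>x. x \<in> frontier (cover S) \<Longrightarrow> \<exists>\<nu> d. d > 0 \<and> outward_unit_normal (cover S) x \<nu> \<and> (GDERIV \<rho> x :> d *\<^sub>R \<nu>)"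
    and D: "C2on UNIV D"
  obtains K0 where "\<And>K x. K \<ge> K0 \<Longrightarrow> x \<in> frontier (cover S) \<Longrightarrow> \<exists>\<mu>>0. conormal S a (\<lambda>y. exp (D y + K * \<rho> y)) x \<mu>"
proof (cases "frontier (cover S) = {}")
  case True
  then show ?thesis using that by blast
next
  case False
  then obtain U where U: "S = Domain U" by (cases S) auto
  let ?F = "frontier (cover S)"
  have comp: "compact ?F" using adm U by (auto intro: compact_frontier_bounded)
  have cl: "?F \<subseteq> closure (cover S)" by (auto simp: frontier_def)
  define nr where "nr x = (\<chi> i. pd i \<rho> x)" for x
  define nD where "nD x = (\<chi> i. pd i D x)" for x
  have nc: "continuous_on V nr" "continuous_on V nD" for V
    unfolding nr_def nD_def using C1on_continuous[OF C2on_D(3)[OF \<rho>(1)]] C1on_continuous[OF C2on_D(3)[OF D]]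
    by (auto intro!: continuous_on_vec_lambda intro: continuous_on_subset[OF _ subset_UNIV])
  have ac: "continuous_on ?F a" using a_C1 cl continuous_on_subset unfolding C1_up_to_boundary_def by blast
  have anr: "continuous_on ?F (\<lambda>x. a x *v nr x)"
    by (rule bounded_bilinear.continuous_on[OF bounded_bilinear_matrix_vector ac nc(1)])
  define q1 where "q1 x = nD x \<bullet> (a x *v nr x)" for x
  define q2 where "q2 x = nr x \<bullet> (a x *v nr x)" for x
  have qc: "continuous_on ?F q1" "continuous_on ?F q2"
    unfolding q1_def q2_def by (intro continuous_intros anr nc)+
  have gr: "\<exists>\<nu> d. d > 0 \<and> outward_unit_normal (cover S) x \<nu> \<and> nr x = d *\<^sub>R \<nu>" if "x \<in> ?F" for x
  proof -
    obtain \<nu> d where d: "d > 0" "outward_unit_normal (cover S) x \<nu>" "GDERIV \<rho> x :> d *\<^sub>R \<nu>" using \<rho>(2)[OF \<open>x \<in> ?F\<close>] by blast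
    have "nr x = d *\<^sub>R \<nu>" using gderiv_pd(2)[OF d(3)] by (simp add: nr_def vec_eq_iff)
    with d show ?thesis by blast
  qed
  have q2pos: "q2 x > 0" if x: "x \<in> ?F" for x
  proof -
    have "nr x \<noteq> 0" using gr[OF x] by (auto simp: outward_unit_normal_def)
    then show ?thesis unfolding q2_def using a_pos cl x by blast
  qed
  obtain x2 where x2: "x2 \<in> ?F" "\<And>x. x \<in> ?F \<Longrightarrow> q2 x2 \<le> q2 x"
    using continuous_attains_inf[OF comp False qc(2)] by blast
  obtain x1 where x1: "x1 \<in> ?F" "\<And>x. x \<in> ?F \<Longrightarrow> q1 x1 \<le> q1 x"
    using continuous_attains_inf[OF comp False qc(1)] by blast
  show ?thesis
  proof (rule that[of "\<bar>q1 x1\<bar> / q2 x2 + 1"])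
    fix K x assume K: "K \<ge> \<bar>q1 x1\<bar> / q2 x2 + 1" and x: "x \<in> ?F"
    have xc: "x \<in> closure (cover S)" using x cl by blast
    have K0: "K \<ge> 0" using K q2pos[OF x2(1)] by (smt (verit) divide_nonneg_pos)
    have "\<bar>q1 x1\<bar> + q2 x2 \<le> K * q2 x2" using K q2pos[OF x2(1)] by (simp add: field_simps)
    also have "\<dots> \<le> K * q2 x" using x2(2)[OF x] K0 by (intro mult_left_mono) auto
    finally have q: "q1 x + K * q2 x > 0" using x1(2)[OF x] q2pos[OF x2(1)] by linarith
    let ?w = "\<lambda>y. exp (D y + K * \<rho> y)"
    have e2: "C2on UNIV (\<lambda>y. 1 * D y + K * \<rho> y)" by (rule C2on_lincomb[OF open_UNIV D \<rho>(1)])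
    then have w2: "C2on UNIV ?w" using C2on_exp[OF open_UNIV] by simp
    obtain \<nu> d where d: "d > 0" "outward_unit_normal (cover S) x \<nu>" "nr x = d *\<^sub>R \<nu>" using gr[OF x] by blast
    have "pd i ?w x = ?w x * (nD x $ i + K * nr x $ i)" for i
    proof -
      have dx: "D differentiable (at x)" "\<rho> differentiable (at x)" using C2on_D(1) D \<rho>(1) by auto
      then have "(\<lambda>y. 1 * D y + K * \<rho> y) differentiable (at x)" by simp
      from pd_compose(2)[OF this DERIV_exp] show ?thesis
        using pd_lincomb[OF dx, of i 1 K] by (simp add: nD_def nr_def)
    qed
    then have "(\<Sum>i\<in>UNIV. (a x *v \<nu>) $ i * pd i ?w x) = ?w x * ((nD x + K *\<^sub>R nr x) \<bullet> (a x *v \<nu>))"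
      by (simp add: inner_vec_def sum_distrib_left algebra_simps)
    moreover have "0 < (nD x + K *\<^sub>R nr x) \<bullet> (a x *v \<nu>)"
    proof -
      have "d * ((nD x + K *\<^sub>R nr x) \<bullet> (a x *v \<nu>)) = (nD x + K *\<^sub>R nr x) \<bullet> (a x *v nr x)"
        unfolding d(3) by (simp add: matrix_vector_mult_scaleR)
      also have "\<dots> = q1 x + K * q2 x" by (simp add: q1_def q2_def inner_add_left)
      finally show ?thesis using q d(1) by (metis zero_less_mult_pos)
    qed
    ultimately have "(\<Sum>i\<in>UNIV. (a x *v \<nu>) $ i * pd i ?w x) > 0" by simp
    then show "\<exists>\<mu>>0. conormal S a ?w x \<mu>" using conormal_C2[OF xc d(2) w2] by blast
  qed
qed

end

context product_problem
begin

text \<open>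
  The ratio of the global eigenfunction to \<open>W i y * \<Psi> i z\<close> is maximised over \<open>y\<close>, \<open>z\<close> and the index
  \<open>i\<close> of the net at once.  The order of the choices matters: \<open>\<delta>\<close> depends on \<open>e\<close>, then the net and the
  \<open>\<Psi> i\<close> on \<open>\<delta>\<close>, then \<open>N\<close> on the bounds of the \<open>\<Psi> i\<close>, and finally the coefficient \<open>Kr\<close> of \<open>\<rho>\<close> on
  \<open>N\<close>.  None of them depends on \<open>\<epsilon>\<close>, hence neither does the constant \<open>C\<close>.
\<close>

lemma upper_bound:
  assumes loc: "\<And>y. y \<in> closed_cell Y \<Longrightarrow> \<exists>\<psi> kk. Z.neumann_eigen (\<lambda>z. c (y, z)) \<psi> kk \<and> kk \<le> K" and e: "e > 0"
  shows "\<exists>C\<ge>0. \<forall>\<epsilon>>0. \<forall>\<phi> k. slicewise_solution \<epsilon> \<phi> k \<longrightarrow> k \<le> K + e + \<epsilon>\<^sup>2 * C"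
proof -
  define \<delta> where "\<delta> = min (1/4) (e / (4 * (L + 1)))"
  have \<delta>: "\<delta> > 0" "2 * \<delta> \<le> 1/2" "L * (2 * \<delta>) \<le> e / 2"
  proof -
    show "\<delta> > 0" "2 * \<delta> \<le> 1/2" using e L_nonneg by (auto simp: \<delta>_def)
    have "\<delta> \<le> e / (4 * (L + 1))" by (simp add: \<delta>_def)
    then have "(L + 1) * \<delta> \<le> e / 4" using L_nonneg by (simp add: field_simps)
    then show "L * (2 * \<delta>) \<le> e / 2" using \<open>\<delta> > 0\<close> by (simp add: algebra_simps)
  qed
  obtain I where I: "I \<subseteq> closed_cell Y" "finite I" "closed_cell Y \<subseteq> (\<Union>i\<in>I. ball i \<delta>)"
    by (rule compactE_image[OF compact_closed_cell[OF Y.adm], where C = "closed_cell Y" and f = "\<lambda>i. ball i \<delta>"]) (use \<delta>(1) in auto)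
  have Icl: "i \<in> clY" if "i \<in> I" for i using that I(1) closed_cell_subset by blast
  have "\<exists>\<Psi>. Z.strict_super (\<lambda>z. c (i, z)) \<Psi> (K + e/2)" if i: "i \<in> I" for i
  proof -
    obtain \<psi> kk where "Z.neumann_eigen (\<lambda>z. c (i, z)) \<psi> kk" "kk \<le> K" using loc I(1) i by blast
    moreover obtain \<Psi> where P: "Z.strict_super (\<lambda>z. c (i, z)) \<Psi> (kk + e/2)"
      using Z.strict_super_exists[OF calculation(1) cont_slice_z[OF c_cont Icl[OF i]] c_desc_z[OF Icl[OF i]], of "e/2"] e by auto
    have "LZ \<Psi> z + c (i, z) * \<Psi> z \<le> (K + e/2) * \<Psi> z" if z: "z \<in> cover Z" for z
    proof -
      have zc: "z \<in> clZ" using z closure_subset by blast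
      have "LZ \<Psi> z + c (i, z) * \<Psi> z \<le> (kk + e/2) * \<Psi> z" using P z unfolding Z.strict_super_def by blast
      also have "\<dots> \<le> (K + e/2) * \<Psi> z"
        using \<open>kk \<le> K\<close> P zc unfolding Z.strict_super_def by (intro mult_right_mono) (auto intro: less_imp_le)
      finally show ?thesis .
    qed
    then show ?thesis using P unfolding Z.strict_super_def by blast
  qed
  then obtain \<Psi> where "\<And>i. i \<in> I \<Longrightarrow> Z.strict_super (\<lambda>z. c (i, z)) (\<Psi> i) (K + e/2)" by metis
  then have \<Psi>: "\<And>i. i \<in> I \<Longrightarrow> C2on (cover Z) (\<Psi> i)" "\<And>i. i \<in> I \<Longrightarrow> continuous_on clZ (\<Psi> i)"
    "\<And>i. i \<in> I \<Longrightarrow> descends Z (\<Psi> i)" "\<And>i z. i \<in> I \<Longrightarrow> z \<in> clZ \<Longrightarrow> \<Psi> i z > 0"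
    "\<And>i z. i \<in> I \<Longrightarrow> z \<in> cover Z \<Longrightarrow> LZ (\<Psi> i) z + c (i, z) * \<Psi> i z \<le> (K + e/2) * \<Psi> i z"
    "\<And>i z. i \<in> I \<Longrightarrow> z \<in> frontier (cover Z) \<Longrightarrow> \<exists>\<mu>>0. conormal Z a (\<Psi> i) z \<mu>"
    unfolding Z.strict_super_def by auto
  have "\<exists>B\<ge>0. \<forall>z\<in>clZ. \<Psi> i z \<le> B \<and> 1 \<le> B * \<Psi> i z" if i: "i \<in> I" for i
  proof -
    obtain B1 where B1: "B1 \<ge> 0" "\<And>z. z \<in> clZ \<Longrightarrow> \<bar>\<Psi> i z\<bar> \<le> B1"
      using periodic_bounded[OF Z.adm \<Psi>(2,3)[OF i]] by blast
    have "continuous_on clZ (\<lambda>z. 1 / \<Psi> i z)"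
      using \<Psi>(4)[OF i] by (intro continuous_intros \<Psi>(2)[OF i]) force
    then obtain B2 where B2: "B2 \<ge> 0" "\<And>z. z \<in> clZ \<Longrightarrow> \<bar>1 / \<Psi> i z\<bar> \<le> B2"
      using periodic_bounded[OF Z.adm _ descends_binop[where h = "\<lambda>x y. 1 / x", OF \<Psi>(3)[OF i] \<Psi>(3)[OF i]]] by blast
    have "\<Psi> i z \<le> B1 + B2 \<and> 1 \<le> (B1 + B2) * \<Psi> i z" if z: "z \<in> clZ" for z
    proof
      show "\<Psi> i z \<le> B1 + B2" using B1(2)[OF z] B2(1) by linarith
      have "1 / \<Psi> i z \<le> B2" using B2(2)[OF z] by linarith
      then have "1 \<le> B2 * \<Psi> i z" using \<Psi>(4)[OF i z] by (simp add: pos_divide_le_eq)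
      moreover have "0 \<le> B1 * \<Psi> i z" using B1(1) \<Psi>(4)[OF i z] by simp
      ultimately show "1 \<le> (B1 + B2) * \<Psi> i z" by (simp add: distrib_right)
    qed
    then show ?thesis using B1(1) B2(1) by (intro exI[of _ "B1 + B2"]) auto
  qed
  then obtain Bi where Bi: "\<And>i. i \<in> I \<Longrightarrow> Bi i \<ge> 0" "\<And>i z. i \<in> I \<Longrightarrow> z \<in> clZ \<Longrightarrow> \<Psi> i z \<le> Bi i \<and> 1 \<le> Bi i * \<Psi> i z"
    by metis
  define B where "B = (\<Sum>i\<in>I. Bi i)"
  have BiB: "Bi i \<le> B" if "i \<in> I" for i
    unfolding B_def using I(2) that Bi(1) by (intro member_le_sum) auto
  have B: "\<Psi> i z \<le> B" "1 \<le> B * \<Psi> i z" if "i \<in> I" "z \<in> clZ" for i z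
  proof -
    show "\<Psi> i z \<le> B" using Bi(2)[OF that] BiB[OF that(1)] by linarith
    have "Bi i * \<Psi> i z \<le> B * \<Psi> i z" using BiB[OF that(1)] \<Psi>(4)[OF that] by (intro mult_right_mono) auto
    then show "1 \<le> B * \<Psi> i z" using Bi(2)[OF that] by linarith
  qed
  have B0: "B \<ge> 0" unfolding B_def using Bi(1) by (intro sum_nonneg) auto
  \<comment> \<open>so that \<open>exp (3 N \<delta>\<^sup>2) \<ge> B\<^sup>2\<close>, which bounds all quotients of the \<open>\<Psi> i\<close>\<close>
  define N where "N = (B * B) / (3 * \<delta>\<^sup>2)"
  have N: "N \<ge> 0" "N * (3 * \<delta>\<^sup>2) = B * B" using \<delta>(1) B0 by (auto simp: N_def)
  obtain \<rho> where \<rho>: "C2on UNIV \<rho>" "descends Y \<rho>"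
    "\<And>x. x \<in> frontier (cover Y) \<Longrightarrow> \<exists>\<nu> d. d > 0 \<and> outward_unit_normal (cover Y) x \<nu> \<and> (GDERIV \<rho> x :> d *\<^sub>R \<nu>)"
    using defining_function[OF Y.alpha Y.adm] by blast
  define D where "D i y = N * (norm (y - i))\<^sup>2" for i y :: "real^'n"
  have D2: "C2on UNIV (D i)" for i unfolding D_def[abs_def] by (intro C2on_cmult C2on_sqdist open_UNIV)
  have "\<exists>K0. \<forall>Kr x. Kr \<ge> K0 \<longrightarrow> x \<in> frontier (cover Y) \<longrightarrow> (\<exists>\<mu>>0. conormal Y A (\<lambda>y. exp (D i y + Kr * \<rho> y)) x \<mu>)" for i
    using Y.weight_flux[OF \<rho>(1,3) D2[of i]] by metis
  then obtain K0 where K0: "\<And>i Kr x. Kr \<ge> K0 i \<Longrightarrow> x \<in> frontier (cover Y) \<Longrightarrow> \<exists>\<mu>>0. conormal Y A (\<lambda>y. exp (D i y + Kr * \<rho> y)) x \<mu>"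
    by metis
  define Kr where "Kr = (\<Sum>i\<in>I. \<bar>K0 i\<bar>)"
  have Kr: "K0 i \<le> Kr" if "i \<in> I" for i
  proof -
    have "\<bar>K0 i\<bar> \<le> Kr" unfolding Kr_def using I(2) that by (intro member_le_sum) auto
    then show ?thesis by linarith
  qed
  define W where "W i y = exp (D i y + Kr * \<rho> y)" for i y
  have W2: "C2on UNIV (W i)" for i
    using C2on_exp[OF open_UNIV C2on_lincomb[OF open_UNIV D2[of i] \<rho>(1), of 1 Kr]] by (simp add: W_def[abs_def])
  have Wpos: "W i y > 0" for i y by (simp add: W_def)
  have Wflux: "\<exists>\<mu>>0. conormal Y A (W i) y \<mu>" if "i \<in> I" "y \<in> frontier (cover Y)" for i y
    using K0[OF Kr[OF that(1)] that(2)] unfolding W_def[abs_def] .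
  have Wc: "continuous_on V (W i)" for V i using C2on_continuous[OF W2] continuous_on_subset by blast
  obtain r where r: "\<And>y. y \<in> closed_cell Y \<Longrightarrow> norm y \<le> r"
    using compact_imp_bounded[OF compact_closed_cell[OF Y.adm]] bounded_iff by metis
  \<comment> \<open>a compact set of \<open>y\<close> that contains a neighbourhood, within the closed domain, of every net point; on a torus it replaces the noncompact cover\<close>
  define T where "T = cball 0 (r + 1) \<inter> clY"
  have T: "compact T" "T \<subseteq> clY" by (auto simp: T_def intro: compact_Int_closed)
  have cellT: "closed_cell Y \<subseteq> T" using r closed_cell_subset[of Y] by (force simp: T_def)
  have nearT: "y' \<in> T" if "i \<in> I" "dist i y' \<le> 1" "y' \<in> clY" for i y'
  proof -
    have "norm y' \<le> norm i + dist i y'" by (metis dist_norm norm_minus_commute norm_triangle_sub)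
    then show ?thesis using r[of i] I(1) that by (auto simp: T_def)
  qed
  have "\<exists>C\<ge>0. \<forall>y\<in>T \<inter> cover Y. LY (W i) y \<le> C * W i y" for i
  proof (cases "T = {}")
    case False
    obtain C1 where C1: "C1 \<ge> 0" "\<And>y. y \<in> T \<inter> cover Y \<Longrightarrow> \<bar>LY (W i) y\<bar> \<le> C1"
      using Y.opLz_bounded[OF W2 T] by blast
    obtain w where w: "\<forall>y\<in>T. W i w \<le> W i y" using continuous_attains_inf[OF T(1) False Wc] by blast
    have "LY (W i) y \<le> C1 / W i w * W i y" if y: "y \<in> T \<inter> cover Y" for y
    proof -
      have "C1 / W i w * W i w \<le> C1 / W i w * W i y"
        using w y C1(1) Wpos[of i w] by (intro mult_left_mono) auto
      moreover have "C1 / W i w * W i w = C1" using Wpos[of i w] by simp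
      ultimately show ?thesis using C1(2)[OF y] by linarith
    qed
    then show ?thesis using C1(1) Wpos[of i w] by (intro exI[of _ "C1 / W i w"]) auto
  qed auto
  then obtain Ci where Ci: "\<And>i. Ci i \<ge> 0" "\<And>i y. y \<in> T \<inter> cover Y \<Longrightarrow> LY (W i) y \<le> Ci i * W i y" by metis
  define C where "C = (\<Sum>i\<in>I. Ci i)"
  have C0: "C \<ge> 0" unfolding C_def using Ci(1) by (intro sum_nonneg) auto
  have C: "LY (W i) y \<le> C * W i y" if "i \<in> I" "y \<in> T" "y \<in> cover Y" for i y
  proof -
    have "Ci i \<le> C" unfolding C_def using I(2) that(1) Ci(1) by (intro member_le_sum) auto
    then have "Ci i * W i y \<le> C * W i y" using Wpos[of i y] by (intro mult_right_mono) auto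
    then show ?thesis using Ci(2)[of y i] that by fastforce
  qed
  have "k \<le> K + e + \<epsilon>\<^sup>2 * C" if eps: "\<epsilon> > 0" and sol: "slicewise_solution \<epsilon> \<phi> k" for \<epsilon> \<phi> k
  proof -
    note f = slicewise_solutionD[OF sol]
    have fdy: "descends Y (\<lambda>y. \<phi> (y, z))" if "z \<in> clZ" for z using f(2) that by (simp add: descendsW_def)
    define R where "R i w = \<phi> w / (W i (fst w) * \<Psi> i (snd w))" for i w
    have fT: "continuous_on (T \<times> clZ) \<phi>" by (rule continuous_on_subset[OF f(1)]) (use T(2) in blast)
    obtain y0 where y0: "y0 \<in> cover Y" using cover_nonempty[OF Y.adm] by blast
    obtain z0 where z0: "z0 \<in> cover Z" using cover_nonempty[OF Z.adm] by blast
    have z0c: "z0 \<in> clZ" using z0 closure_subset by blast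
    have y0c: "y0 \<in> clY" using y0 closure_subset by blast
    obtain y1 where y1: "y1 \<in> closed_cell Y" "\<phi> (y1, z0) = \<phi> (y0, z0)"
      using closed_cell_rep[OF y0c] fdy[OF z0c] by metis
    have Tne: "T \<noteq> {}" using y1(1) cellT by blast
    obtain i1 where i1: "i1 \<in> I" using I(3) y1(1) by blast
    have "\<exists>y z. y \<in> T \<and> z \<in> clZ \<and> (\<forall>y'\<in>T. \<forall>z'\<in>clZ. R i (y', z') \<le> R i (y, z))" if i: "i \<in> I" for i
    proof -
      have "continuous_on (T \<times> clZ) (R i)"
        unfolding R_def
      proof (intro continuous_intros fT)
        show "continuous_on (T \<times> clZ) (\<lambda>w. W i (fst w))"
          by (rule continuous_on_compose2[OF Wc[of UNIV]]) (auto intro!: continuous_intros)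
        show "continuous_on (T \<times> clZ) (\<lambda>w. \<Psi> i (snd w))"
          by (rule continuous_on_compose2[OF \<Psi>(2)[OF i]]) (auto intro!: continuous_intros)
        show "\<forall>w\<in>T \<times> clZ. W i (fst w) * \<Psi> i (snd w) \<noteq> 0" using \<Psi>(4)[OF i] Wpos[of i] by (force simp: less_le)
      qed
      moreover have "descends Z (\<lambda>z. R i (y, z))" if "y \<in> T" for y
      proof -
        have "descends Z (\<lambda>z. \<phi> (y, z))" using f(2) T(2) that by (auto simp: descendsW_def)
        from descends_binop[where h = "\<lambda>p q. p / (W i y * q)", OF this \<Psi>(3)[OF i]]
        show ?thesis by (simp add: R_def)
      qed
      ultimately show ?thesis using product_max[OF T(1) Tne] by metis
    qed
    then obtain ym zm where m: "\<And>i. i \<in> I \<Longrightarrow> ym i \<in> T \<and> zm i \<in> clZ \<and> (\<forall>y'\<in>T. \<forall>z'\<in>clZ. R i (y', z') \<le> R i (ym i, zm i))" by metis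
    have "finite ((\<lambda>i. R i (ym i, zm i)) ` I)" "(\<lambda>i. R i (ym i, zm i)) ` I \<noteq> {}" using I(2) i1 by auto
    from Max_in[OF this] Max_ge[OF this(1)]
    obtain i where i: "i \<in> I" "\<And>j. j \<in> I \<Longrightarrow> R j (ym j, zm j) \<le> R i (ym i, zm i)" by force
    define y where "y = ym i"
    define z where "z = zm i"
    have yz: "y \<in> T" "z \<in> clZ" using m[OF i(1)] by (auto simp: y_def z_def)
    have ycl: "y \<in> clY" using yz(1) T(2) by blast
    define M where "M = R i (y, z)"
    have max: "R j (y', z') \<le> M" if "j \<in> I" "y' \<in> T" "z' \<in> clZ" for j y' z'
      using m[OF that(1)] i(2)[OF that(1)] that unfolding M_def y_def z_def by force
    have M: "M > 0"
    proof -
      have "0 < R i1 (y1, z0)" using f(3)[OF y0 z0] y1(2) Wpos[of i1 y1] \<Psi>(4)[OF i1 z0c] by (simp add: R_def)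
      also have "\<dots> \<le> M" using max[OF i1 _ z0c] y1(1) cellT by blast
      finally show ?thesis .
    qed
    have le: "\<phi> (y', z') \<le> M * (W i y' * \<Psi> i z')" if "y' \<in> T" "z' \<in> clZ" for y' z'
      using max[OF i(1) that] Wpos[of i y'] \<Psi>(4)[OF i(1) that(2)] by (simp add: R_def pos_divide_le_eq)
    have eq: "\<phi> (y, z) = M * (W i y * \<Psi> i z)"
      using Wpos[of i y] \<Psi>(4)[OF i(1) yz(2)] by (simp add: M_def R_def)
    have phipos: "\<phi> (y, z) > 0" unfolding eq using M Wpos[of i y] \<Psi>(4)[OF i(1) yz(2)] by simp
    \<comment> \<open>a translate \<open>y'\<close> of \<open>y\<close> lies close to some net point \<open>j\<close>; by maximality \<open>i\<close> is not much farther from \<open>y\<close>, as the factors with \<open>\<rho>\<close> cancel\<close>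
    have near: "dist i y \<le> 2 * \<delta>"
    proof -
      obtain y' where y': "y' \<in> closed_cell Y" "\<And>f::real^'n\<Rightarrow>real. descends Y f \<Longrightarrow> f y' = f y" using closed_cell_rep[OF ycl] by metis
      obtain j where j: "j \<in> I" "dist j y' < \<delta>" using I(3) y'(1) by auto
      have ph: "\<phi> (y', z) = \<phi> (y, z)" using y'(2)[OF fdy[OF yz(2)]] .
      have rh: "\<rho> y' = \<rho> y" using y'(2)[OF \<rho>(2)] .
      have "y' \<in> T" using y'(1) cellT by blast
      from max[OF j(1) this yz(2)] have "\<phi> (y, z) / (W j y' * \<Psi> j z) \<le> \<phi> (y, z) / (W i y * \<Psi> i z)"
        by (simp add: R_def M_def ph)
      then have "W i y * \<Psi> i z \<le> W j y' * \<Psi> j z"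
        using phipos Wpos[of i y] Wpos[of j y'] \<Psi>(4)[OF i(1) yz(2)] \<Psi>(4)[OF j(1) yz(2)]
        by (simp add: divide_le_cancel frac_le_eq field_simps)
      then have "exp (Kr * \<rho> y) * (exp (D i y) * \<Psi> i z) \<le> exp (Kr * \<rho> y) * (exp (D j y') * \<Psi> j z)"
        by (simp add: W_def exp_add rh mult.assoc mult.left_commute)
      then have 1: "exp (D i y) * \<Psi> i z \<le> exp (D j y') * \<Psi> j z" by simp
      have "exp (D i y) * 1 \<le> exp (D i y) * (B * \<Psi> i z)" using B(2)[OF i(1) yz(2)] by (intro mult_left_mono) auto
      also have "\<dots> = B * (exp (D i y) * \<Psi> i z)" by simp
      also have "\<dots> \<le> B * (exp (D j y') * \<Psi> j z)" using 1 B0 by (intro mult_left_mono) auto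
      also have "\<dots> \<le> B * (exp (D j y') * B)" using B(1)[OF j(1) yz(2)] B0 by (intro mult_left_mono) auto
      also have "\<dots> = exp (D j y') * (B * B)" by simp
      also have "\<dots> \<le> exp (N * \<delta>\<^sup>2) * exp (N * (3 * \<delta>\<^sup>2))"
      proof (rule mult_mono)
        have "(norm (y' - j))\<^sup>2 \<le> \<delta>\<^sup>2" using j(2) by (intro power_mono) (auto simp: dist_norm norm_minus_commute)
        then have "D j y' \<le> N * \<delta>\<^sup>2" unfolding D_def using N(1) by (intro mult_left_mono)
        then show "exp (D j y') \<le> exp (N * \<delta>\<^sup>2)" by simp
        show "B * B \<le> exp (N * (3 * \<delta>\<^sup>2))" unfolding N(2) using exp_ge_add_one_self[of "B * B"] by linarith
      qed (use B0 in auto)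
      also have "\<dots> = exp (N * (2 * \<delta>)\<^sup>2)" by (simp add: exp_add[symmetric] power2_eq_square algebra_simps)
      finally have D4: "N * (norm (y - i))\<^sup>2 \<le> N * (2 * \<delta>)\<^sup>2" by (simp add: D_def)
      have "N > 0"
      proof -
        have "B \<noteq> 0" using B(2)[OF i(1) yz(2)] by auto
        then have "B > 0" using B0 by simp
        then show ?thesis using \<delta>(1) by (simp add: N_def)
      qed
      with D4 have sq: "(norm (y - i))\<^sup>2 \<le> (2 * \<delta>)\<^sup>2" by (simp add: mult_le_cancel_left_pos)
      have "norm (y - i) \<le> 2 * \<delta>" by (rule power2_le_imp_le[OF sq]) (use \<delta>(1) in simp)
      then show ?thesis by (simp add: dist_norm norm_minus_commute)
    qed
    have ballT: "y' \<in> T" if "y' \<in> clY" "y' \<in> ball y (1/2)" for y'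
    proof (rule nearT[OF i(1) _ that(1)])
      have "dist i y' \<le> dist i y + dist y y'" by (rule dist_triangle)
      then show "dist i y' \<le> 1" using near \<delta>(2) that(2) by simp
    qed
    have half: "(1/2 :: real) > 0" by simp
    have ytouch: "y \<in> cover Y \<and> LY (\<lambda>y. \<phi> (y, z)) y \<le> LY (\<lambda>y. (M * \<Psi> i z) * W i y) y"
      if zZ: "z \<in> cover Z"
    proof (rule Y.touching[OF ycl f(4)[OF zZ] _ _ _ half])
      show "C2on (cover Y) (\<lambda>y. (M * \<Psi> i z) * W i y)" by (rule C2on_cmult[OF Y.open_cover Y.subset_cover[OF W2]])
      show "continuous_on clY (\<lambda>y. \<phi> (y, z))" by (rule cont_slice_y[OF f(1) yz(2)])
      show "continuous_on clY (\<lambda>y. (M * \<Psi> i z) * W i y)" by (intro continuous_intros Wc)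
      show "\<phi> (y', z) \<le> (M * \<Psi> i z) * W i y'" if "y' \<in> clY" "y' \<in> ball y (1/2)" for y'
        using le[OF ballT[OF that] yz(2)] by (simp add: ac_simps)
      show "\<phi> (y, z) = (M * \<Psi> i z) * W i y" using eq by (simp add: ac_simps)
      show "conormal Y A (\<lambda>y. \<phi> (y, z)) y 0" if "y \<in> frontier (cover Y)" by (rule f(8)[OF that zZ])
      show "\<exists>\<kappa>>0. conormal Y A (\<lambda>y. (M * \<Psi> i z) * W i y) y \<kappa>" if fr: "y \<in> frontier (cover Y)"
      proof -
        obtain \<mu> where "\<mu> > 0" "conormal Y A (W i) y \<mu>" using Wflux[OF i(1) fr] by blast
        then show ?thesis
          using Y.conormal_lincomb[OF fr Y.subset_cover[OF W2] Y.subset_cover[OF W2], of i \<mu> i \<mu> "M * \<Psi> i z" 0] M \<Psi>(4)[OF i(1) yz(2)]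
          by (intro exI[of _ "M * \<Psi> i z * \<mu>"]) auto
      qed
    qed
    have ztouch: "z \<in> cover Z \<and> LZ (\<lambda>z. \<phi> (y, z)) z \<le> LZ (\<lambda>z. (M * W i y) * \<Psi> i z) z"
      if yY: "y \<in> cover Y"
    proof (rule Z.touching[OF yz(2) f(5)[OF yY] _ _ _ half])
      show "C2on (cover Z) (\<lambda>z. (M * W i y) * \<Psi> i z)" by (rule C2on_cmult[OF Z.open_cover \<Psi>(1)[OF i(1)]])
      show "continuous_on clZ (\<lambda>z. \<phi> (y, z))" by (rule cont_slice_z[OF f(1) ycl])
      show "continuous_on clZ (\<lambda>z. (M * W i y) * \<Psi> i z)" by (intro continuous_intros \<Psi>(2)[OF i(1)])
      show "\<phi> (y, z') \<le> (M * W i y) * \<Psi> i z'" if "z' \<in> clZ" for z'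
        using le[OF yz(1) that] by (simp add: mult.assoc)
      show "\<phi> (y, z) = (M * W i y) * \<Psi> i z" using eq by (simp add: mult.assoc)
      show "conormal Z a (\<lambda>z. \<phi> (y, z)) z 0" if "z \<in> frontier (cover Z)" by (rule f(7)[OF yY that])
      show "\<exists>\<kappa>>0. conormal Z a (\<lambda>z. (M * W i y) * \<Psi> i z) z \<kappa>" if fr: "z \<in> frontier (cover Z)"
      proof -
        obtain \<mu> where "\<mu> > 0" "conormal Z a (\<Psi> i) z \<mu>" using \<Psi>(6)[OF i(1) fr] by blast
        then show ?thesis
          using Z.conormal_lincomb[OF fr \<Psi>(1)[OF i(1)] \<Psi>(1)[OF i(1)], of \<mu> \<mu> "M * W i y" 0] M Wpos[of i y]
          by (intro exI[of _ "M * W i y * \<mu>"]) auto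
      qed
    qed
    \<comment> \<open>at a boundary point of \<open>Y\<close> the other space is a torus, so that the slice in \<open>y\<close> is admissible\<close>
    have yY: "y \<in> cover Y"
    proof (rule ccontr)
      assume ny: "y \<notin> cover Y"
      then have "Y \<noteq> Torus" by auto
      then have "z \<in> cover Z" using torus by auto
      then show False using ytouch ny by blast
    qed
    have zZ: "z \<in> cover Z" using ztouch[OF yY] by blast
    have ly: "LY (\<lambda>y. \<phi> (y, z)) y \<le> C * \<phi> (y, z)"
    proof -
      have "LY (\<lambda>y. \<phi> (y, z)) y \<le> (M * \<Psi> i z) * LY (W i) y"
        using ytouch[OF zZ] unfolding Y.opLz_cmult[OF yY Y.subset_cover[OF W2]] by blast
      also have "\<dots> \<le> (M * \<Psi> i z) * (C * W i y)"
        using C[OF i(1) yz(1) yY] M \<Psi>(4)[OF i(1) yz(2)] by (intro mult_left_mono) auto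
      also have "\<dots> = C * \<phi> (y, z)" unfolding eq by simp
      finally show ?thesis .
    qed
    have lz: "LZ (\<lambda>z. \<phi> (y, z)) z + c (i, z) * \<phi> (y, z) \<le> (K + e/2) * \<phi> (y, z)"
    proof -
      have "LZ (\<lambda>z. \<phi> (y, z)) z \<le> (M * W i y) * LZ (\<Psi> i) z"
        using ztouch[OF yY] unfolding Z.opLz_cmult[OF zZ \<Psi>(1)[OF i(1)]] by blast
      moreover have "(M * W i y) * (LZ (\<Psi> i) z + c (i, z) * \<Psi> i z) \<le> (M * W i y) * ((K + e/2) * \<Psi> i z)"
        using \<Psi>(5)[OF i(1) zZ] M Wpos[of i y] by (intro mult_left_mono) auto
      ultimately show ?thesis unfolding eq by (simp add: algebra_simps)
    qed
    have "c (y, z) - c (i, z) \<le> e / 2"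
    proof -
      have "c (y, z) - c (i, z) \<le> L * dist y i" using c_lip_y[OF ycl Icl[OF i(1)] yz(2)] by linarith
      also have "\<dots> \<le> L * (2 * \<delta>)" using near L_nonneg by (intro mult_left_mono) (auto simp: dist_commute)
      finally show ?thesis using \<delta>(3) by linarith
    qed
    then have cc: "(c (y, z) - c (i, z)) * \<phi> (y, z) \<le> e / 2 * \<phi> (y, z)"
      using phipos by (intro mult_right_mono) auto
    have "\<epsilon>\<^sup>2 * LY (\<lambda>y. \<phi> (y, z)) y \<le> \<epsilon>\<^sup>2 * (C * \<phi> (y, z))"
      using ly by (intro mult_left_mono) auto
    with lz cc f(6)[OF yY zZ] have "k * \<phi> (y, z) \<le> (K + e + \<epsilon>\<^sup>2 * C) * \<phi> (y, z)"
      by (simp add: algebra_simps)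
    then show ?thesis using phipos by simp
  qed
  then show ?thesis using C0 by blast
qed

section \<open>Convergence\<close>

lemma kloc_lipschitz:
  assumes loc: "\<And>y. y \<in> clY \<Longrightarrow> Z.neumann_eigen (\<lambda>z. c (y, z)) (\<psi> y) (kloc y)" and y: "y \<in> clY" "y' \<in> clY"
  shows "kloc y \<le> kloc y' + L * dist y y'"
proof (rule Z.eigenvalue_compare[OF loc[OF y(1)] loc[OF y(2)] cont_slice_z[OF c_cont y(2)] c_desc_z[OF y(2)]])
  fix z assume "z \<in> cover Z"
  then have "z \<in> clZ" using closure_subset by blast
  then show "c (y, z) - c (y', z) \<le> L * dist y y'" using c_lip_y[OF y] by (metis abs_le_D1)
qed

text \<open>
  The local eigenvalue is continuous and, for a torus, periodic: points with the same \<open>c\<close> have the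
  same eigenvalue.  So it is enough to maximise over a compact cell.
\<close>

lemma kloc_max:
  assumes loc: "\<And>y. y \<in> clY \<Longrightarrow> Z.neumann_eigen (\<lambda>z. c (y, z)) (\<psi> y) (kloc y)"
  obtains ymax where "ymax \<in> clY" "\<And>y. y \<in> clY \<Longrightarrow> kloc y \<le> kloc ymax"
proof -
  have ne: "closed_cell Y \<noteq> {}"
    using cover_nonempty[OF Y.adm] closed_cell_rep closure_subset by (metis empty_iff equals0I subsetD)
  have "L-lipschitz_on (closed_cell Y) kloc"
  proof (rule lipschitz_onI[OF _ L_nonneg])
    fix x y assume "x \<in> closed_cell Y" "y \<in> closed_cell Y"
    then have xy: "x \<in> clY" "y \<in> clY" using closed_cell_subset by blast+
    show "dist (kloc x) (kloc y) \<le> L * dist x y"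
      using kloc_lipschitz[OF loc xy] kloc_lipschitz[OF loc xy(2,1)] by (simp add: dist_real_def dist_commute abs_le_iff)
  qed
  then obtain ymax where ym: "ymax \<in> closed_cell Y" "\<forall>y\<in>closed_cell Y. kloc y \<le> kloc ymax"
    using continuous_attains_sup[OF compact_closed_cell[OF Y.adm] ne lipschitz_on_continuous_on] by blast
  show ?thesis
  proof (rule that)
    show "ymax \<in> clY" using ym(1) closed_cell_subset by blast
    fix y assume y: "y \<in> clY"
    obtain y' where y': "y' \<in> closed_cell Y" "\<And>f::real^'n\<Rightarrow>real. descends Y f \<Longrightarrow> f y' = f y" using closed_cell_rep[OF y] by metis
    have y'c: "y' \<in> clY" using y'(1) closed_cell_subset by blast
    have "kloc y \<le> kloc y' + 0"
    proof (rule Z.eigenvalue_compare[OF loc[OF y] loc[OF y'c] cont_slice_z[OF c_cont y'c] c_desc_z[OF y'c]])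
      fix z assume "z \<in> cover Z"
      then have "z \<in> clZ" using closure_subset by blast
      then show "c (y, z) - c (y', z) \<le> 0" using y'(2)[OF c_desc_y] by simp
    qed
    then show "kloc y \<le> kloc ymax" using ym(2) y'(1) by force
  qed
qed

text \<open>
  The lower bound is available at interior points only; \<open>ymax\<close> is approximated by such a point, at a
  cost controlled by the Lipschitz estimate.
\<close>

lemma eigenvalue_limit:
  assumes loc: "\<And>y. y \<in> clY \<Longrightarrow> Z.neumann_eigen (\<lambda>z. c (y, z)) (\<psi> y) (kloc y)"
    and glob: "\<And>\<epsilon>. \<epsilon> > 0 \<Longrightarrow> slicewise_solution \<epsilon> (\<phi> \<epsilon>) (k \<epsilon>)"
    and ym: "ymax \<in> clY" "\<And>y. y \<in> clY \<Longrightarrow> kloc y \<le> kloc ymax"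
  shows "(k \<longlongrightarrow> kloc ymax) (at_right 0)"
proof (rule tendstoI)
  fix e :: real assume e: "e > 0"
  have small: "\<forall>\<^sub>F \<epsilon> in at_right 0. \<epsilon>\<^sup>2 * C < e / 4" for C :: real
  proof (rule order_tendstoD)
    have "((\<lambda>\<epsilon>. \<epsilon>\<^sup>2 * C) \<longlongrightarrow> 0\<^sup>2 * C) (at_right 0)" by (intro tendsto_intros)
    then show "((\<lambda>\<epsilon>. \<epsilon>\<^sup>2 * C) \<longlongrightarrow> 0) (at_right 0)" by simp
  qed (use e in simp)
  have "\<exists>C\<ge>0. \<forall>\<epsilon>>0. \<forall>\<phi> k. slicewise_solution \<epsilon> \<phi> k \<longrightarrow> k \<le> kloc ymax + e/2 + \<epsilon>\<^sup>2 * C"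
  proof (rule upper_bound)
    show "\<exists>\<psi> kk. Z.neumann_eigen (\<lambda>z. c (y, z)) \<psi> kk \<and> kk \<le> kloc ymax" if "y \<in> closed_cell Y" for y
    proof -
      have "y \<in> clY" using that closed_cell_subset by blast
      then show ?thesis using loc ym(2) by blast
    qed
  qed (use e in simp)
  then obtain C1 where C1: "\<And>\<epsilon>. \<epsilon> > 0 \<Longrightarrow> k \<epsilon> \<le> kloc ymax + e/2 + \<epsilon>\<^sup>2 * C1" using glob by blast
  define s where "s = e / (4 * (L + 1))"
  have s: "s > 0" "L * s < e / 4" using e L_nonneg by (auto simp: s_def field_simps)
  obtain y0 where y0: "y0 \<in> cover Y" "dist y0 ymax < s" using ym(1) s(1) closure_approachable by blast
  obtain d where d: "d > 0" "cball y0 d \<subseteq> cover Y" using y0(1) Y.open_cover open_contains_cball by blast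
  define \<delta> where "\<delta> = min d s"
  have \<delta>: "\<delta> > 0" "cball y0 \<delta> \<subseteq> cover Y" "\<delta> \<le> s" using d s(1) by (auto simp: \<delta>_def)
  have y0c: "y0 \<in> clY" using y0(1) closure_subset by blast
  obtain C2 where C2: "\<And>\<epsilon>. \<epsilon> > 0 \<Longrightarrow> kloc y0 - L * \<delta> - \<epsilon>\<^sup>2 * C2 \<le> k \<epsilon>"
    using lower_bound[OF \<delta>(1,2) loc[OF y0c]] glob by blast
  have "L * \<delta> \<le> L * s" "L * dist ymax y0 \<le> L * s"
    using \<delta>(3) y0(2) L_nonneg by (auto intro!: mult_left_mono simp: dist_commute)
  then have low: "kloc ymax - kloc y0 + L * \<delta> < e / 2"
    using kloc_lipschitz[OF loc ym(1) y0c] s(2) by linarith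
  have "\<forall>\<^sub>F \<epsilon>::real in at_right 0. \<epsilon> > 0" by (simp add: eventually_at_filter)
  with small[of C1] small[of C2] show "\<forall>\<^sub>F \<epsilon> in at_right 0. dist (k \<epsilon>) (kloc ymax) < e"
  proof eventually_elim
    case (elim \<epsilon>)
    show ?case using C1[OF elim(3)] C2[OF elim(3)] elim(1,2) low e by (simp add: dist_real_def abs_less_iff)
  qed
qed

end

theorem theorem1p2:
  fixes Y :: "(real^'n) space" and Z :: "(real^'p) space"
    and \<alpha> :: real
    and A :: "real^'n \<Rightarrow> real^'n^'n" and B :: "real^'n \<Rightarrow> real^'n"
    and a :: "real^'p \<Rightarrow> real^'p^'p" and b :: "real^'p \<Rightarrow> real^'p"
    and c :: "(real^'n) \<times> (real^'p) \<Rightarrow> real"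
    and \<phi> :: "real \<Rightarrow> (real^'n) \<times> (real^'p) \<Rightarrow> real" and k :: "real \<Rightarrow> real"
    and \<psi> :: "real^'n \<Rightarrow> real^'p \<Rightarrow> real" and kloc :: "real^'n \<Rightarrow> real"
  assumes alpha: "0 < \<alpha>" "\<alpha> < 1"
    and spaces: "admissible \<alpha> Y" "admissible \<alpha> Z" "Y = Torus \<or> Z = Torus"
    and A: "holder_space 2 \<alpha> Y A" "symmetric_elliptic Y A"
    and a: "holder_space 2 \<alpha> Z a" "symmetric_elliptic Z a"
    and B: "holder_space 1 \<alpha> Y B"
    and b: "holder_space 1 \<alpha> Z b"
    and c: "descendsW Y Z c" "\<exists>L. L-lipschitz_on (closure (coverW Y Z)) c"
    and no_flux: "\<forall>(y, z)\<in>frontier (coverW Y Z). \<forall>\<nu>.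
      outward_unit_normal (coverW Y Z) (y, z) \<nu> \<longrightarrow> (B y, b z) \<bullet> \<nu> = 0"
    and global: "\<And>\<epsilon>. \<epsilon> > 0 \<Longrightarrow> global_eigenpair \<alpha> Y Z A B a b c \<epsilon> (\<phi> \<epsilon>) (k \<epsilon>)"
    and local: "\<And>y0. y0 \<in> closure (cover Y) \<Longrightarrow> local_eigenpair \<alpha> Z a b c y0 (\<psi> y0) (kloc y0)"
    and B_zero: "\<forall>y\<in>closure (cover Y). B y = 0"
  shows "\<exists>ymax\<in>closure (cover Y).
    (\<forall>y\<in>closure (cover Y). kloc y \<le> kloc ymax) \<and> (k \<longlongrightarrow> kloc ymax) (at_right 0)"
proof -
  obtain L where L: "L-lipschitz_on (closure (coverW Y Z)) c" using c(2) by blast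
  have bC1: "C1_up_to_boundary (cover Z) b"
    using holder_on_C1_up_to_boundary[OF alpha(1), of 0 "cover Z" b] open_cover_admissible[OF spaces(2)] b
    by (simp add: holder_space_def)
  interpret product_problem Y Z A a b \<alpha> c L
  proof (intro product_problem.intro elliptic_space.intro elliptic_space_axioms.intro product_problem_axioms.intro)
    show "elliptic_op Y A (\<lambda>_. 0)"
      by (rule elliptic_op_intro[OF alpha(1) spaces(1) A(1)[unfolded numeral_2_eq_2] A(2) C1_up_to_boundary_const])
    show "elliptic_op Z a b"
      by (rule elliptic_op_intro[OF alpha(1) spaces(2) a(1)[unfolded numeral_2_eq_2] a(2) bC1])
  qed (use alpha spaces c(1) L in auto)
  have loc: "Z.neumann_eigen (\<lambda>z. c (y, z)) (\<psi> y) (kloc y)" if "y \<in> closure (cover Y)" for y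
    by (rule Z.local_neumann_eigen[OF local[OF that]])
  have glob: "slicewise_solution \<epsilon> (\<phi> \<epsilon>) (k \<epsilon>)" if "\<epsilon> > 0" for \<epsilon>
    by (rule slicewise_solutionI[OF global[OF that] B_zero])
  obtain ymax where "ymax \<in> closure (cover Y)" "\<And>y. y \<in> closure (cover Y) \<Longrightarrow> kloc y \<le> kloc ymax"
    using kloc_max[OF loc] by blast
  with eigenvalue_limit[OF loc glob this] show ?thesis by blast
qed

end
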